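(* Let $q=f/g$, where $f,g\in\mathbb{Q}[x,y,z]$ and $g$ has an isolated zero at the origin $O\in\mathbb{R}^3$, and let $X(q)\subset\mathbb{C}^3$ be the discriminant variety associated to $q$. Denote by $X_1,\dots,X_k$ the relevant irreducible components of $X(q)$ of dimension one, and by $X_{k+1},\dots,X_n$ the relevant irreducible components of $X(q)$ of dimension two. Let $L\in\mathbb{R}$. Then the limit of $q$ as $(x,y,z)\to O$ (in $\mathbb{R}^3\setminus\{O\}$) exists and equals $L$ if and only if, for every $i=1,\dots,n$, the limit of $q(x,y,z)$ as $(x,y,z)\to O$ along $X_i$ exists and equals $L$. Moreover: (1) Let $1\le i\le k$, and permute the coordinates so that $x$ does not vanish identically on $X_i$. Let $\lambda\in\mathbb{R}$ be any constant for which $u=y+\lambda z$ is a primitive element as described in the context (applied to $X=X_i$), and let $\mu:X_{i,0}\to Y_{i,0}$, $\mu(a,b,c)=(a,b+\lambda c)$, be the corresponding isomorphism between open subsets of $X_i$ and of the plane curve $Y_i$ described there. Then the limit of $q$ along $X_i$ as $(x,y,z)\to O$ exists if and only if the limit of $q\circ\mu^{-1}$ along $Y_i$ as $(u,v)\to(0,0)$ exists, and the corresponding limits are related by $$\lim_{(x,y,z)\to O,\ (x,y,z)\in X_{i,0}} q(x,y,z)=\lim_{(u,v)\to (0,0),\ (u,v)\in Y_{i,0}} (q\circ\mu^{-1})(u,v).$$ (2) Let $k+1\le j\le n$, and write $X_j=V(h)$ with $h\in\mathbb{R}[x,y,z]$ irreducible. Let $A,B,C>0$ be real constants such that the variety $\mathfrak{X}$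 described in the context (for this $h$ and these $A,B,C$) has dimension less than $2$, and let $\mathcal{S},\mathfrak{Z}$ be the other varieties described there. Then the limit of $q(x,y,z)$ as $(x,y,z)\to O$ along $X_j$ exists and equals $L$ if and only if it exists and equals $L$ along each of the irreducible components of $\mathcal{S}$, $\mathfrak{X}$ and $\mathfrak{Z}$.
   Context: **Isolated zero.** $g$ has an isolated zero at $O$ means $g(O)=0$ and $g$ has no other real zero in some neighbourhood of $O$ in $\mathbb{R}^3$. **Varieties.** For an ideal $I$ of a polynomial ring with real coefficients, $V(I)$ is the set of common complex zeros. Irreducible components are taken with respect to prime ideals with real coefficients: the irreducible components of $V(I)$, $I\subset\mathbb{R}[x,y,z]$, are the sets $V(P)$ with $P$ a minimal prime of $I$ in $\mathbb{R}[x,y,z]$. The dimension of $V(P)$ is the Krull dimension of $\mathbb{R}[x,y,z]/P$. **Discriminant variety.** Writing $(x_1,x_2,x_3)=(x,y,z)$, put $$f_{x_i,x_j}=x_i\Big(g\frac{\partial f}{\partial x_j}-f\frac{\partial g}{\partial x_j}\Big)-x_j\Big(g\frac{\partial f}{\partial x_i}-f\frac{\partial g}{\partial x_i}\Big).$$ Then $X(q)=V(f_{x,y},f_{x,z},f_{y,z})\subset\mathbb{C}^3$. An irreducible component of $X(q)$ is relevant if it contains the origin $O$. **Limits along a variety.** For a variety $W\subset\mathbb{C}^3$ (or an open subset of one), "the limit of $q$ along $W$ as $(x,y,z)\to O$ exists and equals $L$" means: for every $\epsilon>0$ there is $\delta>0$ such that $|q(p)-L|<\epsilon$ for all real points $p\in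 W\cap\mathbb{R}^3$ with $0<|p|<\delta$. Similarly for plane curves and $(u,v)\to(0,0)$, where $q\circ\mu^{-1}$ is considered at the real points of $Y_0$ different from $(0,0)$; the limit along $Y$ means the limit along $Y_0$ ($Y\setminus Y_0$ is finite). "The limit exists" means that it equals some $L\in\mathbb{R}$. **Plane model of a space curve.** Let $X=V(P)\subset\mathbb{C}^3$, $P\subset\mathbb{R}[x,y,z]$ prime, be a one-dimensional irreducible variety containing $O$ on which $x$ does not vanish identically, so that $x$ is transcendental over $\mathbb{R}$ in the fraction field $\mathbb{R}(x,y,z)$ of $\mathbb{R}[x,y,z]/P$. Let $\lambda\in\mathbb{R}$ be such that $u=y+\lambda z$ is a primitive element, i.e. $\mathbb{R}(x,y,z)=\mathbb{R}(x,u)$; all real $\lambda$ except finitely many have this property. Let $J$ be the kernel of the $\mathbb{R}$-algebra map $\mathbb{R}[S,T]\to\mathbb{R}(x,y,z)$, $S\mapsto x$, $T\mapsto u$, and let $Y=V(J)\subset\mathbb{C}^2$, an irreducible plane curve. One can write $y=f_1(x,u)/g_1(x)$ and $z=f_2(x,u)/g_2(x)$ in $\mathbb{R}(x,u)$ with real polynomials $f_1,f_2$ and nonzero real polynomials $g_1,g_2$. Put $Z=\{(a,b)\in Y: g_1(a)=0\text{ or }g_2(a)=0\}$ (a finite set), $Y_0=Y\setminus Z$, $\mu:X\to Y$, $\mu(a,b,c)=(a,b+\lambda c)$, and $X_0=\mu^{-1}(Y_0)$. Then $\mu:X_0\to Y_0$ is an isomorphism with inverse $\mu^{-1}(d,e)=\big(d,\tfrac{f_1(d,e)}{g_1(d)},\tfrac{f_2(d,e)}{g_2(d)}\big)$,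 and $X\setminus X_0$ is finite. For $X=X_i$ these sets are denoted $Y_i$, $X_{i,0}$, $Y_{i,0}$. **Varieties attached to a surface.** For $h\in\mathbb{R}[x,y,z]$ irreducible and $A,B,C>0$ put: - $\mathcal{S}=V\big(h,\tfrac{\partial h}{\partial x},\tfrac{\partial h}{\partial y},\tfrac{\partial h}{\partial z}\big)$, the singular locus of $V(h)$; - $\mathfrak{X}=V(D,h)$, where $$D=\begin{vmatrix}Ax&By&Cz\\ x&y&z\\ \partial h/\partial x&\partial h/\partial y&\partial h/\partial z\end{vmatrix};$$ - $\mathfrak{Z}$, the variety defined by $h$ together with the $2\times2$ minors of $\begin{bmatrix}Ax&By&Cz\\ \partial h/\partial x&\partial h/\partial y&\partial h/\partial z\end{bmatrix}$.
   Formalization: Assumes X(q) is not all of C^3; in (1), for every primitive λ only "limit along Y implies the same limit along X" is claimed, and the full claim is for λ such that real points of X_i projecting near (0,0) lie near O, proved to be all but finitely many λ. *)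

theory Defs
  imports
    "HOL-Algebra.Generated_Fields"
    "HOL-Algebra.QuotRing"
    "HOL-Decision_Procs.Algebra_Aux"
    "HOL-Computational_Algebra.Polynomial_Factorial"
    "HOL-Analysis.Analysis"
    "HOL-Library.Extended_Nat"
begin

section \<open>Commutative algebra\<close>

definition minimal_primes :: "('a, 'm) ring_scheme \<Rightarrow> 'a set \<Rightarrow> 'a set set" where
  "minimal_primes R I =
    {P. primeideal P R \<and> I \<subseteq> P \<and> (\<forall>Q. primeideal Q R \<and> I \<subseteq> Q \<and> Q \<subseteq> P \<longrightarrow> Q = P)}"

text \<open>The supremum of the lengths \<open>n\<close> of chains of primes \<open>C 0 \<subset> \<dots> \<subset> C n\<close>.
  It is only ever applied to domains; the zero ring would get the junk value \<open>0\<close>.\<close>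

definition krull_dim :: "('a, 'm) ring_scheme \<Rightarrow> enat" where
  "krull_dim R =
    Sup {enat n | n. \<exists>C. (\<forall>i\<le>n. primeideal (C i) R) \<and> (\<forall>i<n. C i \<subset> C (Suc i))}"

text \<open>The fraction field of a domain; \<open>fraction R a b\<close> is the class of all pairs \<open>(c, d)\<close>
  with \<open>c / d = a / b\<close>.\<close>

definition fraction :: "('a, 'm) ring_scheme \<Rightarrow> 'a \<Rightarrow> 'a \<Rightarrow> ('a \<times> 'a) set" where
  "fraction R a b =
    {(c, d). c \<in> carrier R \<and> d \<in> carrier R - {\<zero>\<^bsub>R\<^esub>} \<and> a \<otimes>\<^bsub>R\<^esub> d = c \<otimes>\<^bsub>R\<^esub> b}"

definition fraction_field :: "('a, 'm) ring_scheme \<Rightarrow> ('a \<times> 'a) set ring" where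
  "fraction_field R =
    \<lparr>carrier = {fraction R a b | a b. a \<in> carrier R \<and> b \<in> carrier R - {\<zero>\<^bsub>R\<^esub>}},
     monoid.mult = (\<lambda>U V. \<Union>((a, b), (c, d)) \<in> U \<times> V. fraction R (a \<otimes>\<^bsub>R\<^esub> c) (b \<otimes>\<^bsub>R\<^esub> d)),
     one = fraction R \<one>\<^bsub>R\<^esub> \<one>\<^bsub>R\<^esub>,
     zero = fraction R \<zero>\<^bsub>R\<^esub> \<one>\<^bsub>R\<^esub>,
     add = (\<lambda>U V. \<Union>((a, b), (c, d)) \<in> U \<times> V.
       fraction R ((a \<otimes>\<^bsub>R\<^esub> d) \<oplus>\<^bsub>R\<^esub> (c \<otimes>\<^bsub>R\<^esub> b)) (b \<otimes>\<^bsub>R\<^esub> d))\<rparr>"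


section \<open>Real polynomials in one, two and three variables\<close>

text \<open>\<open>\<real>[x, y, z]\<close> is the iterated polynomial ring \<open>\<real>[x][y][z]\<close>, whose outermost variable is
  \<open>z\<close>, and \<open>\<real>[S, T]\<close> is \<open>\<real>[S][T]\<close>. As rings in the sense of HOL-Algebra they are
  \<open>cring_class_ops\<close>. The index type \<open>3\<close> numbers the variables \<open>x, y, z\<close> by \<open>1, 2, 3\<close>.\<close>

type_synonym poly2 = "real poly poly"
type_synonym poly3 = "real poly poly poly"

definition const :: "real \<Rightarrow> poly3" where
  "const a = [:[:[:a:]:]:]"

definition var :: "3 \<Rightarrow> poly3" where
  "var i = (vector [[:[:[:0, 1:]:]:], [:[:0, 1:]:], [:0, 1:]] :: poly3 ^ 3) $ i"

definition pd :: "3 \<Rightarrow> poly3 \<Rightarrow> poly3" where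
  "pd i p = (vector [map_poly (map_poly pderiv) p, map_poly pderiv p, pderiv p] :: poly3 ^ 3) $ i"

definition rational_coeffs :: "poly3 \<Rightarrow> bool" where
  "rational_coeffs p \<longleftrightarrow> (\<forall>i j k. coeff (coeff (coeff p i) j) k \<in> \<rat>)"

text \<open>Evaluation in a commutative ring into which the coefficients are mapped by \<open>c\<close>.\<close>

definition eval1 :: "(real \<Rightarrow> 'a::comm_ring_1) \<Rightarrow> real poly \<Rightarrow> 'a \<Rightarrow> 'a" where
  "eval1 c p s = poly (map_poly c p) s"

definition eval2 :: "(real \<Rightarrow> 'a::comm_ring_1) \<Rightarrow> poly2 \<Rightarrow> 'a \<Rightarrow> 'a \<Rightarrow> 'a" where
  "eval2 c p s t = poly (map_poly (\<lambda>r. eval1 c r s) p) t"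

definition eval3 :: "(real \<Rightarrow> 'a::comm_ring_1) \<Rightarrow> poly3 \<Rightarrow> 'a ^ 3 \<Rightarrow> 'a" where
  "eval3 c p v = poly (map_poly (\<lambda>r. eval2 c r (v $ 1) (v $ 2)) p) (v $ 3)"


section \<open>Varieties and their real points\<close>

abbreviation poly_ideal :: "poly3 set \<Rightarrow> poly3 set" where
  "poly_ideal \<equiv> genideal cring_class_ops"

definition variety :: "poly3 set \<Rightarrow> (complex ^ 3) set" where
  "variety I = {p. \<forall>h\<in>I. eval3 of_real h p = 0}"

text \<open>The irreducible components of \<open>variety I\<close> are the sets \<open>variety P\<close> for \<open>P\<close> in
  \<open>component_primes I\<close>.\<close>

abbreviation component_primes :: "poly3 set \<Rightarrow> poly3 set set" where
  "component_primes \<equiv> minimal_primes cring_class_ops"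

definition variety_dim :: "poly3 set \<Rightarrow> enat" where
  "variety_dim P = krull_dim (cring_class_ops Quot P)"

definition real_points :: "(complex ^ 3) set \<Rightarrow> (real ^ 3) set" where
  "real_points W = {p. (\<chi> i. of_real (p $ i)) \<in> W}"

definition real_points2 :: "(complex \<times> complex) set \<Rightarrow> (real \<times> real) set" where
  "real_points2 W = {(d, e). (of_real d, of_real e) \<in> W}"

definition quotient_fun :: "poly3 \<Rightarrow> poly3 \<Rightarrow> real ^ 3 \<Rightarrow> real" where
  "quotient_fun f g p = eval3 (\<lambda>a. a) f p / eval3 (\<lambda>a. a) g p"

definition isolated_zero :: "poly3 \<Rightarrow> bool" where
  "isolated_zero g \<longleftrightarrow>
    eval3 (\<lambda>a. a) g (0 :: real ^ 3) = 0 \<and> (\<forall>\<^sub>F p :: real ^ 3 in at 0. eval3 (\<lambda>a. a) g p \<noteq> 0)"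

text \<open>Since \<open>at 0 within S\<close> ignores the point \<open>0\<close>, this is the limit over the real points
  \<open>p \<noteq> 0\<close> of \<open>W\<close>. It holds for every \<open>L\<close> if \<open>W\<close> has no such points near the origin.\<close>

definition limit_along :: "(real ^ 3 \<Rightarrow> real) \<Rightarrow> (complex ^ 3) set \<Rightarrow> real \<Rightarrow> bool" where
  "limit_along q W L \<longleftrightarrow> (q \<longlongrightarrow> L) (at 0 within real_points W)"


section \<open>The discriminant variety\<close>

definition disc_poly :: "poly3 \<Rightarrow> poly3 \<Rightarrow> 3 \<Rightarrow> 3 \<Rightarrow> poly3" where
  "disc_poly f g i j =
    var i * (g * pd j f - f * pd j g) - var j * (g * pd i f - f * pd i g)"

definition disc_ideal :: "poly3 \<Rightarrow> poly3 \<Rightarrow> poly3 set" where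
  "disc_ideal f g = poly_ideal {disc_poly f g 1 2, disc_poly f g 1 3, disc_poly f g 2 3}"

text \<open>If \<open>variety (disc_ideal f g)\<close> is all of \<open>\<complex>\<^sup>3\<close>, e.g. for \<open>f = g\<close>, then its only component has
  dimension three. There are then no components of dimensions one and two to test the limit
  on, so this case has to be excluded.\<close>

definition relevant_components :: "poly3 \<Rightarrow> poly3 \<Rightarrow> enat \<Rightarrow> poly3 set set" where
  "relevant_components f g d =
    {P \<in> component_primes (disc_ideal f g). 0 \<in> variety P \<and> variety_dim P = d}"


section \<open>The plane model of a space curve\<close>

text \<open>The coordinates are permuted by \<open>\<sigma>\<close>: below, the roles of \<open>x, y, z\<close> are played by the
  variables \<open>\<sigma> 1, \<sigma> 2, \<sigma> 3\<close>, and \<open>u = y + \<kappa> z\<close>. The set \<open>P\<close> is the prime ideal of the space curve.\<close>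

definition function_field :: "poly3 set \<Rightarrow> (poly3 set \<times> poly3 set) set ring" where
  "function_field P = fraction_field (cring_class_ops Quot P)"

definition to_function_field :: "poly3 set \<Rightarrow> poly3 \<Rightarrow> (poly3 set \<times> poly3 set) set" where
  "to_function_field P h =
    fraction (cring_class_ops Quot P) (P +>\<^bsub>cring_class_ops\<^esub> h) (P +>\<^bsub>cring_class_ops\<^esub> 1)"

definition lin_form :: "(3 \<Rightarrow> 3) \<Rightarrow> real \<Rightarrow> poly3" where
  "lin_form \<sigma> \<kappa> = var (\<sigma> 2) + const \<kappa> * var (\<sigma> 3)"

definition primitive_element :: "poly3 set \<Rightarrow> (3 \<Rightarrow> 3) \<Rightarrow> real \<Rightarrow> bool" where
  "primitive_element P \<sigma> \<kappa> \<longleftrightarrow>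
    generate_field (function_field P)
      (to_function_field P ` (range const \<union> {var (\<sigma> 1), lin_form \<sigma> \<kappa>}))
    = carrier (function_field P)"

text \<open>\<open>k = f(x, u) / g(x)\<close> in the function field.\<close>

definition represents :: "poly3 set \<Rightarrow> (3 \<Rightarrow> 3) \<Rightarrow> real \<Rightarrow> poly3 \<Rightarrow> poly2 \<Rightarrow> real poly \<Rightarrow> bool" where
  "represents P \<sigma> \<kappa> k f g \<longleftrightarrow>
    to_function_field P k =
      to_function_field P (eval2 const f (var (\<sigma> 1)) (lin_form \<sigma> \<kappa>))
      \<otimes>\<^bsub>function_field P\<^esub>
      inv\<^bsub>function_field P\<^esub> (to_function_field P (eval1 const g (var (\<sigma> 1))))"

definition plane_model ::
  "poly3 set \<Rightarrow> (3 \<Rightarrow> 3) \<Rightarrow> real \<Rightarrow> poly2 \<Rightarrow> real poly \<Rightarrow> poly2 \<Rightarrow> real poly \<Rightarrow> bool" where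
  "plane_model P \<sigma> \<kappa> f1 g1 f2 g2 \<longleftrightarrow>
    primitive_element P \<sigma> \<kappa> \<and> g1 \<noteq> 0 \<and> g2 \<noteq> 0 \<and>
    represents P \<sigma> \<kappa> (var (\<sigma> 2)) f1 g1 \<and> represents P \<sigma> \<kappa> (var (\<sigma> 3)) f2 g2"

definition plane_ideal :: "poly3 set \<Rightarrow> (3 \<Rightarrow> 3) \<Rightarrow> real \<Rightarrow> poly2 set" where
  "plane_ideal P \<sigma> \<kappa> =
    a_kernel cring_class_ops (function_field P)
      (\<lambda>h. to_function_field P (eval2 const h (var (\<sigma> 1)) (lin_form \<sigma> \<kappa>)))"

definition plane_curve :: "poly3 set \<Rightarrow> (3 \<Rightarrow> 3) \<Rightarrow> real \<Rightarrow> (complex \<times> complex) set" where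
  "plane_curve P \<sigma> \<kappa> = {(a, b). \<forall>h\<in>plane_ideal P \<sigma> \<kappa>. eval2 of_real h a b = 0}"

definition plane_curve0 ::
  "poly3 set \<Rightarrow> (3 \<Rightarrow> 3) \<Rightarrow> real \<Rightarrow> real poly \<Rightarrow> real poly \<Rightarrow> (complex \<times> complex) set" where
  "plane_curve0 P \<sigma> \<kappa> g1 g2 =
    plane_curve P \<sigma> \<kappa> - {(a, b). eval1 of_real g1 a = 0 \<or> eval1 of_real g2 a = 0}"

definition proj :: "(3 \<Rightarrow> 3) \<Rightarrow> real \<Rightarrow> 'a::real_algebra_1 ^ 3 \<Rightarrow> 'a \<times> 'a" where
  "proj \<sigma> \<kappa> p = (p $ \<sigma> 1, p $ \<sigma> 2 + of_real \<kappa> * p $ \<sigma> 3)"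

definition space_curve0 ::
  "poly3 set \<Rightarrow> (3 \<Rightarrow> 3) \<Rightarrow> real \<Rightarrow> real poly \<Rightarrow> real poly \<Rightarrow> (complex ^ 3) set" where
  "space_curve0 P \<sigma> \<kappa> g1 g2 = {p \<in> variety P. proj \<sigma> \<kappa> p \<in> plane_curve0 P \<sigma> \<kappa> g1 g2}"

text \<open>The inverse of \<open>proj \<sigma> \<kappa>\<close> at the real points.\<close>

definition proj_inv ::
  "(3 \<Rightarrow> 3) \<Rightarrow> poly2 \<Rightarrow> real poly \<Rightarrow> poly2 \<Rightarrow> real poly \<Rightarrow> real \<times> real \<Rightarrow> real ^ 3" where
  "proj_inv \<sigma> f1 g1 f2 g2 = (\<lambda>(d, e). \<chi> i.
    if i = \<sigma> 1 then d
    else if i = \<sigma> 2 then eval2 (\<lambda>a. a) f1 d e / poly g1 d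
    else eval2 (\<lambda>a. a) f2 d e / poly g2 d)"

definition plane_limit ::
  "(real ^ 3 \<Rightarrow> real) \<Rightarrow> poly3 set \<Rightarrow> (3 \<Rightarrow> 3) \<Rightarrow> real \<Rightarrow>
    poly2 \<Rightarrow> real poly \<Rightarrow> poly2 \<Rightarrow> real poly \<Rightarrow> real \<Rightarrow> bool" where
  "plane_limit q P \<sigma> \<kappa> f1 g1 f2 g2 L \<longleftrightarrow>
    ((q \<circ> proj_inv \<sigma> f1 g1 f2 g2) \<longlongrightarrow> L)
      (at (0, 0) within real_points2 (plane_curve0 P \<sigma> \<kappa> g1 g2))"

text \<open>No real points of the curve other than those close to the origin are projected close to
  \<open>(0, 0)\<close>. Without this the comparison of limits fails, even if \<open>u\<close> is a primitive element:
  let \<open>f = (x\<^sup>2 + y\<^sup>2 + z\<^sup>2) (x + x y + y z)\<close> and \<open>g = x\<^sup>2 + y\<^sup>2 + z\<^sup>2\<close>. One component of the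
  discriminant variety is the closure of the curve with parametrisation
  \<open>x = (t\<^sup>2 - 1) / (t (t\<^sup>2 - 2))\<close>, \<open>y = 1 / (t\<^sup>2 - 2)\<close>, \<open>z = 1 / (t (t\<^sup>2 - 2))\<close>. The origin
  corresponds to \<open>t = \<infinity>\<close>, and \<open>f / g\<close> tends to \<open>0\<close> there. For \<open>\<kappa> = -1\<close> one has
  \<open>u = (t - 1) / (t (t\<^sup>2 - 2))\<close>, which is primitive because \<open>x / u = t + 1\<close>, but \<open>(x, u)\<close> also
  tends to \<open>(0, 0)\<close> as \<open>t\<close> tends to \<open>1\<close>, where \<open>(x, y, z)\<close> tends to \<open>(0, -1, -1)\<close> and
  \<open>f / g\<close> tends to \<open>1\<close>.\<close>

definition separates_origin :: "poly3 set \<Rightarrow> (3 \<Rightarrow> 3) \<Rightarrow> real \<Rightarrow> bool" where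
  "separates_origin P \<sigma> \<kappa> \<longleftrightarrow>
    (\<forall>\<epsilon>>0. \<exists>\<delta>>0. \<forall>p\<in>real_points (variety P). norm (proj \<sigma> \<kappa> p) < \<delta> \<longrightarrow> norm p < \<epsilon>)"


section \<open>Varieties attached to a surface\<close>

definition sing_ideal :: "poly3 \<Rightarrow> poly3 set" where
  "sing_ideal h = poly_ideal {h, pd 1 h, pd 2 h, pd 3 h}"

definition weighted_vars :: "real \<Rightarrow> real \<Rightarrow> real \<Rightarrow> poly3 ^ 3" where
  "weighted_vars A B C = vector [const A * var 1, const B * var 2, const C * var 3]"

definition crit_ideal :: "poly3 \<Rightarrow> real \<Rightarrow> real \<Rightarrow> real \<Rightarrow> poly3 set" where
  "crit_ideal h A B C =
    poly_ideal {det (vector [weighted_vars A B C, (\<chi> i. var i), (\<chi> i. pd i h)] :: poly3 ^ 3 ^ 3), h}"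

definition minor :: "'a::comm_ring_1 ^ 3 \<Rightarrow> 'a ^ 3 \<Rightarrow> 3 \<Rightarrow> 3 \<Rightarrow> 'a" where
  "minor v w i j = v $ i * w $ j - v $ j * w $ i"

definition tangency_ideal :: "poly3 \<Rightarrow> real \<Rightarrow> real \<Rightarrow> real \<Rightarrow> poly3 set" where
  "tangency_ideal h A B C =
    (let m = minor (weighted_vars A B C) (\<chi> i. pd i h)
     in poly_ideal {h, m 1 2, m 1 3, m 2 3})"

end

theory Submission
  imports Defs "HOL-Algebra.Ring_Divisibility" "HOL-Computational_Algebra.Field_as_Ring"
begin

text \<open>
  The criterion for the limit at the origin is a Lagrange multiplier argument. At an extremum of
  \<open>q = f / g\<close> on a sphere around the origin the derivative of \<open>q\<close> along every rotation is zero, and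
  these derivatives are the polynomials \<open>f\<^sub>x\<^sub>,\<^sub>y, f\<^sub>x\<^sub>,\<^sub>z, f\<^sub>y\<^sub>,\<^sub>z\<close> up to the factor \<open>g\<^sup>2\<close>
  (\<open>disc_poly_at_extremum\<close>). So every value of \<open>q\<close> lies between two values of \<open>q\<close> at points of the
  discriminant variety with the same distance from the origin. By Hilbert's basis theorem this
  variety has finitely many components, hence a limit along it is a limit along each of them. The
  components that miss the origin stay away from it, one of dimension zero through the origin has no
  other real point, and a proper subvariety of space has dimension at most two. The last fact
  comes from counting: four polynomials in three variables are algebraically dependent, while a
  relation between polynomials that separate the members of a chain \<open>C\<^sub>0 \<subset> \<dots> \<subset> C\<^sub>4\<close> of primes would have
  only zero coefficients, by looking at its lowest terms (\<open>no_prime_chain_4\<close>).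

  On a curve component any two coordinates satisfy a polynomial relation, since a prime without such
  a relation is generated by at most one polynomial and lies at the bottom of an explicit chain of
  length two (\<open>prime_chain_without_relation\<close>). So the curve has finitely many points over \<open>x = 0\<close>.
  Near the origin \<open>x\<close> and the denominators \<open>g\<^sub>1(x), g\<^sub>2(x)\<close> are therefore nonzero at the other real points
  of the curve, and the projection to the plane is inverted there by the given formulas; conversely
  the formulas give points of the curve because every polynomial in \<open>x, y, z\<close> is one in \<open>x, u\<close>
  modulo the prime, up to a power of \<open>g\<^sub>1 g\<^sub>2\<close> (\<open>clear_denominators\<close>). If \<open>(x, y + \<kappa> z)\<close> does not separate
  the origin, then either one of the finitely many other points over \<open>x = 0\<close> is projected to \<open>(0, 0)\<close>, or
  the curve goes to infinity with \<open>y / z\<close> tending to \<open>- \<kappa>\<close>. A relation between \<open>x\<close> and \<open>y / z\<close> leaves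
  finitely many such slopes.

  On a surface component \<open>V(h)\<close> the gradient of \<open>q\<close> is a multiple of the position vector, so \<open>q\<close> is
  constant along the curves in \<open>V(h)\<close> that stay on a sphere around the origin. Among the points of
  \<open>V(h)\<close> with a given small distance from the origin and a given value of \<open>q\<close>, take one at which
  \<open>A x\<^sup>2 + B y\<^sup>2 + C z\<^sup>2\<close> is maximal. If \<open>D\<close> did not vanish there, \<open>h\<close>, the squared distance and this
  form would be local coordinates, and moving along the third one would increase the form. So near
  the origin \<open>q\<close> takes all of its values on \<open>V(h)\<close> at the points of \<open>V(D, h)\<close>, without changing the
  distance (\<open>quotient_value_on_crit\<close>).\<close>

\<comment> \<open>\<open>irreducible\<close> is meant for polynomials here, not for elements of a monoid record\<close>
hide_const (open) Divisibility.irreducible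


section \<open>Ideals of commutative rings given by type classes\<close>

text \<open>The carrier of \<open>cring_class_ops\<close> is the whole type, so that ideals and primes can be described
  without carrier conditions; closure under negation follows from that under multiples.\<close>

lemma ideal_class_iff:
  "ideal I (cring_class_ops :: 'a::comm_ring_1 ring) \<longleftrightarrow>
    0 \<in> I \<and> (\<forall>a\<in>I. \<forall>b\<in>I. a + b \<in> I) \<and> (\<forall>a\<in>I. \<forall>x. x * a \<in> I)"
  (is "_ \<longleftrightarrow> ?r")
proof
  assume "ideal I (cring_class_ops :: 'a ring)"
  then interpret ideal I "cring_class_ops :: 'a ring" .
  show ?r
    using zero_closed a_closed I_l_closed by (auto simp: class_simps)
next
  assume r: ?r
  show "ideal I (cring_class_ops :: 'a ring)"
  proof (rule idealI)
    show "ring (cring_class_ops :: 'a ring)"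
      by (rule cring_class.ring_axioms)
    have "- a \<in> I" if "a \<in> I" for a
      using r that by (metis mult_minus1)
    then have "inv\<^bsub>add_monoid cring_class_ops\<^esub> a \<in> I" if "a \<in> I" for a
      using that by (metis a_inv_def uminus_class)
    then show "subgroup I (add_monoid (cring_class_ops :: 'a ring))"
      using r by unfold_locales (auto simp: cring_class_ops_def)
  qed (use r in \<open>auto simp: cring_class_ops_def mult.commute\<close>)
qed

lemma ideal_class_diff:
  assumes "ideal I (cring_class_ops :: 'a::comm_ring_1 ring)" "a \<in> I" "b \<in> I"
  shows "a - b \<in> I"
  using assms unfolding ideal_class_iff by (metis add_uminus_conv_diff mult_minus1)

lemma primeideal_class_iff:
  "primeideal P (cring_class_ops :: 'a::comm_ring_1 ring) \<longleftrightarrow>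
    ideal P cring_class_ops \<and> 1 \<notin> P \<and> (\<forall>a b. a * b \<in> P \<longrightarrow> a \<in> P \<or> b \<in> P)"
  (is "_ \<longleftrightarrow> ?r")
proof
  assume "primeideal P (cring_class_ops :: 'a ring)"
  then interpret primeideal P "cring_class_ops :: 'a ring" .
  have "1 \<notin> P"
    using one_imp_carrier I_notcarr by (auto simp: class_simps)
  then show ?r
    using I_prime ideal_axioms by (auto simp: class_simps)
next
  assume ?r
  then show "primeideal P (cring_class_ops :: 'a ring)"
    by (intro primeidealI) (auto simp: class_simps cring_class)
qed

lemma genideal_class_ideal: "ideal (genideal cring_class_ops S) (cring_class_ops :: 'a::comm_ring_1 ring)"
  by (rule ring.genideal_ideal[OF cring_class.ring_axioms]) (auto simp: carrier_class)

lemma genideal_class_self: "S \<subseteq> genideal (cring_class_ops :: 'a::comm_ring_1 ring) S"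
  by (rule ring.genideal_self[OF cring_class.ring_axioms]) (auto simp: carrier_class)

lemma genideal_class_subset_iff:
  assumes "ideal I (cring_class_ops :: 'a::comm_ring_1 ring)"
  shows "genideal cring_class_ops S \<subseteq> I \<longleftrightarrow> S \<subseteq> I"
  using genideal_class_self[of S] ring.genideal_minimal[OF cring_class.ring_axioms assms] by blast

lemma primeideal_class_power:
  assumes "primeideal P (cring_class_ops :: 'a::comm_ring_1 ring)" "a ^ n \<in> P"
  shows "a \<in> P"
  using assms by (induction n) (auto simp: primeideal_class_iff)


section \<open>Finiteness of the set of irreducible components\<close>

text \<open>Because of \<open>degree p \<le> n\<close> instead of \<open>degree p = n\<close>, this is an ideal, and it grows with \<open>n\<close>.\<close>

definition lead_ideal :: "nat \<Rightarrow> 'a::comm_ring_1 poly set \<Rightarrow> 'a set" where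
  "lead_ideal n I = {coeff p n | p. p \<in> I \<and> degree p \<le> n}"

lemma lead_ideal_ideal:
  assumes "ideal I (cring_class_ops :: 'a::comm_ring_1 poly ring)"
  shows "ideal (lead_ideal n I) (cring_class_ops :: 'a ring)"
proof -
  have "0 \<in> lead_ideal n I"
    using assms unfolding lead_ideal_def ideal_class_iff by (metis (mono_tags) coeff_0 degree_0 le0 mem_Collect_eq)
  moreover have "a + b \<in> lead_ideal n I" if ab: "a \<in> lead_ideal n I" "b \<in> lead_ideal n I" for a b
  proof -
    obtain p q where "a = coeff p n" "p \<in> I" "degree p \<le> n" "b = coeff q n" "q \<in> I" "degree q \<le> n"
      using ab by (auto simp: lead_ideal_def)
    then have "a + b = coeff (p + q) n \<and> p + q \<in> I \<and> degree (p + q) \<le> n"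
      using assms by (auto simp: ideal_class_iff degree_add_le)
    then show ?thesis
      unfolding lead_ideal_def by blast
  qed
  moreover have "x * a \<in> lead_ideal n I" if a: "a \<in> lead_ideal n I" for a x
  proof -
    obtain p where "a = coeff p n" "p \<in> I" "degree p \<le> n"
      using a by (auto simp: lead_ideal_def)
    then have "x * a = coeff ([:x:] * p) n \<and> [:x:] * p \<in> I \<and> degree ([:x:] * p) \<le> n"
      using assms order_trans[OF degree_smult_le, of p n x] by (auto simp: ideal_class_iff simp del: mult_pCons_left) auto
    then show ?thesis
      unfolding lead_ideal_def by blast
  qed
  ultimately show ?thesis
    by (auto simp: ideal_class_iff)
qed

lemma lead_ideal_mono: "I \<subseteq> J \<Longrightarrow> lead_ideal n I \<subseteq> lead_ideal n J"
  by (auto simp: lead_ideal_def)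

lemma lead_ideal_mono_degree:
  assumes "ideal I (cring_class_ops :: 'a::comm_ring_1 poly ring)" "m \<le> n"
  shows "lead_ideal m I \<subseteq> lead_ideal n I"
proof
  fix a assume "a \<in> lead_ideal m I"
  then obtain p where p: "a = coeff p m" "p \<in> I" "degree p \<le> m"
    by (auto simp: lead_ideal_def)
  have "monom 1 (n - m) * p \<in> I"
    using assms p by (auto simp: ideal_class_iff)
  moreover have "degree (monom 1 (n - m) * p) \<le> n"
    using degree_mult_le[of "monom 1 (n - m)" p] degree_monom_le[of "1::'a" "n - m"] p assms(2)
    by linarith
  moreover have "coeff (monom 1 (n - m) * p) n = a"
    using assms(2) p by (simp add: coeff_monom_mult)
  ultimately show "a \<in> lead_ideal n I"
    unfolding lead_ideal_def by blast
qed

text \<open>Subtracting an element of \<open>I\<close> with the same leading coefficient lowers the degree of an element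
  of \<open>J\<close>.\<close>

lemma ideal_eqI_lead_ideal:
  assumes I: "ideal I (cring_class_ops :: 'a::comm_ring_1 poly ring)"
    and J: "ideal J cring_class_ops" and sub: "I \<subseteq> J"
    and lead: "\<And>n. lead_ideal n J \<subseteq> lead_ideal n I"
  shows "I = J"
proof -
  have "p \<in> J \<Longrightarrow> p \<in> I" for p
  proof (induction "if p = 0 then 0 else Suc (degree p)" arbitrary: p rule: less_induct)
    case less
    show ?case
    proof (cases "p = 0")
      case True
      then show ?thesis
        using I by (simp add: ideal_class_iff)
    next
      case False
      have "coeff p (degree p) \<in> lead_ideal (degree p) J"
        using less.prems by (auto simp: lead_ideal_def)
      then obtain q where q: "coeff p (degree p) = coeff q (degree p)" "q \<in> I" "degree q \<le> degree p"
        using lead by (auto simp: lead_ideal_def)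
      have "p - q = 0 \<or> degree (p - q) < degree p"
        using q by (metis coeff_diff degree_diff_le eq_zero_or_degree_less order_refl right_minus_eq)
      moreover have "p - q \<in> J"
        using ideal_class_diff[OF J] less.prems q sub by auto
      ultimately have "p - q \<in> I"
        using less.hyps[of "p - q"] False by auto
      moreover have "p = (p - q) + q" by simp
      ultimately show ?thesis
        using q I unfolding ideal_class_iff by metis
    qed
  qed
  then show ?thesis
    using sub by blast
qed

text \<open>Hilbert's basis theorem, for chains: the double sequence of the leading coefficient ideals of
  the members of a chain stabilises, so the chain does.\<close>

theorem noetherian_poly:
  assumes noeth: "noetherian_ring (cring_class_ops :: 'a::comm_ring_1 ring)"
  shows "noetherian_ring (cring_class_ops :: 'a poly ring)"
proof (rule ring.trivial_ideal_chain_imp_noetherian[OF cring_class.ring_axioms])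
  fix C :: "'a poly set set"
  assume C: "C \<noteq> {}" "subset.chain {I. ideal I cring_class_ops} C"
  have idl: "ideal I cring_class_ops" if "I \<in> C" for I
    using C(2) that by (auto simp: subset_chain_def)
  have total: "I \<subseteq> J \<or> J \<subseteq> I" if "I \<in> C" "J \<in> C" for I J
    using C(2) that by (auto simp: subset_chain_def)
  define U where "U = \<Union>C"
  have U: "ideal U cring_class_ops"
    using ring.chain_Union_is_ideal[OF cring_class.ring_axioms C(2)] C(1) by (simp add: U_def)
  have stable: "\<Union>S \<in> S" if "S \<noteq> {}" "\<And>I. I \<in> S \<Longrightarrow> ideal I cring_class_ops"
    "\<And>I J. I \<in> S \<Longrightarrow> J \<in> S \<Longrightarrow> I \<subseteq> J \<or> J \<subseteq> I" for S :: "'a set set"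
    using noetherian_ring.ideal_chain_is_trivial[OF noeth, of S] that by (auto simp: subset_chain_def)
  \<comment> \<open>in each degree the chain of leading coefficient ideals reaches its union\<close>
  have "\<exists>I\<in>C. lead_ideal n I = lead_ideal n U" for n
  proof -
    have "\<Union> (lead_ideal n ` C) \<in> lead_ideal n ` C"
    proof (rule stable)
      show "lead_ideal n ` C \<noteq> {}"
        using C by auto
      show "ideal I cring_class_ops" if "I \<in> lead_ideal n ` C" for I
        using that idl lead_ideal_ideal by auto
      show "I \<subseteq> J \<or> J \<subseteq> I" if IJ: "I \<in> lead_ideal n ` C" "J \<in> lead_ideal n ` C" for I J
      proof -
        obtain I' J' where "I = lead_ideal n I'" "I' \<in> C" "J = lead_ideal n J'" "J' \<in> C"
          using IJ by auto
        then show ?thesis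
          using total[of I' J'] lead_ideal_mono[of I' J' n] lead_ideal_mono[of J' I' n] by auto
      qed
    qed
    moreover have "\<Union> (lead_ideal n ` C) = lead_ideal n U"
      by (auto simp: lead_ideal_def U_def)
    ultimately show ?thesis by auto
  qed
  then obtain I where I: "\<And>n. I n \<in> C" "\<And>n. lead_ideal n (I n) = lead_ideal n U"
    by metis
  \<comment> \<open>beyond some degree \<open>N\<close> nothing new happens, so that finitely many degrees matter\<close>
  have "\<Union> (range (\<lambda>n. lead_ideal n U)) \<in> range (\<lambda>n. lead_ideal n U)"
  proof (rule stable)
    show "J \<subseteq> K \<or> K \<subseteq> J" if JK: "J \<in> range (\<lambda>n. lead_ideal n U)" "K \<in> range (\<lambda>n. lead_ideal n U)" for J K
    proof -
      obtain m n where "J = lead_ideal m U" "K = lead_ideal n U"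
        using JK by auto
      then show ?thesis
        using lead_ideal_mono_degree[OF U, of m n] lead_ideal_mono_degree[OF U, of n m] by (cases "m \<le> n") auto
    qed
  qed (auto intro: lead_ideal_ideal U)
  then obtain N where N: "\<And>n. lead_ideal n U \<subseteq> lead_ideal N U"
    by blast
  have "\<exists>J\<in>C. \<forall>n\<le>N. I n \<subseteq> J" for N
  proof (induction N)
    case (Suc N)
    then obtain J where J: "J \<in> C" "\<forall>n\<le>N. I n \<subseteq> J" by auto
    show ?case
      using total[OF J(1) I(1)[of "Suc N"]]
    proof
      assume "J \<subseteq> I (Suc N)"
      then show ?thesis
        using J I(1) by (intro bexI[of _ "I (Suc N)"]) (auto simp: le_Suc_eq)
    next
      assume "I (Suc N) \<subseteq> J"
      then show ?thesis
        using J by (intro bexI[of _ J]) (auto simp: le_Suc_eq)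
    qed
  qed (use I in auto)
  then obtain J where J: "J \<in> C" "\<And>n. n \<le> N \<Longrightarrow> I n \<subseteq> J" by blast
  have "J = U"
  proof (rule ideal_eqI_lead_ideal[OF idl[OF J(1)] U])
    show "J \<subseteq> U"
      using J by (auto simp: U_def)
    have le: "lead_ideal n U \<subseteq> lead_ideal n J" if "n \<le> N" for n
      using I(2)[of n] lead_ideal_mono[OF J(2)[OF that]] by metis
    show "lead_ideal n U \<subseteq> lead_ideal n J" for n
    proof (cases "n \<le> N")
      case False
      have "lead_ideal n U \<subseteq> lead_ideal N J"
        using N le by blast
      also have "\<dots> \<subseteq> lead_ideal n J"
        using lead_ideal_mono_degree[OF idl[OF J(1)]] False by simp
      finally show ?thesis .
    qed (rule le)
  qed
  then show "\<Union>C \<in> C"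
    using J by (simp add: U_def)
qed

lemma noetherian_field: "noetherian_ring (cring_class_ops :: 'a::field ring)"
proof (rule ring.trivial_ideal_chain_imp_noetherian[OF cring_class.ring_axioms])
  fix C :: "'a set set"
  assume C: "C \<noteq> {}" "subset.chain {I. ideal I cring_class_ops} C"
  have "I = {0} \<or> I = UNIV" if "ideal I (cring_class_ops :: 'a ring)" for I
  proof (cases "I \<subseteq> {0}")
    case True
    then show ?thesis
      using that by (auto simp: ideal_class_iff)
  next
    case False
    then obtain a where "a \<in> I" "a \<noteq> 0" by auto
    then have "x \<in> I" for x
      using that unfolding ideal_class_iff by (metis nonzero_divide_eq_eq)
    then show ?thesis by auto
  qed
  then have sub: "I = {0} \<or> I = UNIV" if "I \<in> C" for I
    using C(2) that by (auto simp: subset_chain_def)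
  show "\<Union>C \<in> C"
  proof (cases "UNIV \<in> C")
    case True
    then have "\<Union>C = UNIV" by blast
    then show ?thesis using True by simp
  next
    case False
    then have "C = {{0}}"
      using sub C(1) by (metis ex_in_conv is_singletonI' is_singleton_the_elem singletonD)
    then show ?thesis by simp
  qed
qed

lemma noetherian_wf:
  assumes "noetherian_ring (cring_class_ops :: 'a::comm_ring_1 ring)"
  shows "wf {(J, I). ideal I (cring_class_ops :: 'a ring) \<and> ideal J cring_class_ops \<and> I \<subset> J}"
proof (rule ccontr)
  assume "\<not> ?thesis"
  then obtain f :: "nat \<Rightarrow> 'a set" where f: "\<And>i. ideal (f i) cring_class_ops" "\<And>i. f i \<subset> f (Suc i)"
    unfolding wf_iff_no_infinite_down_chain
    by (metis (mono_tags, lifting) case_prodD mem_Collect_eq)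
  have mono: "f i \<subseteq> f j" if "i \<le> j" for i j
    by (rule lift_Suc_mono_le[OF _ that]) (use f(2) in auto)
  have total: "f i \<subseteq> f j \<or> f j \<subseteq> f i" for i j
    using mono nat_le_linear by metis
  have "\<Union> (range f) \<in> range f"
    by (rule noetherian_ring.ideal_chain_is_trivial[OF assms])
      (use f(1) total in \<open>auto simp: subset_chain_def\<close>)
  then obtain n where "\<Union> (range f) = f n" by auto
  then have "f (Suc n) \<subseteq> f n" by blast
  then show False
    using f(2)[of n] by blast
qed

text \<open>Noetherian induction: if \<open>a b \<in> I\<close> with \<open>a, b \<notin> I\<close>, every prime over \<open>I\<close> lies over
  \<open>I + (a)\<close> or over \<open>I + (b)\<close>.\<close>

lemma finite_primes_below:
  assumes noeth: "noetherian_ring (cring_class_ops :: 'a::comm_ring_1 ring)"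
    and I: "ideal I (cring_class_ops :: 'a ring)"
  shows "\<exists>F. finite F \<and> (\<forall>P\<in>F. primeideal P cring_class_ops \<and> I \<subseteq> P) \<and>
    (\<forall>Q. primeideal Q cring_class_ops \<and> I \<subseteq> Q \<longrightarrow> (\<exists>P\<in>F. P \<subseteq> Q))"
  using I
proof (induction I rule: wf_induct_rule[OF noetherian_wf[OF noeth]])
  case (1 I)
  consider "primeideal I cring_class_ops" | "1 \<in> I"
    | a b where "a * b \<in> I" "a \<notin> I" "b \<notin> I"
    using 1(2) by (auto simp: primeideal_class_iff)
  then show ?case
  proof cases
    case 1
    then show ?thesis by (intro exI[of _ "{I}"]) auto
  next
    case 2
    then show ?thesis
      by (intro exI[of _ "{}"]) (auto simp: primeideal_class_iff)
  next
    case 3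
    define K where "K c = genideal cring_class_ops (insert c I)" for c
    have K: "ideal (K c) cring_class_ops" "I \<subseteq> K c" "c \<in> K c" for c
      using genideal_class_ideal genideal_class_self[of "insert c I"] by (auto simp: K_def)
    have "\<exists>F. finite F \<and> (\<forall>P\<in>F. primeideal P cring_class_ops \<and> K c \<subseteq> P) \<and>
      (\<forall>Q. primeideal Q cring_class_ops \<and> K c \<subseteq> Q \<longrightarrow> (\<exists>P\<in>F. P \<subseteq> Q))" if "c \<notin> I" for c
      using that K[of c] "1.prems" by (intro "1.IH") auto
    from this[OF 3(2)] this[OF 3(3)] obtain F G where
      F: "finite F" "\<forall>P\<in>F. primeideal P cring_class_ops \<and> K a \<subseteq> P"
        "\<forall>Q. primeideal Q cring_class_ops \<and> K a \<subseteq> Q \<longrightarrow> (\<exists>P\<in>F. P \<subseteq> Q)" and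
      G: "finite G" "\<forall>P\<in>G. primeideal P cring_class_ops \<and> K b \<subseteq> P"
        "\<forall>Q. primeideal Q cring_class_ops \<and> K b \<subseteq> Q \<longrightarrow> (\<exists>P\<in>G. P \<subseteq> Q)"
      by (elim exE conjE) (rule that)
    have "\<exists>P\<in>F \<union> G. P \<subseteq> Q" if Q: "primeideal Q cring_class_ops" "I \<subseteq> Q" for Q
    proof -
      have "a \<in> Q \<or> b \<in> Q"
        using Q 3 by (auto simp: primeideal_class_iff)
      then have "K a \<subseteq> Q \<or> K b \<subseteq> Q"
        using Q genideal_class_subset_iff[of Q] by (auto simp: K_def primeideal_class_iff)
      then show ?thesis
        using F G Q by (metis UnI1 UnI2)
    qed
    moreover have "primeideal P cring_class_ops \<and> I \<subseteq> P" if "P \<in> F \<union> G" for P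
      using that F(2) G(2) K(2) by blast
    ultimately show ?thesis
      using F(1) G(1) by (intro exI[of _ "F \<union> G"]) simp
  qed
qed

text \<open>A minimal prime contains, hence is, a member of the finite set of \<open>finite_primes_below\<close>; and below
  every prime over \<open>I\<close> there is a minimal member of that set.\<close>

lemma finite_minimal_primes:
  assumes noeth: "noetherian_ring (cring_class_ops :: 'a::comm_ring_1 ring)"
    and I: "ideal I (cring_class_ops :: 'a ring)"
  shows "finite (minimal_primes cring_class_ops I)"
    and "\<And>Q. primeideal Q cring_class_ops \<Longrightarrow> I \<subseteq> Q \<Longrightarrow> \<exists>P\<in>minimal_primes cring_class_ops I. P \<subseteq> Q"
proof -
  obtain F where F: "finite F" "\<forall>P\<in>F. primeideal P cring_class_ops \<and> I \<subseteq> P"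
    "\<forall>Q. primeideal Q cring_class_ops \<and> I \<subseteq> Q \<longrightarrow> (\<exists>P\<in>F. P \<subseteq> Q)"
    using finite_primes_below[OF assms] by auto
  have "minimal_primes cring_class_ops I \<subseteq> F"
    using F(2,3) by (fastforce simp: minimal_primes_def)
  then show "finite (minimal_primes cring_class_ops I)"
    using F(1) finite_subset by blast
  show "\<exists>P\<in>minimal_primes cring_class_ops I. P \<subseteq> Q"
    if Q: "primeideal Q cring_class_ops" "I \<subseteq> Q" for Q
  proof -
    obtain P0 where "P0 \<in> F" "P0 \<subseteq> Q"
      using F Q by blast
    then obtain P where P: "P \<in> F" "P \<subseteq> P0" "\<And>P'. P' \<in> F \<Longrightarrow> P' \<subseteq> P \<Longrightarrow> P' = P"
      using finite_has_minimal2[OF F(1)] by metis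
    have "P \<in> minimal_primes cring_class_ops I"
      unfolding minimal_primes_def
    proof (intro CollectI conjI allI impI)
      fix R assume R: "primeideal R cring_class_ops \<and> I \<subseteq> R \<and> R \<subseteq> P"
      then obtain P' where "P' \<in> F" "P' \<subseteq> R"
        using F(3) by blast
      then show "R = P"
        using P(3)[of P'] R by auto
    qed (use F P in auto)
    then show ?thesis
      using P \<open>P0 \<subseteq> Q\<close> by blast
  qed
qed

lemma noetherian_poly3: "noetherian_ring (cring_class_ops :: poly3 ring)"
  by (intro noetherian_poly noetherian_field)


section \<open>Evaluation of polynomials\<close>

text \<open>Unital homomorphisms between rings that are given by type classes. Identities between the
  various evaluations below hold because both sides are homomorphisms that agree on the constants
  and on the variables.\<close>

definition is_hom :: "('a::comm_ring_1 \<Rightarrow> 'b::comm_ring_1) \<Rightarrow> bool" where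
  "is_hom c \<longleftrightarrow> c 1 = 1 \<and> (\<forall>a b. c (a + b) = c a + c b) \<and> (\<forall>a b. c (a * b) = c a * c b)"

lemma is_hom_simps:
  assumes "is_hom c"
  shows is_hom_1: "c 1 = 1" and is_hom_add: "c (a + b) = c a + c b"
    and is_hom_mult: "c (a * b) = c a * c b" and is_hom_0: "c 0 = 0"
    and is_hom_uminus: "c (- a) = - c a" and is_hom_diff: "c (a - b) = c a - c b"
    and is_hom_power: "c (a ^ n) = c a ^ n"
proof -
  note h = assms[unfolded is_hom_def]
  show "c 1 = 1" "c (a + b) = c a + c b" "c (a * b) = c a * c b"
    using h by auto
  show 0: "c 0 = 0"
    using h by (metis add_cancel_right_right)
  have u: "c (- a) = - c a" for a
    using h 0 by (metis add.right_inverse add_eq_0_iff)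
  show "c (- a) = - c a" by (rule u)
  show "c (a - b) = c a - c b"
    using h u by (metis diff_conv_add_uminus)
  show "c (a ^ n) = c a ^ n"
    using h by (induction n) auto
qed

lemma is_hom_sum: "is_hom c \<Longrightarrow> c (sum f A) = (\<Sum>x\<in>A. c (f x))"
  by (induction A rule: infinite_finite_induct) (auto simp: is_hom_add is_hom_0)

lemma is_hom_comp: "is_hom f \<Longrightarrow> is_hom g \<Longrightarrow> is_hom (\<lambda>x. f (g x))"
  by (simp add: is_hom_def)

lemma is_hom_id: "is_hom (\<lambda>a. a)"
  by (simp add: is_hom_def)

lemma is_hom_of_real: "is_hom (of_real :: real \<Rightarrow> 'a::{real_algebra_1, comm_ring_1})"
  by (simp add: is_hom_def)

lemma is_hom_const: "is_hom const"
  by (simp add: is_hom_def const_def one_pCons)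

lemma is_hom_poly_map_poly:
  assumes c: "is_hom c"
  shows "is_hom (\<lambda>p. poly (map_poly c p) s)"
proof -
  define e where "e = (\<lambda>p. poly (map_poly c p) s)"
  have pc: "e (pCons a p) = c a + s * e p" for a p
    using is_hom_0[OF c] by (simp add: e_def map_poly_pCons)
  have e0: "e 0 = 0"
    by (simp add: e_def)
  have add: "e (p + q) = e p + e q" for p q
    by (induction p q rule: poly_induct2)
      (auto simp: e0 pc is_hom_add[OF c] algebra_simps)
  have smult: "e (smult a p) = c a * e p" for a p
    by (induction p) (auto simp: e0 pc is_hom_mult[OF c] algebra_simps)
  have mult: "e (p * q) = e p * e q" for p q
    by (induction p) (auto simp: e0 pc add smult is_hom_0[OF c] algebra_simps)
  have "e 1 = 1"
    by (simp add: one_pCons pc is_hom_1[OF c] e0)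
  then show ?thesis
    using add mult by (simp add: is_hom_def flip: e_def)
qed

lemma is_hom_eval1: "is_hom c \<Longrightarrow> is_hom (\<lambda>p. eval1 c p s)"
  unfolding eval1_def by (rule is_hom_poly_map_poly)

lemma is_hom_eval2: "is_hom c \<Longrightarrow> is_hom (\<lambda>p. eval2 c p s t)"
  unfolding eval2_def by (intro is_hom_poly_map_poly is_hom_eval1)

lemma is_hom_eval3: "is_hom c \<Longrightarrow> is_hom (\<lambda>p. eval3 c p v)"
  unfolding eval3_def by (intro is_hom_poly_map_poly is_hom_eval2)

lemmas eval3_hom = is_hom_simps[OF is_hom_eval3]
lemmas eval2_hom = is_hom_simps[OF is_hom_eval2]
lemmas eval1_hom = is_hom_simps[OF is_hom_eval1]

lemma poly_generated:
  assumes "\<And>a. Q [:a:]" "Q [:0, 1:]" "\<And>p q. Q p \<Longrightarrow> Q q \<Longrightarrow> Q (p + q)" "\<And>p q. Q p \<Longrightarrow> Q q \<Longrightarrow> Q (p * q)"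
  shows "Q (p :: 'a::comm_ring_1 poly)"
proof (induction p)
  case 0
  show ?case using assms(1)[of 0] by simp
next
  case (pCons a p)
  have "pCons a p = [:a:] + [:0, 1:] * p" by simp
  then show ?case
    using pCons assms by metis
qed

lemma const_poly_hom: "[:a + b:] = [:a:] + [:b:]" "[:a * b:] = [:a:] * [:b :: 'a::comm_ring_1:]"
  by auto

lemma poly2_generated:
  fixes p :: poly2
  assumes "\<And>a. Q [:[:a:]:]" "Q [:[:0, 1:]:]" "Q [:0, 1:]"
    "\<And>p q. Q p \<Longrightarrow> Q q \<Longrightarrow> Q (p + q)" "\<And>p q. Q p \<Longrightarrow> Q q \<Longrightarrow> Q (p * q)"
  shows "Q p"
proof (rule poly_generated)
  show "Q [:a:]" for a
    by (induction a rule: poly_generated) (use assms in \<open>auto simp only: const_poly_hom\<close>)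
qed (use assms in auto)

lemma var_simps:
  "var 1 = [:[:[:0, 1:]:]:]" "var 2 = [:[:0, 1:]:]" "var 3 = [:0, 1:]"
  by (auto simp: var_def)

lemma poly3_generated:
  fixes p :: poly3
  assumes "\<And>a. Q (const a)" "\<And>i. Q (var i)"
    "\<And>p q. Q p \<Longrightarrow> Q q \<Longrightarrow> Q (p + q)" "\<And>p q. Q p \<Longrightarrow> Q q \<Longrightarrow> Q (p * q)"
  shows "Q p"
proof (rule poly_generated)
  show "Q [:0, 1:]"
    using assms(2)[of 3] by (simp add: var_simps)
  show "Q [:a:]" for a
  proof (rule poly2_generated[of "\<lambda>a. Q [:a:]"])
    show "Q [:[:[:0, 1:]:]:]" "Q [:[:0, 1:]:]"
      using assms(2)[of 1] assms(2)[of 2] by (auto simp: var_simps)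
  qed (use assms in \<open>auto simp only: const_poly_hom const_def\<close>)
qed (use assms in auto)

lemma poly2_hom_eqI:
  fixes p :: poly2
  assumes "is_hom \<phi>" "is_hom \<psi>" "\<And>a. \<phi> [:[:a:]:] = \<psi> [:[:a:]:]"
    "\<phi> [:[:0, 1:]:] = \<psi> [:[:0, 1:]:]" "\<phi> [:0, 1:] = \<psi> [:0, 1:]"
  shows "\<phi> p = \<psi> p"
  by (induction p rule: poly2_generated) (use assms in \<open>auto simp: is_hom_simps\<close>)

lemma poly3_hom_eqI:
  fixes p :: poly3
  assumes "is_hom \<phi>" "is_hom \<psi>" "\<And>a. \<phi> (const a) = \<psi> (const a)" "\<And>i. \<phi> (var i) = \<psi> (var i)"
  shows "\<phi> p = \<psi> p"
  by (induction p rule: poly3_generated) (use assms in \<open>auto simp: is_hom_simps\<close>)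

lemma eval1_pCons: "is_hom c \<Longrightarrow> eval1 c (pCons a p) s = c a + s * eval1 c p s"
  by (simp add: eval1_def map_poly_pCons is_hom_0)

lemma eval1_simps:
  assumes "is_hom c"
  shows "eval1 c [:a:] s = c a" "eval1 c [:0, 1:] s = s" "eval1 c 0 s = 0"
  by (auto simp: eval1_def map_poly_pCons is_hom_0[OF assms] is_hom_1[OF assms])

lemma eval2_simps:
  assumes "is_hom c"
  shows "eval2 c [:p:] s t = eval1 c p s" "eval2 c [:0, 1:] s t = t" "eval2 c 0 s t = 0"
  using is_hom_0[OF is_hom_eval1[OF assms]] is_hom_1[OF is_hom_eval1[OF assms]]
  by (auto simp: eval2_def map_poly_pCons)

lemma eval3_simps:
  assumes "is_hom c"
  shows "eval3 c [:p:] v = eval2 c p (v $ 1) (v $ 2)" "eval3 c [:0, 1:] v = v $ 3"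
  using is_hom_0[OF is_hom_eval2[OF assms]] is_hom_1[OF is_hom_eval2[OF assms]]
  by (auto simp: eval3_def map_poly_pCons)

lemma eval3_const: "is_hom c \<Longrightarrow> eval3 c (const a) v = c a"
  by (simp add: const_def eval3_simps eval2_simps eval1_simps)

lemma eval3_var: "is_hom c \<Longrightarrow> eval3 c (var i) v = v $ i"
  using exhaust_3[of i] by (auto simp: var_simps eval3_simps eval2_simps eval1_simps)

lemma eval1_hom_comp:
  assumes "is_hom \<phi>" "is_hom c"
  shows "\<phi> (eval1 c p s) = eval1 (\<lambda>a. \<phi> (c a)) p (\<phi> s)"
  by (induction p)
    (auto simp: eval1_simps eval1_pCons assms is_hom_comp[OF assms] is_hom_simps[OF assms(1)])

lemma eval2_hom_comp:
  assumes "is_hom \<phi>" "is_hom c"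
  shows "\<phi> (eval2 c p s t) = eval2 (\<lambda>a. \<phi> (c a)) p (\<phi> s) (\<phi> t)"
  by (rule poly2_hom_eqI[OF is_hom_comp[OF assms(1) is_hom_eval2[OF assms(2)]]
        is_hom_eval2[OF is_hom_comp[OF assms]]])
    (simp_all add: eval2_simps eval1_simps assms is_hom_comp[OF assms])

lemma eval3_hom_comp:
  assumes "is_hom \<phi>" "is_hom c"
  shows "\<phi> (eval3 c p v) = eval3 (\<lambda>a. \<phi> (c a)) p (\<chi> i. \<phi> (v $ i))"
  by (rule poly3_hom_eqI[OF is_hom_comp[OF assms(1) is_hom_eval3[OF assms(2)]]
        is_hom_eval3[OF is_hom_comp[OF assms]]])
    (simp_all add: eval3_const eval3_var assms is_hom_comp[OF assms])

lemma eval3_eval1: "is_hom c \<Longrightarrow> eval3 c (eval1 const g a) v = eval1 c g (eval3 c a v)"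
  using eval1_hom_comp[OF is_hom_eval3[of c v] is_hom_const, of g a] by (simp add: eval3_const)

lemma eval3_eval2: "is_hom c \<Longrightarrow> eval3 c (eval2 const h a b) v = eval2 c h (eval3 c a v) (eval3 c b v)"
  using eval2_hom_comp[OF is_hom_eval3[of c v] is_hom_const, of h a b] by (simp add: eval3_const)

lemma eval3_eval3: "is_hom c \<Longrightarrow> eval3 c (eval3 const h w) v = eval3 c h (\<chi> i. eval3 c (w $ i) v)"
  using eval3_hom_comp[OF is_hom_eval3[of c v] is_hom_const, of h w] by (simp add: eval3_const)

lemma eval3_vars: "eval3 const h (\<chi> i. var i) = h"
  by (rule poly3_hom_eqI[of _ "\<lambda>h. h"])
    (auto simp: is_hom_eval3 is_hom_const is_hom_id eval3_const eval3_var)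

abbreviation rval :: "poly3 \<Rightarrow> real ^ 3 \<Rightarrow> real" where
  "rval \<equiv> eval3 (\<lambda>a. a)"

lemmas rval_hom = eval3_hom[OF is_hom_id]
lemmas rval_const = eval3_const[OF is_hom_id]
lemmas rval_var = eval3_var[OF is_hom_id]

lemma eval3_of_real: "eval3 of_real p (\<chi> i. of_real (v $ i) ) = (of_real (rval p v) :: complex)"
  using eval3_hom_comp[OF is_hom_of_real[where 'a=complex] is_hom_id, of p v] by simp

lemma real_points_variety: "p \<in> real_points (variety I) \<longleftrightarrow> (\<forall>h\<in>I. rval h p = 0)"
  by (simp add: real_points_def variety_def eval3_of_real)

lemma zero_in_variety: "0 \<in> variety I \<longleftrightarrow> (\<forall>h\<in>I. rval h 0 = 0)"
proof -
  have "(\<chi> i. of_real ((0 :: real ^ 3) $ i)) = (0 :: complex ^ 3)"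
    by (simp add: vec_eq_iff)
  then show ?thesis
    using real_points_variety[of 0 I] by (simp add: real_points_def)
qed

lemma prime_eval_kernel:
  fixes v :: "'a::idom ^ 3"
  assumes "is_hom c"
  shows "primeideal {h. eval3 c h v = 0} cring_class_ops"
  using eval3_hom[OF assms] by (auto simp: primeideal_class_iff ideal_class_iff)

lemma real_points_variety_poly_ideal:
  "p \<in> real_points (variety (poly_ideal S)) \<longleftrightarrow> (\<forall>h\<in>S. rval h p = 0)"
  using genideal_class_subset_iff[of "{h. rval h p = 0}" S] prime_eval_kernel[OF is_hom_id, of p]
  by (auto simp: real_points_variety primeideal_class_iff)

text \<open>The polynomials that vanish at \<open>p\<close> form a prime over \<open>I\<close>, which lies over a minimal one.\<close>

lemma real_points_in_component:
  assumes "p \<in> real_points (variety I)" "ideal I cring_class_ops"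
  shows "\<exists>P\<in>component_primes I. p \<in> real_points (variety P)"
proof -
  have "\<exists>P\<in>component_primes I. P \<subseteq> {h. rval h p = 0}"
    using assms by (intro finite_minimal_primes(2)[OF noetherian_poly3] prime_eval_kernel is_hom_id)
      (auto simp: real_points_variety)
  then show ?thesis
    by (auto simp: real_points_variety)
qed

lemma real_points_component_subset:
  assumes "P \<in> component_primes I"
  shows "real_points (variety P) \<subseteq> real_points (variety I)"
  using assms unfolding real_points_variety minimal_primes_def subset_iff by blast


section \<open>Partial derivatives\<close>

lemma map_poly_derivation:
  assumes "\<And>a b. d (a + b) = d a + d b" "\<And>a b. d (a * b) = d a * b + a * d (b :: 'a::comm_ring_1)"
  shows "map_poly d (p + q) = map_poly d p + map_poly d q"
    and "map_poly d (p * q) = map_poly d p * q + p * map_poly d q"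
proof -
  have 0: "d 0 = 0"
    using assms(1)[of 0 0] by simp
  have sum: "d (sum f A) = (\<Sum>x\<in>A. d (f x))" for f and A :: "nat set"
    by (induction A rule: infinite_finite_induct) (auto simp: 0 assms)
  show "map_poly d (p + q) = map_poly d p + map_poly d q"
    by (intro poly_eqI) (simp add: coeff_map_poly 0 assms)
  show "map_poly d (p * q) = map_poly d p * q + p * map_poly d q"
    by (intro poly_eqI) (simp add: coeff_map_poly 0 assms coeff_mult sum sum.distrib)
qed

lemma pd_simps:
  "pd 1 p = map_poly (map_poly pderiv) p" "pd 2 p = map_poly pderiv p" "pd 3 p = pderiv p"
  by (auto simp: pd_def)

lemma pderiv_derivation: "pderiv (p * q) = pderiv p * q + p * pderiv (q :: 'a::idom poly)"
  by (simp add: pderiv_mult algebra_simps)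

lemma pd_add: "pd i (p + q) = pd i p + pd i q"
  and pd_mult: "pd i (p * q) = pd i p * q + p * pd i q"
  using exhaust_3[of i]
  by (auto simp: pd_simps pderiv_add pderiv_derivation map_poly_derivation)

lemma pd_const: "pd i (const a) = 0"
  using exhaust_3[of i] by (auto simp: pd_simps const_def map_poly_pCons pderiv_pCons)

lemma pd_var: "pd i (var j) = (if i = j then 1 else 0)"
  using exhaust_3[of i] exhaust_3[of j]
  by (auto simp: pd_simps var_simps map_poly_pCons pderiv_pCons one_pCons)

lemma has_derivative_rval: "(rval p has_derivative (\<lambda>d. \<Sum>i\<in>UNIV. rval (pd i p) v * d $ i)) (at v)"
proof (induction p rule: poly3_generated)
  case (1 a)
  then show ?case
    by (simp add: rval_const pd_const rval_hom)
next
  case (2 i)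
  have "((\<lambda>v. v $ i) has_derivative (\<lambda>d. d $ i)) (at v)"
    by (intro bounded_linear_imp_has_derivative bounded_linear_vec_nth)
  moreover have "(\<Sum>j\<in>UNIV. rval (pd j (var i)) v * d $ j) = d $ i" for d :: "real ^ 3"
    using exhaust_3[of i] by (auto simp: sum_3 pd_var rval_hom)
  ultimately show ?case
    by (simp add: rval_var)
next
  case (3 p q)
  then show ?case
    using has_derivative_add[OF 3] by (simp add: pd_add rval_hom algebra_simps sum.distrib)
next
  case (4 p q)
  show ?case
    unfolding rval_hom
    by (rule has_derivative_eq_rhs[OF has_derivative_mult[OF 4]])
      (auto simp: pd_mult rval_hom algebra_simps sum.distrib sum_distrib_left sum_distrib_right)
qed

lemma continuous_on_rval: "continuous_on S (rval p)"
  using has_derivative_continuous[OF has_derivative_rval]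
  by (auto intro: continuous_at_imp_continuous_on)

lemma closed_real_points: "closed (real_points (variety I))"
proof -
  have "real_points (variety I) = (\<Inter>h\<in>I. {p. rval h p = 0})"
    by (auto simp: real_points_variety)
  moreover have "closed {p. rval h p = 0}" for h
    by (intro closed_Collect_eq continuous_on_rval continuous_on_const)
  ultimately show ?thesis
    by auto
qed


section \<open>Extrema of the quotient on spheres\<close>

definition quotient_grad :: "poly3 \<Rightarrow> poly3 \<Rightarrow> 3 \<Rightarrow> real ^ 3 \<Rightarrow> real" where
  "quotient_grad f g i p = (rval g p * rval (pd i f) p - rval f p * rval (pd i g) p) / (rval g p)\<^sup>2"

lemma has_derivative_quotient_fun:
  assumes "rval g p \<noteq> 0"
  shows "(quotient_fun f g has_derivative (\<lambda>d. \<Sum>i\<in>UNIV. quotient_grad f g i p * d $ i)) (at p)"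
proof -
  have "((\<lambda>p. rval f p / rval g p) has_derivative (\<lambda>d. \<Sum>i\<in>UNIV. quotient_grad f g i p * d $ i)) (at p)"
    by (rule has_derivative_eq_rhs[OF has_derivative_divide[OF has_derivative_rval has_derivative_rval assms]])
      (use assms in \<open>auto simp: quotient_grad_def sum_3 field_simps power2_eq_square\<close>)
  moreover have "quotient_fun f g = (\<lambda>p. rval f p / rval g p)"
    by (auto simp: quotient_fun_def)
  ultimately show ?thesis by simp
qed

lemma continuous_on_quotient_fun:
  assumes "\<And>p. p \<in> S \<Longrightarrow> rval g p \<noteq> 0"
  shows "continuous_on S (quotient_fun f g)"
  using has_derivative_continuous[OF has_derivative_quotient_fun] assms
  by (auto intro: continuous_at_imp_continuous_on)

lemma rval_disc_poly:
  assumes "rval g p \<noteq> 0"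
  shows "rval (disc_poly f g i j) p = (rval g p)\<^sup>2 * (p $ i * quotient_grad f g j p - p $ j * quotient_grad f g i p)"
  using assms by (simp add: disc_poly_def rval_hom rval_var quotient_grad_def field_simps)

lemma disc_poly_swap: "disc_poly f g i j = - disc_poly f g j i"
  by (simp add: disc_poly_def)

lemma disc_poly_same: "disc_poly f g i i = 0"
  by (simp add: disc_poly_def)

lemma real_points_disc_ideal:
  "p \<in> real_points (variety (disc_ideal f g)) \<longleftrightarrow> (\<forall>i j. rval (disc_poly f g i j) p = 0)"
  (is "?l \<longleftrightarrow> ?r")
proof
  assume ?l
  then have "rval (disc_poly f g 1 2) p = 0" "rval (disc_poly f g 1 3) p = 0" "rval (disc_poly f g 2 3) p = 0"
    by (auto simp: disc_ideal_def real_points_variety_poly_ideal)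
  moreover have "rval (disc_poly f g i j) p = - rval (disc_poly f g j i) p" for i j
    using rval_hom(5)[of "disc_poly f g j i" p] disc_poly_swap[of f g i j] by simp
  from this[of 2 1] this[of 3 1] this[of 3 2] calculation
  have "rval (disc_poly f g i j) p = 0" for i j
    using exhaust_3[of i] exhaust_3[of j] by (auto simp: disc_poly_same rval_hom)
  then show ?r by simp
next
  assume ?r
  then show ?l
    by (auto simp: disc_ideal_def real_points_variety_poly_ideal)
qed

text \<open>Rotating \<open>p\<close> in the plane of the \<open>i\<close>-th and \<open>j\<close>-th axes keeps it on its sphere, so the
  derivative of the quotient along this rotation vanishes at an extremum.\<close>

lemma disc_poly_at_extremum:
  assumes g: "rval g p \<noteq> 0"
    and ext: "(\<forall>x. norm x = norm p \<longrightarrow> quotient_fun f g x \<le> quotient_fun f g p) \<or>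
      (\<forall>x. norm x = norm p \<longrightarrow> quotient_fun f g x \<ge> quotient_fun f g p)"
  shows "rval (disc_poly f g i j) p = 0"
proof (cases "i = j")
  case False
  define a b :: "real ^ 3"
    where "a = (\<chi> k. if k = i then p $ i else if k = j then p $ j else 0)"
      and "b = (\<chi> k. if k = i then - p $ j else if k = j then p $ i else 0)"
  define \<gamma> where "\<gamma> t = p + (cos t - 1) *\<^sub>R a + sin t *\<^sub>R b" for t :: real
  have \<gamma>0: "\<gamma> 0 = p"
    by (simp add: \<gamma>_def)
  have "inner (\<gamma> t) (\<gamma> t) = inner p p" for t
  proof -
    have "(c * a - s * b)\<^sup>2 + (c * b + s * a)\<^sup>2 = (s\<^sup>2 + c\<^sup>2) * (a\<^sup>2 + b\<^sup>2)" for a b c s :: real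
      by (simp add: power2_eq_square algebra_simps)
    from this[of "cos t" _ "sin t"] have "(cos t * a - sin t * b)\<^sup>2 + (cos t * b + sin t * a)\<^sup>2 = a\<^sup>2 + b\<^sup>2" for a b
      by simp
    moreover have "a + (cos t - 1) * a = cos t * a" for a
      by (simp add: algebra_simps)
    ultimately have ij: "(p $ i + (cos t - 1) * p $ i - sin t * p $ j)\<^sup>2 + (p $ j + (cos t - 1) * p $ j + sin t * p $ i)\<^sup>2
      = (p $ i)\<^sup>2 + (p $ j)\<^sup>2"
      by simp
    have S: "(\<Sum>k\<in>UNIV. h k) = h i + h j + (\<Sum>k\<in>UNIV - {i, j}. h k)" for h :: "3 \<Rightarrow> real"
      using False by (subst sum.subset_diff[of "{i, j}"]) auto
    show ?thesis
      unfolding inner_vec_def S using ij False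
      by (simp add: \<gamma>_def a_def b_def power2_eq_square)
  qed
  then have norm: "norm (\<gamma> t) = norm p" for t
    by (simp add: norm_eq_sqrt_inner)
  have "(\<gamma> has_vector_derivative b) (at 0)"
    unfolding \<gamma>_def by (auto intro!: derivative_eq_intros)
  then have "((\<lambda>t. quotient_fun f g (\<gamma> t)) has_derivative
      (\<lambda>t. \<Sum>k\<in>UNIV. quotient_grad f g k p * (t *\<^sub>R b) $ k)) (at 0)"
    unfolding has_vector_derivative_def
    by (rule has_derivative_compose) (simp add: \<gamma>0 has_derivative_quotient_fun[OF g])
  moreover have "(\<Sum>k\<in>UNIV. quotient_grad f g k p * (t *\<^sub>R b) $ k) =
      (p $ i * quotient_grad f g j p - p $ j * quotient_grad f g i p) * t" for t
  proof -
    have "(\<Sum>k\<in>UNIV. quotient_grad f g k p * (t *\<^sub>R b) $ k) = (\<Sum>k\<in>{i, j}. quotient_grad f g k p * (t *\<^sub>R b) $ k)"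
      by (rule sum.mono_neutral_right) (auto simp: b_def)
    then show ?thesis
      using False by (simp add: b_def algebra_simps)
  qed
  ultimately have deriv: "((\<lambda>t. quotient_fun f g (\<gamma> t)) has_field_derivative
      p $ i * quotient_grad f g j p - p $ j * quotient_grad f g i p) (at 0)"
    by (simp add: has_field_derivative_def)
  from ext have "p $ i * quotient_grad f g j p - p $ j * quotient_grad f g i p = 0"
  proof
    assume "\<forall>x. norm x = norm p \<longrightarrow> quotient_fun f g x \<le> quotient_fun f g p"
    then show ?thesis
      using DERIV_local_max[OF deriv zero_less_one] norm \<gamma>0 by simp
  next
    assume "\<forall>x. norm x = norm p \<longrightarrow> quotient_fun f g x \<ge> quotient_fun f g p"
    then show ?thesis
      using DERIV_local_min[OF deriv zero_less_one] norm \<gamma>0 by simp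
  qed
  then show ?thesis
    using rval_disc_poly[OF g] by simp
qed (simp add: disc_poly_same rval_hom)

lemma isolated_zero_nonzero:
  assumes "isolated_zero g"
  obtains d where "d > 0" "\<And>p. p \<noteq> 0 \<Longrightarrow> norm p < d \<Longrightarrow> rval g p \<noteq> 0"
  using assms unfolding isolated_zero_def eventually_at by (auto simp: dist_norm)

lemma tendsto_at_0_within_iff:
  fixes q :: "real ^ 3 \<Rightarrow> real"
  shows "(q \<longlongrightarrow> L) (at 0 within S) \<longleftrightarrow>
    (\<forall>e>0. \<exists>d>0. \<forall>p\<in>S. p \<noteq> 0 \<and> norm p < d \<longrightarrow> \<bar>q p - L\<bar> < e)"
  by (simp add: Lim_within dist_norm imp_conjL)

text \<open>On each sphere the values of the quotient are enclosed by its maximum and its minimum, which are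
  attained on the discriminant variety.\<close>

lemma limit_from_disc:
  assumes g: "isolated_zero g"
    and lim: "(quotient_fun f g \<longlongrightarrow> L) (at 0 within real_points (variety (disc_ideal f g)))"
  shows "(quotient_fun f g \<longlongrightarrow> L) (at 0)"
  unfolding tendsto_at_0_within_iff
proof (intro allI impI)
  fix e :: real assume "e > 0"
  then obtain d where d: "d > 0"
    "\<And>p. p \<in> real_points (variety (disc_ideal f g)) \<Longrightarrow> p \<noteq> 0 \<Longrightarrow> norm p < d \<Longrightarrow> \<bar>quotient_fun f g p - L\<bar> < e"
    using lim unfolding tendsto_at_0_within_iff by meson
  obtain d0 where d0: "d0 > 0" "\<And>p. p \<noteq> 0 \<Longrightarrow> norm p < d0 \<Longrightarrow> rval g p \<noteq> 0"
    using isolated_zero_nonzero[OF g] by blast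
  have "\<bar>quotient_fun f g p0 - L\<bar> < e" if p0: "p0 \<noteq> 0" "norm p0 < min d d0" for p0
  proof -
    define S where "S = sphere (0 :: real ^ 3) (norm p0)"
    have S: "p \<noteq> 0 \<and> norm p = norm p0" if "p \<in> S" for p
      using that p0 by (auto simp: S_def)
    have cont: "continuous_on S (quotient_fun f g)"
      using S p0 d0 by (intro continuous_on_quotient_fun) auto
    have "compact S" "p0 \<in> S"
      by (auto simp: S_def)
    then have "S \<noteq> {}" by blast
    obtain p1 where p1: "p1 \<in> S" "\<And>x. x \<in> S \<Longrightarrow> quotient_fun f g x \<le> quotient_fun f g p1"
      using continuous_attains_sup[OF \<open>compact S\<close> \<open>S \<noteq> {}\<close> cont] by blast
    obtain p2 where p2: "p2 \<in> S" "\<And>x. x \<in> S \<Longrightarrow> quotient_fun f g p2 \<le> quotient_fun f g x"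
      using continuous_attains_inf[OF \<open>compact S\<close> \<open>S \<noteq> {}\<close> cont] by blast
    have "p1 \<in> real_points (variety (disc_ideal f g))"
      unfolding real_points_disc_ideal
      by (intro allI disc_poly_at_extremum disjI1) (use S[OF p1(1)] p0 d0 p1(2) in \<open>auto simp: S_def\<close>)
    moreover have "p2 \<in> real_points (variety (disc_ideal f g))"
      unfolding real_points_disc_ideal
      by (intro allI disc_poly_at_extremum disjI2) (use S[OF p2(1)] p0 d0 p2(2) in \<open>auto simp: S_def\<close>)
    ultimately have "\<bar>quotient_fun f g p1 - L\<bar> < e" "\<bar>quotient_fun f g p2 - L\<bar> < e"
      using d(2) S p1 p2 p0 by auto
    then show ?thesis
      using p1(2)[OF \<open>p0 \<in> S\<close>] p2(2)[OF \<open>p0 \<in> S\<close>] by linarith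
  qed
  then show "\<exists>d>0. \<forall>p\<in>UNIV. p \<noteq> 0 \<and> norm p < d \<longrightarrow> \<bar>quotient_fun f g p - L\<bar> < e"
    using d d0 by (intro exI[of _ "min d d0"]) auto
qed

lemma tendsto_within_finite_Union:
  assumes "finite F" "\<And>A. A \<in> F \<Longrightarrow> (f \<longlongrightarrow> l) (at x within A)"
  shows "(f \<longlongrightarrow> l) (at x within \<Union>F)"
  using assms by (induction F) (auto simp: at_within_union filterlim_sup)

text \<open>Finiteness of the set of components makes the estimates along the components uniform. A
  component is closed, so one that misses the origin has no points near it.\<close>

lemma limit_from_components:
  assumes I: "ideal I cring_class_ops"
    and lim: "\<And>P. P \<in> component_primes I \<Longrightarrow> 0 \<in> variety P \<Longrightarrow> limit_along q (variety P) L"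
  shows "(q \<longlongrightarrow> L) (at 0 within real_points (variety I))"
proof (rule tendsto_within_subset)
  show "real_points (variety I) \<subseteq> \<Union> ((\<lambda>P. real_points (variety P)) ` component_primes I)"
  proof
    fix p assume "p \<in> real_points (variety I)"
    from real_points_in_component[OF this I]
    show "p \<in> \<Union> ((\<lambda>P. real_points (variety P)) ` component_primes I)" by simp
  qed
  show "(q \<longlongrightarrow> L) (at 0 within \<Union> ((\<lambda>P. real_points (variety P)) ` component_primes I))"
  proof (rule tendsto_within_finite_Union)
    show "finite ((\<lambda>P. real_points (variety P)) ` component_primes I)"
      using finite_minimal_primes(1)[OF noetherian_poly3 I] by simp
    fix A assume "A \<in> (\<lambda>P. real_points (variety P)) ` component_primes I"
    then obtain P where P: "P \<in> component_primes I" "A = real_points (variety P)" by auto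
    show "(q \<longlongrightarrow> L) (at 0 within A)"
    proof (cases "0 \<in> variety P")
      case True
      then show ?thesis
        using lim P by (simp add: limit_along_def)
    next
      case False
      then have "0 \<notin> A"
        using P zero_in_variety by (simp add: real_points_variety)
      moreover have "closed A"
        unfolding P by (rule closed_real_points)
      ultimately have "at 0 within A = bot"
        by (simp add: at_within_eq_bot_iff)
      then show ?thesis by simp
    qed
  qed
qed


section \<open>Limits along a surface\<close>

text \<open>The inverse function theorem; the derivative of a polynomial map is its Jacobian matrix.\<close>

lemma polynomial_map_local_inverse:
  fixes F :: "poly3 ^ 3" and x :: "real ^ 3"
  assumes det: "det (\<chi> i j. rval (pd j (F $ i)) x) \<noteq> 0"
  shows "\<exists>V G. open V \<and> (\<chi> i. rval (F $ i) x) \<in> V \<and> G (\<chi> i. rval (F $ i) x) = x \<and>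
    (\<forall>y\<in>V. (\<chi> i. rval (F $ i) (G y)) = y) \<and> (\<forall>y\<in>V. \<exists>G'. (G has_derivative G') (at y))"
proof -
  define M :: "real ^ 3 \<Rightarrow> real ^ 3 ^ 3" where "M x = (\<chi> i j. rval (pd j (F $ i)) x)" for x
  define \<Phi> where "\<Phi> x = (\<chi> i. rval (F $ i) x)" for x
  define \<Phi>' where "\<Phi>' x = Blinfun ((*v) (M x))" for x
  have app: "blinfun_apply (Blinfun ((*v) N)) = (*v) N" for N :: "real ^ 3 ^ 3"
    by (intro bounded_linear_Blinfun_apply matrix_vector_mul_bounded_linear)
  have deriv: "(\<Phi> has_derivative blinfun_apply (\<Phi>' x)) (at x)" for x
  proof -
    have "((\<lambda>x. \<Phi> x $ i) has_derivative (\<lambda>d. (M x *v d) $ i)) (at x)" for i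
      using has_derivative_rval[of "F $ i" x] by (simp add: \<Phi>_def M_def matrix_vector_mult_def)
    then have "(\<Phi> has_derivative (*v) (M x)) (at x)"
      by (intro has_derivative_componentwise_within[THEN iffD2])
        (auto simp: Basis_vec_def inner_axis)
    then show ?thesis
      by (simp add: \<Phi>'_def app)
  qed
  have cont: "continuous_on UNIV \<Phi>'"
  proof (rule continuous_on_blinfun_componentwise)
    fix b :: "real ^ 3"
    have "continuous_on UNIV (\<lambda>x. M x *v b)"
      unfolding M_def matrix_vector_mult_def
      by (auto intro!: continuous_on_vec_lambda continuous_intros continuous_on_rval)
    then show "continuous_on UNIV (\<lambda>x. blinfun_apply (\<Phi>' x) b)"
      by (simp add: \<Phi>'_def app)
  qed
  obtain N where "N ** M x = mat 1"
    using det by (auto simp: M_def invertible_def simp flip: invertible_det_nz)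
  then have inv: "Blinfun ((*v) N) o\<^sub>L \<Phi>' x = id_blinfun"
    by (intro blinfun_eqI) (simp add: \<Phi>'_def app matrix_vector_mul_assoc)
  show ?thesis
  proof (rule inverse_function_theorem[OF open_UNIV deriv cont UNIV_I inv])
    fix U V G G'
    assume V: "open V" "\<Phi> x \<in> V" and "x \<in> U" and hom: "homeomorphism U V \<Phi> G"
      and G: "\<And>y. y \<in> V \<Longrightarrow> (G has_derivative G' y) (at y)"
    have "\<forall>y\<in>V. \<Phi> (G y) = y" "\<forall>y\<in>V. \<exists>G'. (G has_derivative G') (at y)"
      using homeomorphism_apply2[OF hom] G by auto
    then show ?thesis
      using V homeomorphism_apply1[OF hom \<open>x \<in> U\<close>] unfolding \<Phi>_def by (intro exI conjI)
  qed
qed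

definition crit_poly :: "poly3 \<Rightarrow> real \<Rightarrow> real \<Rightarrow> real \<Rightarrow> poly3" where
  "crit_poly h A B C = det (vector [weighted_vars A B C, (\<chi> i. var i), (\<chi> i. pd i h)])"

lemma crit_ideal_eq: "crit_ideal h A B C = poly_ideal {crit_poly h A B C, h}"
  by (simp add: crit_ideal_def crit_poly_def)

definition square_norm_poly :: poly3 where
  "square_norm_poly = var 1 * var 1 + var 2 * var 2 + var 3 * var 3"

definition weight_poly :: "real \<Rightarrow> real \<Rightarrow> real \<Rightarrow> poly3" where
  "weight_poly A B C = const A * (var 1 * var 1) + const B * (var 2 * var 2) + const C * (var 3 * var 3)"

lemma rval_two: "rval 2 x = 2"
  by (metis one_add_one rval_hom(1,2))

text \<open>The gradients of the squared norm and of the weighted form are twice the second and the first row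
  of the matrix that defines \<open>D\<close>; exchanging the outer rows gives the sign.\<close>

lemma jacobian_crit_poly:
  "det (\<chi> i j. rval (pd j ((vector [h, square_norm_poly, weight_poly A B C] :: poly3 ^ 3) $ i)) x)
    = - 4 * rval (crit_poly h A B C) x"
  by (simp add: det_3 crit_poly_def weighted_vars_def square_norm_poly_def weight_poly_def
      pd_add pd_mult pd_var pd_const rval_hom rval_const rval_var rval_two algebra_simps)

lemma rval_square_norm_poly: "rval square_norm_poly x = inner x x"
  by (simp add: square_norm_poly_def rval_hom rval_var inner_vec_def sum_3)

text \<open>The point is the one where the weighted form is maximal on the set \<open>K\<close> of points of the surface with
  the norm of \<open>p0\<close> and the value of the quotient at \<open>p0\<close>. The curve \<open>\<gamma>\<close> in the proof by contradiction
  increases the weighted form with unit speed and leaves \<open>h\<close> and the norm unchanged. It is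
  orthogonal to the position vector, hence to the gradient of the quotient, and so it stays in
  \<open>K\<close>.\<close>

lemma quotient_value_on_crit:
  assumes g: "\<And>x. norm x = norm p0 \<Longrightarrow> rval g x \<noteq> 0"
    and disc: "\<And>x i j. rval h x = 0 \<Longrightarrow> rval (disc_poly f g i j) x = 0"
    and p0: "p0 \<noteq> 0" "rval h p0 = 0"
  shows "\<exists>p. norm p = norm p0 \<and> rval h p = 0 \<and> rval (crit_poly h A B C) p = 0 \<and>
    quotient_fun f g p = quotient_fun f g p0"
proof -
  define q where "q = quotient_fun f g"
  define K where "K = {p \<in> sphere 0 (norm p0). q p = q p0} \<inter> {p. rval h p = 0}"
  have K: "p \<in> K \<longleftrightarrow> norm p = norm p0 \<and> q p = q p0 \<and> rval h p = 0" for p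
    by (auto simp: K_def)
  have "continuous_on (sphere 0 (norm p0)) q"
    unfolding q_def using g by (intro continuous_on_quotient_fun) auto
  then have "closed {p \<in> sphere 0 (norm p0). q p = q p0}"
    by (intro continuous_closed_preimage_constant) auto
  moreover have "closed {p. rval h p = 0}"
    by (intro closed_Collect_eq continuous_on_rval continuous_on_const)
  ultimately have "closed K"
    by (auto simp: K_def)
  moreover have "bounded K"
    by (rule bounded_subset[of "sphere 0 (norm p0)"]) (auto simp: K_def)
  ultimately have "compact K"
    by (simp add: compact_eq_bounded_closed)
  moreover have "p0 \<in> K"
    using p0 by (simp add: K)
  ultimately obtain p where p: "p \<in> K"
    and max: "\<And>x. x \<in> K \<Longrightarrow> rval (weight_poly A B C) x \<le> rval (weight_poly A B C) p"
    using continuous_attains_sup[of K "rval (weight_poly A B C)"] continuous_on_rval by blast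
  have "rval (crit_poly h A B C) p = 0"
  proof (rule ccontr)
    assume nz: "rval (crit_poly h A B C) p \<noteq> 0"
    define F :: "poly3 ^ 3" where "F = vector [h, square_norm_poly, weight_poly A B C]"
    define \<Phi> where "\<Phi> x = (\<chi> i. rval (F $ i) x)" for x
    have "det (\<chi> i j. rval (pd j (F $ i)) p) \<noteq> 0"
      unfolding F_def jacobian_crit_poly using nz by simp
    from polynomial_map_local_inverse[OF this, folded \<Phi>_def]
    obtain V G where VG: "open V \<and> \<Phi> p \<in> V \<and> G (\<Phi> p) = p \<and>
        (\<forall>y\<in>V. \<Phi> (G y) = y) \<and> (\<forall>y\<in>V. \<exists>G'. (G has_derivative G') (at y))"
      by (elim exE) (rule that)
    then have V: "open V" "\<Phi> p \<in> V" and Gp: "G (\<Phi> p) = p"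
      and \<Phi>G: "\<And>y. y \<in> V \<Longrightarrow> \<Phi> (G y) = y"
      and G': "\<And>y. y \<in> V \<Longrightarrow> \<exists>G'. (G has_derivative G') (at y)"
      by auto
    define e :: "real ^ 3" where "e = axis 3 1"
    have e: "e $ 1 = 0" "e $ 2 = 0" "e $ 3 = 1"
      by (auto simp: e_def axis_def)
    define \<gamma> where "\<gamma> s = G (\<Phi> p + s *\<^sub>R e)" for s
    obtain \<epsilon> where \<epsilon>: "\<epsilon> > 0" "ball (\<Phi> p) \<epsilon> \<subseteq> V"
      using V open_contains_ball by blast
    have inV: "\<Phi> p + s *\<^sub>R e \<in> V" if "s \<in> {-\<epsilon><..<\<epsilon>}" for s
      using that \<epsilon>(2) by (auto simp: dist_norm e_def norm_axis_1 subset_iff)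
    have \<Phi>\<gamma>: "\<Phi> (\<gamma> s) = \<Phi> p + s *\<^sub>R e" if "s \<in> {-\<epsilon><..<\<epsilon>}" for s
      unfolding \<gamma>_def by (rule \<Phi>G[OF inV[OF that]])
    have comps: "rval h (\<gamma> s) = 0" "inner (\<gamma> s) (\<gamma> s) = inner p p"
      "rval (weight_poly A B C) (\<gamma> s) = rval (weight_poly A B C) p + s"
      if s: "s \<in> {-\<epsilon><..<\<epsilon>}" for s
    proof -
      have "\<Phi> (\<gamma> s) $ i = \<Phi> p $ i + s * e $ i" for i
        using \<Phi>\<gamma>[OF s] by simp
      from this[of 1] this[of 2] this[of 3]
      show "rval h (\<gamma> s) = 0" "inner (\<gamma> s) (\<gamma> s) = inner p p"
        "rval (weight_poly A B C) (\<gamma> s) = rval (weight_poly A B C) p + s"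
        using p by (auto simp: \<Phi>_def F_def e K rval_square_norm_poly)
    qed
    have norm\<gamma>: "norm (\<gamma> s) = norm p0" if "s \<in> {-\<epsilon><..<\<epsilon>}" for s
      using comps(2)[OF that] p by (simp add: norm_eq_sqrt_inner K)
    have "((\<lambda>s. q (\<gamma> s)) has_derivative (\<lambda>_. 0)) (at s within {-\<epsilon><..<\<epsilon>})"
      if s: "s \<in> {-\<epsilon><..<\<epsilon>}" for s
    proof -
      define x where "x = \<gamma> s"
      obtain G' where "(G has_derivative G') (at (\<Phi> p + s *\<^sub>R e))"
        using G'[OF inV[OF s]] by blast
      moreover have "((\<lambda>s. \<Phi> p + s *\<^sub>R e) has_derivative (\<lambda>t. t *\<^sub>R e)) (at s)"
        by (auto intro!: derivative_eq_intros)
      ultimately have "(\<gamma> has_derivative (\<lambda>t. G' (t *\<^sub>R e))) (at s)"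
        unfolding \<gamma>_def by (rule has_derivative_compose[rotated])
      then obtain v where v: "(\<gamma> has_derivative v) (at s)" by blast
      have "((\<lambda>s. rval square_norm_poly (\<gamma> s)) has_derivative (\<lambda>t. 2 * inner x (v t))) (at s)"
        by (rule has_derivative_eq_rhs[OF has_derivative_compose[OF v has_derivative_rval]])
          (simp add: sum_3 square_norm_poly_def pd_add pd_mult pd_var rval_hom rval_var rval_two
            inner_vec_def x_def algebra_simps)
      moreover have "((\<lambda>s. rval square_norm_poly (\<gamma> s)) has_derivative (\<lambda>t. 0)) (at s)"
        by (rule has_derivative_transform_within_open[OF has_derivative_const[of "inner p p"],
              where s = "{-\<epsilon><..<\<epsilon>}"])
          (use s comps(2) in \<open>auto simp: rval_square_norm_poly\<close>)
      ultimately have "(\<lambda>t. 2 * inner x (v t)) = (\<lambda>t. 0)"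
        by (rule has_derivative_unique)
      then have orth: "inner x (v t) = 0" for t
        by (simp add: fun_eq_iff)
      have gx: "rval g x \<noteq> 0"
        using norm\<gamma>[OF s] g by (simp add: x_def)
      \<comment> \<open>on the surface the gradient of the quotient is parallel to the position vector\<close>
      have par: "x $ i * quotient_grad f g j x = x $ j * quotient_grad f g i x" for i j
        using disc[OF comps(1)[OF s], of i j] gx by (simp add: rval_disc_poly flip: x_def)
      have "inner x x * quotient_grad f g j x = (\<Sum>i\<in>UNIV. x $ i * quotient_grad f g i x) * x $ j" for j
      proof -
        have "inner x x * quotient_grad f g j x = (\<Sum>i\<in>UNIV. x $ i * (x $ i * quotient_grad f g j x))"
          by (simp add: inner_vec_def sum_distrib_right mult.assoc)
        also have "\<dots> = (\<Sum>i\<in>UNIV. x $ i * (x $ j * quotient_grad f g i x))"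
          unfolding par[of _ j] ..
        also have "\<dots> = (\<Sum>i\<in>UNIV. x $ i * quotient_grad f g i x) * x $ j"
          unfolding sum_distrib_right by (intro sum.cong) (auto simp: mult_ac)
        finally show ?thesis .
      qed
      then have "inner x x * (\<Sum>j\<in>UNIV. quotient_grad f g j x * v t $ j) =
          (\<Sum>i\<in>UNIV. x $ i * quotient_grad f g i x) * inner x (v t)" for t
        by (simp add: inner_vec_def[of x "v t"] sum_distrib_left flip: mult.assoc)
      moreover have "inner x x \<noteq> 0"
        using norm\<gamma>[OF s] p0 by (auto simp: x_def)
      ultimately have "(\<Sum>j\<in>UNIV. quotient_grad f g j x * v t $ j) = 0" for t
        using orth by simp
      then have "((\<lambda>s. q (\<gamma> s)) has_derivative (\<lambda>_. 0)) (at s)"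
        using has_derivative_compose[OF v has_derivative_quotient_fun, of g f] gx
        by (simp add: q_def flip: x_def)
      then show ?thesis
        by (rule has_derivative_at_withinI)
    qed
    from has_derivative_zero_constant[OF _ this]
    obtain c where c: "\<And>s. s \<in> {-\<epsilon><..<\<epsilon>} \<Longrightarrow> q (\<gamma> s) = c"
      by (auto simp: convex_real_interval)
    have "\<gamma> 0 = p"
      using Gp by (simp add: \<gamma>_def)
    then have "q (\<gamma> (\<epsilon> / 2)) = q p0"
      using c[of 0] c[of "\<epsilon> / 2"] \<epsilon>(1) p by (simp add: K)
    then have "\<gamma> (\<epsilon> / 2) \<in> K"
      using \<epsilon>(1) norm\<gamma>[of "\<epsilon> / 2"] comps(1)[of "\<epsilon> / 2"] by (simp add: K)
    then show False
      using max[of "\<gamma> (\<epsilon> / 2)"] comps(3)[of "\<epsilon> / 2"] \<epsilon>(1) by simp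
  qed
  then show ?thesis
    using p by (auto simp: K q_def)
qed

lemma limit_from_crit:
  assumes g: "isolated_zero g"
    and disc: "\<And>x i j. rval h x = 0 \<Longrightarrow> rval (disc_poly f g i j) x = 0"
    and lim: "(quotient_fun f g \<longlongrightarrow> L) (at 0 within real_points (variety (crit_ideal h A B C)))"
  shows "(quotient_fun f g \<longlongrightarrow> L) (at 0 within real_points (variety {h}))"
  unfolding tendsto_at_0_within_iff
proof (intro allI impI)
  fix e :: real assume "e > 0"
  then obtain d where d: "d > 0"
    "\<And>p. p \<in> real_points (variety (crit_ideal h A B C)) \<Longrightarrow> p \<noteq> 0 \<Longrightarrow> norm p < d \<Longrightarrow> \<bar>quotient_fun f g p - L\<bar> < e"
    using lim unfolding tendsto_at_0_within_iff by meson
  obtain d0 where d0: "d0 > 0" "\<And>p. p \<noteq> 0 \<Longrightarrow> norm p < d0 \<Longrightarrow> rval g p \<noteq> 0"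
    using isolated_zero_nonzero[OF g] by blast
  have "\<bar>quotient_fun f g p0 - L\<bar> < e"
    if p0: "p0 \<in> real_points (variety {h})" "p0 \<noteq> 0" "norm p0 < min d d0" for p0
  proof -
    obtain p where p: "norm p = norm p0" "rval h p = 0" "rval (crit_poly h A B C) p = 0"
      "quotient_fun f g p = quotient_fun f g p0"
      using quotient_value_on_crit[of p0 g h f A B C] disc p0 d0
      by (metis min_less_iff_conj norm_eq_zero real_points_variety singletonI)
    then have "p \<in> real_points (variety (crit_ideal h A B C))"
      by (simp add: crit_ideal_eq real_points_variety_poly_ideal)
    then show ?thesis
      using d(2)[of p] p p0 by (metis min_less_iff_conj norm_eq_zero)
  qed
  then show "\<exists>d>0. \<forall>p\<in>real_points (variety {h}). p \<noteq> 0 \<and> norm p < d \<longrightarrow> \<bar>quotient_fun f g p - L\<bar> < e"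
    using d d0 by (intro exI[of _ "min d d0"]) auto
qed

text \<open>All three kinds of components lie in the surface, which gives one direction. The other one comes
  from the components of \<open>crit_ideal h A B C\<close>, on which the quotient takes all its values
  near the origin.\<close>

lemma surface_limit:
  assumes g: "isolated_zero g" and P: "P \<in> component_primes (disc_ideal f g)"
    and h: "variety P = variety {h}"
  shows "limit_along (quotient_fun f g) (variety P) L \<longleftrightarrow>
    (\<forall>Q\<in>component_primes (sing_ideal h) \<union> component_primes (crit_ideal h A B C) \<union>
      component_primes (tangency_ideal h A B C). limit_along (quotient_fun f g) (variety Q) L)"
    (is "?l \<longleftrightarrow> ?r")
proof
  have gen: "real_points (variety Q) \<subseteq> real_points (variety {h})"
    if "h \<in> S" "Q \<in> component_primes (poly_ideal S)" for S Q
    using real_points_component_subset[OF that(2)] that(1)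
    by (auto simp: real_points_variety_poly_ideal real_points_variety[of _ "{h}"])
  have sub: "real_points (variety Q) \<subseteq> real_points (variety {h})"
    if "Q \<in> component_primes (sing_ideal h) \<union> component_primes (crit_ideal h A B C) \<union>
      component_primes (tangency_ideal h A B C)" for Q
    using that unfolding sing_ideal_def crit_ideal_def tangency_ideal_def Let_def
    by (auto dest!: gen[rotated])
  show ?r if ?l
    using that sub unfolding limit_along_def h by (meson tendsto_within_subset)
  show ?l if ?r
    unfolding limit_along_def h
  proof (rule limit_from_crit[OF g])
    show "rval (disc_poly f g i j) x = 0" if "rval h x = 0" for x i j
    proof -
      have "x \<in> real_points (variety P)"
        using that unfolding h by (simp add: real_points_variety)
      then show ?thesis
        using real_points_component_subset[OF P] real_points_disc_ideal by blast
    qed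
    show "(quotient_fun f g \<longlongrightarrow> L) (at 0 within real_points (variety (crit_ideal h A B C)))"
      using \<open>?r\<close> by (intro limit_from_components) (auto simp: crit_ideal_def genideal_class_ideal)
  qed
qed


section \<open>Krull dimension and chains of primes\<close>

text \<open>Chains of primes over \<open>P\<close> correspond to chains of primes of the quotient by \<open>P\<close>, and thus compute its
  dimension without reference to the quotient ring.\<close>

definition prime_chain :: "'a::comm_ring_1 set \<Rightarrow> nat \<Rightarrow> (nat \<Rightarrow> 'a set) \<Rightarrow> bool" where
  "prime_chain P n C \<longleftrightarrow>
    (\<forall>i\<le>n. primeideal (C i) cring_class_ops \<and> P \<subseteq> C i) \<and> (\<forall>i<n. C i \<subset> C (Suc i))"

lemma coset_eq_iff:
  assumes "ideal P (cring_class_ops :: 'a::comm_ring_1 ring)"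
  shows "P +>\<^bsub>cring_class_ops\<^esub> a = P +>\<^bsub>cring_class_ops\<^esub> b \<longleftrightarrow> a - b \<in> P"
proof -
  have coset: "P +>\<^bsub>cring_class_ops\<^esub> c = {x. x - c \<in> P}" for c :: 'a
    by (force simp: a_r_coset_def' class_simps)
  have trans: "x - c \<in> P" if "b - c \<in> P" "x - b \<in> P" for x b c
  proof -
    have "(x - b) + (b - c) \<in> P"
      using assms that by (simp only: ideal_class_iff)
    then show ?thesis by simp
  qed
  have sym: "b - a \<in> P" if "a - b \<in> P"
  proof -
    have "(- 1) * (a - b) \<in> P"
      using assms that by (simp only: ideal_class_iff)
    then show ?thesis by simp
  qed
  have "a - a \<in> P"
    using assms by (simp add: ideal_class_iff)
  then have "a - b \<in> P" if "{x. x - a \<in> P} = {x. x - b \<in> P}"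
    using that by blast
  moreover have "{x. x - a \<in> P} = {x. x - b \<in> P}" if "a - b \<in> P"
    using trans[OF that] trans[OF sym[OF that]] by blast
  ultimately show ?thesis
    unfolding coset by blast
qed

lemma coset_zero: "P +>\<^bsub>cring_class_ops\<^esub> (0 :: 'a::comm_ring_1) = P"
  by (simp add: a_r_coset_def' class_simps)

lemma carrier_quot: "carrier (cring_class_ops Quot P) = range (\<lambda>h :: 'a::comm_ring_1. P +>\<^bsub>cring_class_ops\<^esub> h)"
  by (auto simp: FactRing_def A_RCOSETS_def' carrier_class)

lemma mult_quot:
  assumes "ideal P (cring_class_ops :: 'a::comm_ring_1 ring)"
  shows "(P +>\<^bsub>cring_class_ops\<^esub> a) \<otimes>\<^bsub>cring_class_ops Quot P\<^esub> (P +>\<^bsub>cring_class_ops\<^esub> b)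
    = P +>\<^bsub>cring_class_ops\<^esub> (a * b)"
  using ideal.rcoset_mult_add[OF assms, of a b] by (simp add: FactRing_def class_simps)

lemma primeideal_quot_vimage:
  assumes P: "ideal P (cring_class_ops :: 'a::comm_ring_1 ring)"
    and C: "primeideal C (cring_class_ops Quot P)"
  shows "primeideal {h. P +>\<^bsub>cring_class_ops\<^esub> h \<in> C} cring_class_ops"
    and "P \<subseteq> {h. P +>\<^bsub>cring_class_ops\<^esub> h \<in> C}"
proof -
  show "primeideal {h. P +>\<^bsub>cring_class_ops\<^esub> h \<in> C} cring_class_ops"
    using ring_hom_ring.primeideal_vimage[OF ideal.rcos_ring_hom_ring[OF P] cring_class C]
    by (simp add: carrier_class)
  have "P \<in> C"
    using C unfolding primeideal_def ideal_def
    by (metis (no_types, lifting) FactRing_def additive_subgroup.zero_closed ring.simps(1))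
  moreover have "P +>\<^bsub>cring_class_ops\<^esub> h = P" if "h \<in> P" for h
    using coset_eq_iff[OF P, of h 0] that by (simp add: coset_zero)
  ultimately show "P \<subseteq> {h. P +>\<^bsub>cring_class_ops\<^esub> h \<in> C}"
    by auto
qed

lemma primeideal_quot_image:
  assumes P: "ideal P (cring_class_ops :: 'a::comm_ring_1 ring)"
    and D: "primeideal D cring_class_ops" "P \<subseteq> D"
  shows "primeideal ((\<lambda>h. P +>\<^bsub>cring_class_ops\<^esub> h) ` D) (cring_class_ops Quot P)"
proof -
  have mem: "P +>\<^bsub>cring_class_ops\<^esub> h \<in> (\<lambda>h. P +>\<^bsub>cring_class_ops\<^esub> h) ` D \<longleftrightarrow> h \<in> D" for h
  proof
    assume "P +>\<^bsub>cring_class_ops\<^esub> h \<in> (\<lambda>h. P +>\<^bsub>cring_class_ops\<^esub> h) ` D"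
    then obtain d where d: "d \<in> D" "h - d \<in> P"
      by (auto simp: coset_eq_iff[OF P])
    then have "(h - d) + d \<in> D"
      using D by (auto simp only: primeideal_class_iff ideal_class_iff)
    then show "h \<in> D" by simp
  qed auto
  show ?thesis
  proof (rule primeidealI)
    show "ideal ((\<lambda>h. P +>\<^bsub>cring_class_ops\<^esub> h) ` D) (cring_class_ops Quot P)"
      using ring.ring_ideal_imp_quot_ideal[OF cring_class.ring_axioms P] D
      by (simp add: primeideal_def)
    show "cring (cring_class_ops Quot P)"
      by (rule ideal.quotient_is_cring[OF P cring_class])
    show "carrier (cring_class_ops Quot P) \<noteq> (\<lambda>h. P +>\<^bsub>cring_class_ops\<^esub> h) ` D"
    proof
      assume "carrier (cring_class_ops Quot P) = (\<lambda>h. P +>\<^bsub>cring_class_ops\<^esub> h) ` D"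
      then have "1 \<in> D"
        using mem[of 1] unfolding carrier_quot by blast
      then show False
        using D by (simp add: primeideal_class_iff)
    qed
    show "u \<in> (\<lambda>h. P +>\<^bsub>cring_class_ops\<^esub> h) ` D \<or> v \<in> (\<lambda>h. P +>\<^bsub>cring_class_ops\<^esub> h) ` D"
      if uv: "u \<in> carrier (cring_class_ops Quot P)" "v \<in> carrier (cring_class_ops Quot P)"
        "u \<otimes>\<^bsub>cring_class_ops Quot P\<^esub> v \<in> (\<lambda>h. P +>\<^bsub>cring_class_ops\<^esub> h) ` D" for u v
    proof -
      obtain a b where "u = P +>\<^bsub>cring_class_ops\<^esub> a" "v = P +>\<^bsub>cring_class_ops\<^esub> b"
        using uv(1,2) by (auto simp: carrier_quot)
      moreover from this have "a * b \<in> D"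
        using uv(3) mem[of "a * b"] by (simp add: mult_quot[OF P])
      ultimately show ?thesis
        using mem D(1) by (auto simp: primeideal_class_iff)
    qed
  qed
qed

lemma krull_dim_quot:
  assumes P: "ideal P (cring_class_ops :: 'a::comm_ring_1 ring)"
  shows "krull_dim (cring_class_ops Quot P) = Sup {enat n | n. \<exists>C. prime_chain P n C}"
proof -
  have "(\<exists>C. (\<forall>i\<le>n. primeideal (C i) (cring_class_ops Quot P)) \<and> (\<forall>i<n. C i \<subset> C (Suc i))) \<longleftrightarrow>
    (\<exists>C. prime_chain P n C)" for n
  proof
    assume "\<exists>C. (\<forall>i\<le>n. primeideal (C i) (cring_class_ops Quot P)) \<and> (\<forall>i<n. C i \<subset> C (Suc i))"
    then obtain C where C: "\<And>i. i \<le> n \<Longrightarrow> primeideal (C i) (cring_class_ops Quot P)"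
      "\<And>i. i < n \<Longrightarrow> C i \<subset> C (Suc i)" by blast
    define D where "D i = {h. P +>\<^bsub>cring_class_ops\<^esub> h \<in> C i}" for i
    have "D i \<subset> D (Suc i)" if i: "i < n" for i
    proof -
      obtain u where u: "u \<in> C (Suc i)" "u \<notin> C i"
        using C(2)[OF i] by blast
      have "C (Suc i) \<subseteq> carrier (cring_class_ops Quot P)"
        using C(1)[of "Suc i"] i additive_subgroup.a_subset by (fastforce simp: primeideal_def ideal_def)
      then obtain h where "u = P +>\<^bsub>cring_class_ops\<^esub> h"
        using u by (auto simp: carrier_quot)
      then show ?thesis
        using C(2)[OF i] u by (auto simp: D_def)
    qed
    then have "prime_chain P n D"
      using primeideal_quot_vimage[OF P C(1)] by (auto simp: prime_chain_def D_def)
    then show "\<exists>C. prime_chain P n C" by blast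
  next
    assume "\<exists>C. prime_chain P n C"
    then obtain D where D: "\<And>i. i \<le> n \<Longrightarrow> primeideal (D i) cring_class_ops \<and> P \<subseteq> D i"
      "\<And>i. i < n \<Longrightarrow> D i \<subset> D (Suc i)"
      by (auto simp: prime_chain_def)
    define C where "C i = (\<lambda>h. P +>\<^bsub>cring_class_ops\<^esub> h) ` D i" for i
    have "C i \<subset> C (Suc i)" if i: "i < n" for i
    proof -
      obtain h where h: "h \<in> D (Suc i)" "h \<notin> D i"
        using D(2)[OF i] by blast
      have "P +>\<^bsub>cring_class_ops\<^esub> h \<notin> C i"
      proof
        assume "P +>\<^bsub>cring_class_ops\<^esub> h \<in> C i"
        then obtain d where d: "d \<in> D i" "h - d \<in> P"
          by (auto simp: C_def coset_eq_iff[OF P])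
        then have "(h - d) + d \<in> D i"
          using D(1)[OF less_imp_le[OF i]] by (auto simp only: primeideal_class_iff ideal_class_iff)
        then show False
          using h by simp
      qed
      then show ?thesis
        using h D(2)[OF i] by (auto simp: C_def)
    qed
    then show "\<exists>C. (\<forall>i\<le>n. primeideal (C i) (cring_class_ops Quot P)) \<and> (\<forall>i<n. C i \<subset> C (Suc i))"
      using primeideal_quot_image[OF P] D(1) by (intro exI[of _ C]) (auto simp: C_def)
  qed
  then show ?thesis
    by (simp add: krull_dim_def)
qed

lemma variety_dim_ge:
  assumes "ideal P cring_class_ops" "prime_chain P n C"
  shows "enat n \<le> variety_dim P"
  unfolding variety_dim_def krull_dim_quot[OF assms(1)]
  using assms(2) by (intro Sup_upper) blast

lemma variety_dim_le:
  assumes "ideal P cring_class_ops" "\<And>m C. prime_chain P m C \<Longrightarrow> m \<le> n"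
  shows "variety_dim P \<le> enat n"
  unfolding variety_dim_def krull_dim_quot[OF assms(1)]
  using assms(2) by (intro Sup_least) auto


section \<open>Algebraic dependence bounds chains of primes\<close>

text \<open>Gaussian elimination without division: a column with a nonzero entry in row \<open>i\<close> is used to clear
  that row in all the other columns.\<close>

lemma underdetermined_system:
  fixes A :: "'i \<Rightarrow> 'j \<Rightarrow> 'a::idom"
  assumes "finite I" "finite J" "card I < card J"
  shows "\<exists>c. (\<exists>j\<in>J. c j \<noteq> 0) \<and> (\<forall>i\<in>I. (\<Sum>j\<in>J. c j * A i j) = 0)"
  using assms
proof (induction I arbitrary: J A rule: finite_induct)
  case empty
  then show ?case
    by (intro exI[of _ "\<lambda>_. 1"]) (auto simp: card_gt_0_iff)
next
  case (insert i I)
  show ?case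
  proof (cases "\<forall>j\<in>J. A i j = 0")
    case True
    have "card I < card J"
      using insert.prems insert.hyps by simp
    from insert.IH[OF insert.prems(1) this, of A] show ?thesis
      using True by auto
  next
    case False
    then obtain j0 where j0: "j0 \<in> J" "A i j0 \<noteq> 0" by auto
    define J' where "J' = J - {j0}"
    define A' where "A' k j = A i j0 * A k j - A k j0 * A i j" for k j
    have J': "finite J'" "J = insert j0 J'" "j0 \<notin> J'"
      using j0 insert.prems by (auto simp: J'_def)
    then have "card I < card J'"
      using insert.prems insert.hyps by simp
    from insert.IH[OF J'(1) this, of A'] obtain c where
      c: "\<exists>j\<in>J'. c j \<noteq> 0" "\<And>k. k \<in> I \<Longrightarrow> (\<Sum>j\<in>J'. c j * A' k j) = 0" by blast
    define c' where "c' j = (if j = j0 then - (\<Sum>j\<in>J'. c j * A i j) else A i j0 * c j)" for j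
    have sum: "(\<Sum>j\<in>J. c' j * A k j) = A i j0 * (\<Sum>j\<in>J'. c j * A k j) - A k j0 * (\<Sum>j\<in>J'. c j * A i j)" for k
    proof -
      have "(\<Sum>j\<in>J'. c' j * A k j) = A i j0 * (\<Sum>j\<in>J'. c j * A k j)"
        unfolding sum_distrib_left using J'(3) by (intro sum.cong) (auto simp: c'_def)
      then show ?thesis
        unfolding J'(2) using J'(1,3) by (simp add: c'_def)
    qed
    have "(\<Sum>j\<in>J. c' j * A k j) = 0" if "k \<in> insert i I" for k
    proof (cases "k = i")
      case False
      have "(\<Sum>j\<in>J'. c j * A' k j) = A i j0 * (\<Sum>j\<in>J'. c j * A k j) - A k j0 * (\<Sum>j\<in>J'. c j * A i j)"
        unfolding sum_distrib_left sum_subtractf[symmetric]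
        by (intro sum.cong) (auto simp: A'_def algebra_simps)
      then show ?thesis
        using c(2)[of k] that False sum by simp
    qed (simp add: sum)
    moreover have "\<exists>j\<in>J. c' j \<noteq> 0"
    proof -
      obtain j where "j \<in> J'" "c j \<noteq> 0"
        using c(1) by blast
      then have "c' j \<noteq> 0" "j \<in> J"
        using j0(2) J' by (auto simp: c'_def)
      then show ?thesis by blast
    qed
    ultimately show ?thesis by blast
  qed
qed

text \<open>The polynomials of degree at most \<open>d\<close> in each variable, a space of dimension \<open>(d + 1)\<^sup>3\<close>.\<close>

definition bounded_degrees :: "nat \<Rightarrow> poly3 set" where
  "bounded_degrees d = {p. \<forall>i j k. d < i \<or> d < j \<or> d < k \<longrightarrow> coeff (coeff (coeff p i) j) k = 0}"

lemma coeff3_mult: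
  "coeff (coeff (coeff (p * q :: poly3) i) j) k = (\<Sum>a\<le>i. \<Sum>b\<le>j. \<Sum>c\<le>k.
    coeff (coeff (coeff p a) b) c * coeff (coeff (coeff q (i - a)) (j - b)) (k - c))"
  by (simp add: coeff_mult coeff_sum)

lemma bounded_degrees_mult:
  assumes "p \<in> bounded_degrees d" "q \<in> bounded_degrees e"
  shows "p * q \<in> bounded_degrees (d + e)"
  unfolding bounded_degrees_def
proof (intro CollectI allI impI)
  fix i j k assume out: "d + e < i \<or> d + e < j \<or> d + e < k"
  have "coeff (coeff (coeff p a) b) c * coeff (coeff (coeff q (i - a)) (j - b)) (k - c) = 0"
    if "a \<le> i" "b \<le> j" "c \<le> k" for a b c
  proof -
    have "d < a \<or> d < b \<or> d < c \<or> e < i - a \<or> e < j - b \<or> e < k - c"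
      using out that by linarith
    then show ?thesis
      using assms by (auto simp: bounded_degrees_def)
  qed
  then show "coeff (coeff (coeff (p * q) i) j) k = 0"
    unfolding coeff3_mult by (intro sum.neutral ballI) auto
qed

lemma bounded_degrees_mono: "d \<le> e \<Longrightarrow> bounded_degrees d \<subseteq> bounded_degrees e"
  by (auto simp: bounded_degrees_def)

lemma ex_bounded_degrees: "\<exists>d. p \<in> bounded_degrees d"
proof (induction p rule: poly3_generated)
  case (1 a)
  have "const a \<in> bounded_degrees 0"
    by (auto simp: bounded_degrees_def const_def coeff_pCons split: nat.splits)
  then show ?case ..
next
  case (2 i)
  have "var i \<in> bounded_degrees 1"
    using exhaust_3[of i] by (auto simp: bounded_degrees_def var_simps coeff_pCons split: nat.splits)
  then show ?case ..
next
  case (3 p q)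
  then obtain d e where "p \<in> bounded_degrees d" "q \<in> bounded_degrees e" by blast
  then have "p + q \<in> bounded_degrees (max d e)"
    by (auto simp: bounded_degrees_def)
  then show ?case ..
next
  case (4 p q)
  then show ?case
    using bounded_degrees_mult by blast
qed

lemma bounded_degrees_power: "p \<in> bounded_degrees d \<Longrightarrow> p ^ n \<in> bounded_degrees (n * d)"
proof (induction n)
  case 0
  have "const 1 \<in> bounded_degrees 0"
    by (auto simp: bounded_degrees_def const_def coeff_pCons split: nat.splits)
  then show ?case
    by (simp add: const_def one_pCons)
next
  case (Suc n)
  then show ?case
    using bounded_degrees_mult[of p d "p ^ n" "n * d"] by simp
qed

lemma coeff3_const_mult: "coeff (coeff (coeff (const c * p) i) j) k = c * coeff (coeff (coeff p i) j) k"
  by (simp add: const_def)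

lemma poly3_eqI: "(\<And>i j k. coeff (coeff (coeff p i) j) k = coeff (coeff (coeff q i) j) k) \<Longrightarrow> p = (q :: poly3)"
  by (intro poly_eqI) auto

text \<open>The \<open>N\<^sup>4\<close> monomials in \<open>a1, a2, a3, a4\<close> with exponents below \<open>N\<close> lie in a space of dimension
  \<open>(d N + 1)\<^sup>3\<close>, where \<open>d\<close> depends on the \<open>a\<close>'s only. For large \<open>N\<close> they are too many to be
  independent. The relation is written in nested form so that its lowest terms can be
  peeled off one variable at a time.\<close>

lemma four_polys_dependent:
  fixes a1 a2 a3 a4 :: poly3
  shows "\<exists>N c. (\<exists>i<N. \<exists>j<N. \<exists>k<N. \<exists>l<N. c i j k l \<noteq> 0) \<and>
    (\<Sum>i<N. a1 ^ i * (\<Sum>j<N. a2 ^ j * (\<Sum>k<N. a3 ^ k * (\<Sum>l<N. a4 ^ l * const (c i j k l))))) = 0"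
proof -
  obtain d1 d2 d3 d4 where d: "a1 \<in> bounded_degrees d1" "a2 \<in> bounded_degrees d2" "a3 \<in> bounded_degrees d3" "a4 \<in> bounded_degrees d4"
    using ex_bounded_degrees by meson
  define d where "d = d1 + d2 + d3 + d4"
  define N where "N = (d + 1) ^ 3 + 1"
  define mono where "mono = (\<lambda>(i, j, k, l). a1 ^ i * (a2 ^ j * (a3 ^ k * a4 ^ l)))"
  define J where "J = {..<N} \<times> {..<N} \<times> {..<N} \<times> {..<N}"
  define I where "I = {..d * N} \<times> {..d * N} \<times> {..d * N}"
  have mono_bounded: "mono t \<in> bounded_degrees (d * N)" if "t \<in> J" for t
  proof -
    obtain i j k l where t: "t = (i, j, k, l)" by (metis surj_pair)
    then have "i \<le> N" "j \<le> N" "k \<le> N" "l \<le> N"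
      using that by (auto simp: J_def)
    then have "i * d1 + (j * d2 + (k * d3 + l * d4)) \<le> N * d1 + (N * d2 + (N * d3 + N * d4))"
      by (intro add_mono mult_right_mono) auto
    then have "i * d1 + (j * d2 + (k * d3 + l * d4)) \<le> d * N"
      by (simp add: d_def algebra_simps)
    moreover have "mono t \<in> bounded_degrees (i * d1 + (j * d2 + (k * d3 + l * d4)))"
      unfolding t mono_def prod.case by (intro bounded_degrees_mult bounded_degrees_power d)
    ultimately show ?thesis
      using bounded_degrees_mono by blast
  qed
  have "card I < card J"
  proof -
    have "d * N + 1 \<le> (d + 1) * N"
      by (simp add: N_def)
    then have "(d * N + 1) ^ 3 \<le> ((d + 1) * N) ^ 3"
      by (rule power_mono) simp
    also have "\<dots> = (d + 1) ^ 3 * N ^ 3"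
      by (rule power_mult_distrib)
    also have "\<dots> < N * N ^ 3"
      by (intro mult_strict_right_mono) (auto simp: N_def)
    finally show ?thesis
      by (simp add: I_def J_def card_cartesian_product power3_eq_cube numeral_eq_Suc mult.assoc)
  qed
  then obtain c where c: "\<exists>t\<in>J. c t \<noteq> 0"
    "\<And>i j k. (i, j, k) \<in> I \<Longrightarrow> (\<Sum>t\<in>J. c t * coeff (coeff (coeff (mono t) i) j) k) = 0"
    using underdetermined_system[of I J "\<lambda>(i, j, k) t. coeff (coeff (coeff (mono t) i) j) k"]
    by (fastforce simp: I_def J_def)
  have "(\<Sum>t\<in>J. const (c t) * mono t) = 0"
  proof (rule poly3_eqI)
    fix i j k
    have "(\<Sum>t\<in>J. c t * coeff (coeff (coeff (mono t) i) j) k) = 0"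
    proof (cases "(i, j, k) \<in> I")
      case False
      then have "d * N < i \<or> d * N < j \<or> d * N < k"
        by (auto simp: I_def)
      then have "coeff (coeff (coeff (mono t) i) j) k = 0" if "t \<in> J" for t
        using mono_bounded[OF that] by (auto simp: bounded_degrees_def)
      then show ?thesis by simp
    qed (rule c(2))
    then show "coeff (coeff (coeff (\<Sum>t\<in>J. const (c t) * mono t) i) j) k = coeff (coeff (coeff 0 i) j) k"
      by (simp add: coeff_sum coeff3_const_mult)
  qed
  moreover have "(\<Sum>t\<in>J. const (c t) * mono t) =
    (\<Sum>i<N. a1 ^ i * (\<Sum>j<N. a2 ^ j * (\<Sum>k<N. a3 ^ k * (\<Sum>l<N. a4 ^ l * const (c (i, j, k, l))))))"
    by (simp add: J_def mono_def sum_distrib_left sum.cartesian_product' algebra_simps)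
  ultimately show ?thesis
    using c(1) by (intro exI[of _ N] exI[of _ "\<lambda>i j k l. c (i, j, k, l)"]) (auto simp: J_def)
qed

text \<open>If \<open>a\<close> separates the primes \<open>Q \<subset> Q'\<close>, the lowest term of a relation in powers of \<open>a\<close>
  modulo \<open>Q\<close> is a relation modulo \<open>Q'\<close>.\<close>

lemma lowest_term_of_relation:
  assumes Q: "primeideal Q (cring_class_ops :: 'a::comm_ring_1 ring)" "primeideal Q' cring_class_ops" "Q \<subseteq> Q'"
    and a: "a \<in> Q'" "a \<notin> Q"
    and sum: "(\<Sum>k<N. a ^ k * S k) \<in> Q"
    and Z: "\<And>k. k < N \<Longrightarrow> S k \<in> Q' \<Longrightarrow> Z k" "\<And>k. k < N \<Longrightarrow> Z k \<Longrightarrow> S k = 0"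
    and k: "k < N"
  shows "Z k"
  using k
proof (induction k rule: less_induct)
  case (less k)
  define T where "T = (\<Sum>j\<in>{Suc k..<N}. a ^ (j - Suc k) * S j)"
  have "(\<Sum>k<N. a ^ k * S k) = (\<Sum>j\<in>{k..<N}. a ^ j * S j)"
    by (rule sum.mono_neutral_right) (use less Z(2) in auto)
  also have "\<dots> = a ^ k * S k + (\<Sum>j\<in>{Suc k..<N}. a ^ j * S j)"
    using less.prems by (simp add: sum.atLeast_Suc_lessThan)
  also have "(\<Sum>j\<in>{Suc k..<N}. a ^ j * S j) = a ^ k * (a * T)"
    unfolding T_def sum_distrib_left
  proof (rule sum.cong)
    fix j assume "j \<in> {Suc k..<N}"
    then have "a ^ j = a ^ k * (a * a ^ (j - Suc k))"
      by (metis atLeastLessThan_iff le_add_diff_inverse power_Suc power_add add_Suc_shift)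
    then show "a ^ j * S j = a ^ k * (a * (a ^ (j - Suc k) * S j))"
      by (simp add: mult.assoc)
  qed simp
  finally have "a ^ k * (S k + a * T) \<in> Q"
    using sum by (simp add: distrib_left)
  moreover have "a ^ k \<notin> Q"
    using primeideal_class_power[OF Q(1)] a by blast
  ultimately have "S k + a * T \<in> Q'"
    using Q by (auto simp: primeideal_class_iff)
  moreover have "a * T \<in> Q'"
    using Q(2) a by (metis ideal_class_iff mult.commute primeideal_class_iff)
  ultimately have "(S k + a * T) - a * T \<in> Q'"
    using Q(2) ideal_class_diff unfolding primeideal_class_iff by blast
  then show ?case
    using Z(1) less.prems by simp
qed

text \<open>Take \<open>a i\<close> in \<open>C (Suc i)\<close> but not in \<open>C i\<close>. By \<open>lowest_term_of_relation\<close>, a relation between the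
  \<open>a i\<close> that holds modulo \<open>C 0\<close> descends step by step to its coefficients, which would have to lie
  in \<open>C 4\<close>. A prime contains no constant but \<open>0\<close>, so all coefficients are zero.\<close>

lemma no_prime_chain_4:
  assumes "prime_chain (P :: poly3 set) 4 C"
  shows False
proof -
  have C: "primeideal (C i) cring_class_ops" if "i \<le> 4" for i
    using assms that by (auto simp: prime_chain_def)
  have sub: "C i \<subset> C (Suc i)" if "i < 4" for i
    using assms that by (auto simp: prime_chain_def)
  have "\<exists>a. a \<in> C (Suc i) \<and> a \<notin> C i" if "i < 4" for i
    using sub[OF that] by blast
  then obtain a where a: "\<And>i. i < 4 \<Longrightarrow> a i \<in> C (Suc i)" "\<And>i. i < 4 \<Longrightarrow> a i \<notin> C i"
    by metis
  obtain N c where c: "\<exists>i<N. \<exists>j<N. \<exists>k<N. \<exists>l<N. c i j k l \<noteq> 0"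
    and rel: "(\<Sum>i<N. a 0 ^ i * (\<Sum>j<N. a 1 ^ j * (\<Sum>k<N. a 2 ^ k * (\<Sum>l<N. a 3 ^ l * const (c i j k l))))) = 0"
    by (rule exE[OF four_polys_dependent[of "a 0" "a 1" "a 2" "a 3"]], erule exE, erule conjE, rule that)
  have scalar: "t = 0" if "const t \<in> C 4" for t
  proof (rule ccontr)
    assume "t \<noteq> 0"
    then have "const (1 / t) * const t = 1"
      by (simp add: const_def one_pCons)
    moreover have "const (1 / t) * const t \<in> C 4"
      using C[of 4] that by (auto simp: primeideal_class_iff ideal_class_iff)
    ultimately show False
      using C[of 4] by (simp add: primeideal_class_iff)
  qed
  have const0: "const 0 = 0"
    by (simp add: const_def)
  define S3 where "S3 i j k = (\<Sum>l<N. a 3 ^ l * const (c i j k l))" for i j k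
  define S2 where "S2 i j = (\<Sum>k<N. a 2 ^ k * S3 i j k)" for i j
  define S1 where "S1 i = (\<Sum>j<N. a 1 ^ j * S2 i j)" for i
  have le: "C 0 \<subseteq> C 1" "C 1 \<subseteq> C 2" "C 2 \<subseteq> C 3" "C 3 \<subseteq> C 4"
    using sub[of 0] sub[of 1] sub[of 2] sub[of 3] by (auto simp: numeral_eq_Suc)
  have a': "a 0 \<in> C 1" "a 0 \<notin> C 0" "a 1 \<in> C 2" "a 1 \<notin> C 1" "a 2 \<in> C 3" "a 2 \<notin> C 2" "a 3 \<in> C 4" "a 3 \<notin> C 3"
    using a[of 0] a[of 1] a[of 2] a[of 3] by (auto simp: numeral_eq_Suc)
  have Cs: "primeideal (C 0) cring_class_ops" "primeideal (C 1) cring_class_ops"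
    "primeideal (C 2) cring_class_ops" "primeideal (C 3) cring_class_ops" "primeideal (C 4) cring_class_ops"
    by (auto intro: C)
  have 3: "c i j k l = 0" if "S3 i j k \<in> C 3" "l < N" for i j k l
    by (rule lowest_term_of_relation[OF Cs(4,5) le(4) a'(7,8) that(1)[unfolded S3_def],
          where Z = "\<lambda>l. c i j k l = 0"])
      (use that(2) scalar in \<open>auto simp: const0\<close>)
  have 2: "\<forall>l<N. c i j k l = 0" if "S2 i j \<in> C 2" "k < N" for i j k
    by (rule lowest_term_of_relation[OF Cs(3,4) le(3) a'(5,6) that(1)[unfolded S2_def],
          where Z = "\<lambda>k. \<forall>l<N. c i j k l = 0"])
      (use that(2) 3 in \<open>auto simp: S3_def const0\<close>)
  have 1: "\<forall>k<N. \<forall>l<N. c i j k l = 0" if "S1 i \<in> C 1" "j < N" for i j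
    by (rule lowest_term_of_relation[OF Cs(2,3) le(2) a'(3,4) that(1)[unfolded S1_def],
          where Z = "\<lambda>j. \<forall>k<N. \<forall>l<N. c i j k l = 0"])
      (use that(2) 2 in \<open>auto simp: S2_def S3_def const0\<close>)
  have "(\<Sum>i<N. a 0 ^ i * S1 i) \<in> C 0"
    using rel Cs(1) by (simp add: S1_def S2_def S3_def primeideal_class_iff ideal_class_iff)
  then have "\<forall>j<N. \<forall>k<N. \<forall>l<N. c i j k l = 0" if "i < N" for i
    by (rule lowest_term_of_relation[OF Cs(1,2) le(1) a'(1,2),
          where Z = "\<lambda>i. \<forall>j<N. \<forall>k<N. \<forall>l<N. c i j k l = 0"])
      (use that 1 in \<open>auto simp: S1_def S2_def S3_def const0\<close>)
  then show False
    using c by blast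
qed

lemma prime_chain_mono: "prime_chain P n C \<Longrightarrow> m \<le> n \<Longrightarrow> prime_chain P m C"
  by (auto simp: prime_chain_def)

lemma zero_primeideal: "primeideal {0} (cring_class_ops :: 'a::idom ring)"
  by (auto simp: primeideal_class_iff ideal_class_iff)

text \<open>A chain of length three over \<open>P\<close> could be prolonged by the zero ideal to one of
  length four.\<close>

lemma variety_dim_le_2:
  assumes P: "primeideal P cring_class_ops" "P \<noteq> {0}"
  shows "variety_dim P \<le> 2"
proof -
  have "m \<le> 2" if "prime_chain P m C" for m C
  proof (rule ccontr)
    assume "\<not> m \<le> 2"
    then have C: "prime_chain P 3 C"
      using prime_chain_mono[OF that] by simp
    define D where "D i = (case i of 0 \<Rightarrow> {0} | Suc i \<Rightarrow> C i)" for i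
    have "0 \<in> P"
      using P by (auto simp: primeideal_class_iff ideal_class_iff)
    then obtain x where "x \<in> P" "x \<noteq> 0"
      using P(2) by auto
    moreover have "P \<subseteq> C 0"
      using C by (simp add: prime_chain_def)
    ultimately have "{0} \<subset> C 0"
      using \<open>0 \<in> P\<close> by auto
    then have "prime_chain {0} 4 D"
      using C zero_primeideal \<open>0 \<in> P\<close> by (auto simp: prime_chain_def D_def split: nat.splits)
    then show False
      by (rule no_prime_chain_4)
  qed
  then have "variety_dim P \<le> enat 2"
    using P by (intro variety_dim_le) (auto simp: primeideal_class_iff)
  then show ?thesis
    by (simp add: numeral_eq_enat)
qed

text \<open>\<open>P\<close> is contained in the ideal of the origin, and dimension zero leaves no room between them.\<close>

lemma variety_dim_0:
  assumes P: "primeideal P cring_class_ops" "variety_dim P = 0" "0 \<in> variety P"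
  shows "real_points (variety P) = {0}"
proof -
  define M where "M = {h. rval h 0 = 0}"
  have M: "primeideal M cring_class_ops"
    unfolding M_def by (rule prime_eval_kernel[OF is_hom_id])
  have "P \<subseteq> M"
    using P(3) by (auto simp: zero_in_variety M_def)
  have "P = M"
  proof (rule ccontr)
    assume "P \<noteq> M"
    then have "prime_chain P 1 (\<lambda>i. if i = 0 then P else M)"
      using P M \<open>P \<subseteq> M\<close> by (auto simp: prime_chain_def)
    then have "enat 1 \<le> variety_dim P"
      using P by (intro variety_dim_ge) (auto simp: primeideal_class_iff)
    then show False
      using P(2) by (simp add: zero_enat_def)
  qed
  then have "var i \<in> P" for i
    by (simp add: M_def rval_var)
  then have "p = 0" if "p \<in> real_points (variety P)" for p
    using that by (force simp: real_points_variety rval_var vec_eq_iff)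
  moreover have "0 \<in> real_points (variety P)"
    using P(3) by (simp add: real_points_variety zero_in_variety)
  ultimately show ?thesis by auto
qed

lemma limit_iff_limits_along_components:
  assumes g: "isolated_zero g" and nontrivial: "variety (disc_ideal f g) \<noteq> UNIV"
  shows "(quotient_fun f g \<longlongrightarrow> L) (at 0) \<longleftrightarrow>
    (\<forall>P\<in>relevant_components f g 1 \<union> relevant_components f g 2.
      limit_along (quotient_fun f g) (variety P) L)"
proof
  show "\<forall>P\<in>relevant_components f g 1 \<union> relevant_components f g 2.
      limit_along (quotient_fun f g) (variety P) L" if "(quotient_fun f g \<longlongrightarrow> L) (at 0)"
    using tendsto_within_subset[OF that] by (simp add: limit_along_def)
next
  assume lim: "\<forall>P\<in>relevant_components f g 1 \<union> relevant_components f g 2.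
      limit_along (quotient_fun f g) (variety P) L"
  show "(quotient_fun f g \<longlongrightarrow> L) (at 0)"
  proof (intro limit_from_disc[OF g] limit_from_components)
    show "ideal (disc_ideal f g) cring_class_ops"
      by (simp add: disc_ideal_def genideal_class_ideal)
    fix P assume P: "P \<in> component_primes (disc_ideal f g)" "0 \<in> variety P"
    then have prime: "primeideal P cring_class_ops" and sub: "disc_ideal f g \<subseteq> P"
      by (auto simp: minimal_primes_def)
    have "P \<noteq> {0}"
    proof
      assume "P = {0}"
      then have "variety (disc_ideal f g) = UNIV"
        using sub by (auto simp: variety_def eval3_hom[OF is_hom_of_real])
      then show False
        using nontrivial by simp
    qed
    then have "variety_dim P \<le> 2"
      by (rule variety_dim_le_2[OF prime])
    then obtain n where n: "variety_dim P = enat n" "n \<le> 2"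
      by (cases "variety_dim P") (auto simp: numeral_eq_enat)
    then consider "variety_dim P = 0" | "variety_dim P = 1" | "variety_dim P = 2"
      by (auto simp: numeral_eq_enat zero_enat_def one_enat_def numeral_eq_Suc le_Suc_eq)
    then show "limit_along (quotient_fun f g) (variety P) L"
    proof cases
      case 1
      have "at (0 :: real ^ 3) within {0} = bot"
        by (simp add: at_within_eq_bot_iff)
      then show ?thesis
        using variety_dim_0[OF prime 1 P(2)] by (simp add: limit_along_def)
    qed (use lim P in \<open>auto simp: relevant_components_def\<close>)
  qed
qed


section \<open>Algebraic relations on curves\<close>

lemma is_hom_map_poly:
  assumes "is_hom c"
  shows "is_hom (map_poly c)"
proof -
  note h = is_hom_simps[OF assms]
  have "map_poly c (p + q) = map_poly c p + map_poly c q" for p q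
    by (intro poly_eqI) (simp add: coeff_map_poly h)
  moreover have "map_poly c (p * q) = map_poly c p * map_poly c q" for p q
    by (intro poly_eqI) (simp add: coeff_map_poly h coeff_mult is_hom_sum[OF assms])
  ultimately show ?thesis
    by (simp add: is_hom_def h)
qed

lemma is_hom_poly: "is_hom (\<lambda>p. poly p (a :: 'a::comm_ring_1))"
  by (simp add: is_hom_def)

lemma prime_elem_dvd_kernel:
  assumes "is_hom \<phi>" "prime_elem (F :: 'b::idom)"
  shows "primeideal {h. F dvd \<phi> h} cring_class_ops"
  using assms(2)
  by (auto simp: primeideal_class_iff ideal_class_iff is_hom_simps[OF assms(1)] prime_elem_def)

text \<open>The degree is at most additive, so the factors cannot all be constants.\<close>

lemma prime_factor_of_positive_degree:
  fixes p :: "'a::{factorial_ring_gcd,semiring_gcd_mult_normalize} poly"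
  assumes "degree p \<ge> 1"
  shows "\<exists>q. prime_elem q \<and> q dvd p \<and> degree q \<ge> 1"
  using assms
proof (induction p rule: prime_divisors_induct)
  case (unit p)
  then show ?case
    by (auto simp: is_unit_poly_iff)
next
  case (factor q p)
  then have "degree (q * p) \<le> degree q + degree p"
    by (intro degree_mult_le)
  then consider "degree q \<ge> 1" | "degree p \<ge> 1"
    using factor.prems by linarith
  then show ?case
  proof cases
    case 1
    then show ?thesis
      using factor.hyps by (intro exI[of _ q]) auto
  next
    case 2
    then show ?thesis
      using factor.IH by (meson dvd_mult)
  qed
qed simp

lemma prime_factor_in_primeideal:
  fixes p :: "'a::{factorial_semiring,idom}"
  assumes P: "primeideal P cring_class_ops"
    and "p \<noteq> 0" "p \<in> P"
  shows "\<exists>q. prime_elem q \<and> q dvd p \<and> q \<in> P"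
  using assms(2,3)
proof (induction p rule: prime_divisors_induct)
  case (unit p)
  then obtain u where "1 = u * p"
    by (metis dvdE mult.commute)
  then show ?case
    using P unit.prems by (metis ideal_class_iff primeideal_class_iff)
next
  case (factor q p)
  then consider "q \<in> P" | "p \<in> P"
    using P by (auto simp: primeideal_class_iff)
  then show ?case
  proof cases
    case 1
    then show ?thesis
      using factor.hyps by (intro exI[of _ q]) auto
  next
    case 2
    moreover have "p \<noteq> 0"
      using factor.prems by auto
    ultimately obtain r where "prime_elem r" "r dvd p" "r \<in> P"
      using factor.IH by blast
    then show ?thesis
      by (intro exI[of _ r]) auto
  qed
qed simp

lemma nonzero_specialisation:
  fixes F :: "real poly poly"
  assumes "F \<noteq> 0"
  shows "\<exists>a. map_poly (\<lambda>r. poly r a) F \<noteq> 0"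
proof -
  obtain n where "coeff F n \<noteq> 0"
    using assms by (metis leading_coeff_0_iff)
  then obtain a where "poly (coeff F n) a \<noteq> 0"
    using poly_all_0_iff_0 by blast
  then have "coeff (map_poly (\<lambda>r. poly r a) F) n \<noteq> 0"
    by (simp add: coeff_map_poly)
  then show ?thesis
    by (metis coeff_0)
qed

text \<open>Either \<open>P\<close> is zero, and \<open>F\<close> may be any prime such as \<open>z\<close>, or it is generated by \<open>F\<close>: dividing an
  element of \<open>P\<close> by \<open>F\<close> over \<open>\<real>(x, y)\<close> only introduces denominators that are prime to \<open>F\<close>.\<close>

lemma prime_without_relation_principal:
  assumes P: "primeideal P (cring_class_ops :: poly3 ring)"
    and rel: "\<And>h. [:h:] \<in> P \<Longrightarrow> h = 0"
  shows "\<exists>F. prime_elem F \<and> degree F \<ge> 1 \<and> (\<forall>h\<in>P. F dvd h)"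
proof (cases "P = {0}")
  case True
  have "prime_elem (var 3)"
    unfolding var_simps using prime_elem_linear_poly[of 1 "0 :: poly2"] by simp
  then show ?thesis
    using True by (intro exI[of _ "var 3"]) (simp add: var_simps)
next
  case False
  have P': "0 \<in> P" "\<And>a b. a \<in> P \<Longrightarrow> b \<in> P \<Longrightarrow> a - b \<in> P" "\<And>a x. a \<in> P \<Longrightarrow> x * a \<in> P"
    using P ideal_class_diff by (auto simp: primeideal_class_iff ideal_class_iff)
  then obtain h0 where "h0 \<in> P \<and> h0 \<noteq> 0"
    using False by auto
  from ex_has_least_nat[of "\<lambda>h. h \<in> P \<and> h \<noteq> 0", OF this, of degree]
  obtain F0 where F0: "F0 \<in> P" "F0 \<noteq> 0"
    and min: "\<And>h. h \<in> P \<Longrightarrow> h \<noteq> 0 \<Longrightarrow> degree F0 \<le> degree h"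
    by auto
  \<comment> \<open>a prime factor of \<open>F0\<close> still has the least degree in \<open>z\<close>, so pseudo-division by it leaves no remainder\<close>
  obtain F where F: "prime_elem F" "F dvd F0" "F \<in> P"
    using prime_factor_in_primeideal[OF P F0(2,1)] by blast
  have "degree F \<le> degree F0"
    using dvd_imp_degree_le[OF F(2) F0(2)] .
  then have minF: "degree F \<le> degree h" if "h \<in> P" "h \<noteq> 0" for h
    using min[OF that] by simp
  have "F \<noteq> 0"
    using F(1) by auto
  have deg: "degree F \<ge> 1"
  proof (rule ccontr)
    assume "\<not> degree F \<ge> 1"
    then obtain h where "F = [:h:]"
      by (metis degree_eq_zeroE less_one not_le)
    then show False
      using rel F(3) \<open>F \<noteq> 0\<close> by auto
  qed
  have "F dvd h" if "h \<in> P" for h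
  proof -
    obtain a q where a: "a \<noteq> 0" "smult a h = F * q + pseudo_mod h F"
      using pseudo_mod(1)[OF \<open>F \<noteq> 0\<close>] by blast
    then have "pseudo_mod h F = [:a:] * h - q * F"
      by (simp add: mult.commute)
    then have "pseudo_mod h F \<in> P"
      using P'(2)[OF P'(3)[OF that, of "[:a:]"] P'(3)[OF F(3), of q]] by simp
    then have "pseudo_mod h F = 0"
      using pseudo_mod(2)[OF \<open>F \<noteq> 0\<close>, of h] minF by fastforce
    then have "F dvd [:a:] * h"
      using a by simp
    moreover have "\<not> F dvd [:a:]"
      using dvd_imp_degree_le[of F "[:a:]"] a(1) deg by auto
    ultimately show ?thesis
      using F(1) prime_elem_dvd_mult_iff by blast
  qed
  then show ?thesis
    using F deg by blast
qed

text \<open>If \<open>F(a, y, z)\<close> and a factor \<open>F\<^sub>1(y, z)\<close> of it at \<open>y = b\<close> still depend on \<open>z\<close>, then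
  the prime \<open>(F)\<close> lies below the prime of \<open>x = a, F\<^sub>1 = 0\<close>, and that below the prime of
  \<open>x = a, y = b, F\<^sub>2 = 0\<close>, where \<open>F\<^sub>2\<close> is a factor of \<open>F\<^sub>1(b, z)\<close>.\<close>

lemma prime_chain_without_relation:
  assumes P: "primeideal P (cring_class_ops :: poly3 ring)"
    and rel: "\<And>h. [:h:] \<in> P \<Longrightarrow> h = 0"
  shows "\<exists>C. prime_chain P 2 C"
proof -
  obtain F where F: "prime_elem F" "degree F \<ge> 1" "\<And>h. h \<in> P \<Longrightarrow> F dvd h"
    using prime_without_relation_principal[OF assms] by blast
  have "F \<noteq> 0"
    using F(1) by auto
  then obtain a where a: "map_poly (\<lambda>r. poly r a) (lead_coeff F) \<noteq> 0"
    using nonzero_specialisation[of "lead_coeff F"] by auto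
  define \<phi> :: "poly3 \<Rightarrow> poly2" where "\<phi> = map_poly (map_poly (\<lambda>r. poly r a))"
  have \<phi>: "is_hom \<phi>"
    unfolding \<phi>_def by (intro is_hom_map_poly is_hom_poly)
  have "coeff (\<phi> F) (degree F) \<noteq> 0"
    using a by (simp add: \<phi>_def coeff_map_poly)
  then have "degree (\<phi> F) \<ge> 1"
    using F(2) le_degree le_trans by blast
  then obtain F1 where F1: "prime_elem F1" "F1 dvd \<phi> F" "degree F1 \<ge> 1"
    using prime_factor_of_positive_degree by blast
  have "F1 \<noteq> 0"
    using F1(1) by auto
  then obtain b where b: "poly (lead_coeff F1) b \<noteq> 0"
    using poly_all_0_iff_0[of "lead_coeff F1"] by auto
  define \<psi> :: "poly2 \<Rightarrow> real poly" where "\<psi> = map_poly (\<lambda>r. poly r b)"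
  have \<psi>: "is_hom \<psi>"
    unfolding \<psi>_def by (intro is_hom_map_poly is_hom_poly)
  have "coeff (\<psi> F1) (degree F1) \<noteq> 0"
    using b by (simp add: \<psi>_def coeff_map_poly)
  then have "degree (\<psi> F1) \<ge> 1"
    using F1(3) le_degree le_trans by blast
  then obtain F2 where F2: "prime_elem F2" "F2 dvd \<psi> F1" "degree F2 \<ge> 1"
    using prime_factor_of_positive_degree by blast
  define Q1 where "Q1 = {h. F1 dvd \<phi> h}"
  define Q2 where "Q2 = {h. F2 dvd \<psi> (\<phi> h)}"
  have prime: "primeideal Q1 cring_class_ops" "primeideal Q2 cring_class_ops"
    unfolding Q1_def Q2_def using prime_elem_dvd_kernel[OF \<phi> F1(1)]
      prime_elem_dvd_kernel[OF is_hom_comp[OF \<psi> \<phi>] F2(1)] by auto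
  have dvd_hom: "\<xi> u dvd \<xi> v" if "u dvd v" "is_hom \<xi>" for \<xi> :: "poly3 \<Rightarrow> poly2" and u v
    using that by (metis dvd_def is_hom_mult)
  have dvd_hom': "\<psi> u dvd \<psi> v" if "u dvd v" for u v
    using that \<psi> by (metis dvd_def is_hom_mult)
  have sub: "P \<subseteq> Q1" "Q1 \<subseteq> Q2"
  proof
    show "h \<in> Q1" if "h \<in> P" for h
      unfolding Q1_def using dvd_trans[OF F1(2) dvd_hom[OF F(3)[OF that] \<phi>]] by simp
    show "Q1 \<subseteq> Q2"
    proof
      fix h assume "h \<in> Q1"
      then have "F1 dvd \<phi> h"
        by (simp add: Q1_def)
      then show "h \<in> Q2"
        unfolding Q2_def using dvd_trans[OF F2(2) dvd_hom'] by simp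
    qed
  qed
  define u v :: poly3 where "u = [:[:[:- a, 1:]:]:]" and "v = [:[:[:- b:], 1:]:]"
  have "\<phi> u = 0" "\<phi> v = [:[:- b, 1:]:]" "\<psi> (\<phi> v) = 0"
    by (auto simp: \<phi>_def \<psi>_def u_def v_def map_poly_pCons)
  moreover have "\<not> F dvd u"
    using dvd_imp_degree_le[of F u] F(2) by (auto simp: u_def)
  moreover have "\<not> F1 dvd [:[:- b, 1:]:]"
    using dvd_imp_degree_le[of F1 "[:[:- b, 1:]:]"] F1(3) by auto
  ultimately have "u \<in> Q1" "u \<notin> P" "v \<in> Q2" "v \<notin> Q1"
    using F(3) by (auto simp: Q1_def Q2_def)
  then have strict: "P \<subset> Q1" "Q1 \<subset> Q2"
    using sub by auto
  show ?thesis
    using P prime sub strict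
    by (intro exI[of _ "\<lambda>i. if i = 0 then P else if i = 1 then Q1 else Q2"])
      (auto simp: prime_chain_def less_2_cases_iff)
qed

lemma bij_with_values:
  assumes "i \<noteq> (j :: 3)"
  shows "\<exists>\<tau> :: 3 \<Rightarrow> 3. bij \<tau> \<and> \<tau> 1 = i \<and> \<tau> 2 = j"
proof -
  have "{i, j} \<noteq> UNIV"
  proof
    assume "{i, j} = UNIV"
    then have "card (UNIV :: 3 set) = card {i, j}" by simp
    then show False
      using assms by simp
  qed
  then obtain k where k: "k \<noteq> i" "k \<noteq> j" by auto
  define \<tau> where "\<tau> m = (if m = 1 then i else if m = 2 then j else k)" for m :: 3
  have "inj \<tau>"
    using assms k by (auto simp: inj_def \<tau>_def forall_3)
  then have "bij \<tau>"
    by (simp add: bij_def finite_UNIV_inj_surj)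
  then show ?thesis
    by (intro exI[of _ \<tau>]) (simp add: \<tau>_def)
qed

definition rename_vars :: "(3 \<Rightarrow> 3) \<Rightarrow> poly3 \<Rightarrow> poly3" where
  "rename_vars \<tau> h = eval3 const h (\<chi> m. var (\<tau> m))"

lemma is_hom_rename_vars: "is_hom (rename_vars \<tau>)"
  unfolding rename_vars_def by (intro is_hom_eval3 is_hom_const)

lemma rename_vars_comp: "rename_vars \<tau> (rename_vars \<sigma> h) = rename_vars (\<tau> \<circ> \<sigma>) h"
  by (simp add: rename_vars_def eval3_eval3 is_hom_const eval3_var)

lemma rename_vars_id: "rename_vars id h = h"
  by (simp add: rename_vars_def eval3_vars)

lemma primeideal_hom_vimage:
  assumes "is_hom \<phi>" "primeideal P cring_class_ops"
  shows "primeideal {h. \<phi> h \<in> P} cring_class_ops"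
  using assms(2) by (auto simp: primeideal_class_iff ideal_class_iff is_hom_simps[OF assms(1)])

text \<open>Renaming the variables \<open>i\<close> and \<open>j\<close> to \<open>x\<close> and \<open>y\<close> transports the chain of
  \<open>prime_chain_without_relation\<close>, which contradicts dimension one.\<close>

lemma curve_relation:
  assumes P: "primeideal P cring_class_ops" and dim: "variety_dim P = 1" and ij: "i \<noteq> j"
  shows "\<exists>h. h \<noteq> 0 \<and> eval2 const h (var i) (var j) \<in> P"
proof (rule ccontr)
  assume "\<not> ?thesis"
  then have none: "\<And>h. eval2 const h (var i) (var j) \<in> P \<Longrightarrow> h = 0" by blast
  obtain \<tau> :: "3 \<Rightarrow> 3" where \<tau>: "bij \<tau>" "\<tau> 1 = i" "\<tau> 2 = j"
    using bij_with_values[OF ij] by blast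
  define \<rho> where "\<rho> = inv_into UNIV \<tau>"
  have "\<tau> \<circ> \<rho> = id" "\<rho> \<circ> \<tau> = id"
    using bij_is_surj[OF \<tau>(1)] bij_is_inj[OF \<tau>(1)] by (simp_all add: \<rho>_def surj_iff inj_iff)
  then have inv: "rename_vars \<tau> (rename_vars \<rho> h) = h" "rename_vars \<rho> (rename_vars \<tau> h) = h" for h
    by (simp_all add: rename_vars_comp rename_vars_id)
  define P' where "P' = {h. rename_vars \<tau> h \<in> P}"
  have P': "primeideal P' cring_class_ops"
    unfolding P'_def by (rule primeideal_hom_vimage[OF is_hom_rename_vars P])
  have "rename_vars \<tau> [:h:] = eval2 const h (var i) (var j)" for h
    by (simp add: rename_vars_def eval3_simps is_hom_const \<tau>)
  then obtain C where C: "prime_chain P' 2 C"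
    using prime_chain_without_relation[OF P'] none by (auto simp: P'_def)
  define D where "D n = {h. rename_vars \<rho> h \<in> C n}" for n
  have "D n \<subset> D (Suc n)" if n: "n < 2" for n
  proof -
    have "C n \<subset> C (Suc n)"
      using C n by (simp add: prime_chain_def)
    then obtain h where "h \<in> C (Suc n)" "h \<notin> C n" "C n \<subseteq> C (Suc n)"
      by blast
    then have "rename_vars \<tau> h \<in> D (Suc n)" "rename_vars \<tau> h \<notin> D n" "D n \<subseteq> D (Suc n)"
      by (auto simp: D_def inv)
    then show ?thesis by blast
  qed
  moreover have "primeideal (D n) cring_class_ops" if "n \<le> 2" for n
    unfolding D_def using C that by (intro primeideal_hom_vimage is_hom_rename_vars) (simp add: prime_chain_def)
  moreover have "P \<subseteq> D n" if "n \<le> 2" for n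
  proof -
    have "P' \<subseteq> C n"
      using C that by (simp add: prime_chain_def)
    then show ?thesis
      by (auto simp: D_def P'_def inv)
  qed
  ultimately have "prime_chain P 2 D"
    by (simp add: prime_chain_def)
  then have "enat 2 \<le> variety_dim P"
    using P by (intro variety_dim_ge) (auto simp: primeideal_class_iff)
  then show False
    using dim by (simp add: one_enat_def)
qed


section \<open>Separating the origin\<close>

lemma eval1_real: "eval1 (\<lambda>a. a) p s = poly p (s :: real)"
  by (simp add: eval1_def)

lemma eval2_at_0: "eval2 (\<lambda>a. a) h 0 t = poly (map_poly (\<lambda>r. poly r 0) h) (t :: real)"
  by (simp add: eval2_def eval1_real)

lemma eval2_as_sum:
  assumes c: "is_hom c" and h: "\<And>i. i \<ge> n \<Longrightarrow> coeff h i = 0"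
  shows "eval2 c h s t = (\<Sum>i<n. eval1 c (coeff h i) s * t ^ i)"
proof -
  have 0: "eval1 c 0 s = 0"
    by (simp add: eval1_simps[OF c])
  have coeff: "coeff (map_poly (\<lambda>r. eval1 c r s) h) i = eval1 c (coeff h i) s" for i
    by (simp add: coeff_map_poly 0)
  have deg: "degree (map_poly (\<lambda>r. eval1 c r s) h) \<le> m" if "n \<le> Suc m" for m
    using that h by (intro degree_le) (auto simp: coeff 0)
  have "eval2 c h s t = (\<Sum>i\<le>degree (map_poly (\<lambda>r. eval1 c r s) h). eval1 c (coeff h i) s * t ^ i)"
    by (simp add: eval2_def poly_altdef coeff)
  also have "\<dots> = (\<Sum>i\<le>degree (map_poly (\<lambda>r. eval1 c r s) h) + n. eval1 c (coeff h i) s * t ^ i)"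
    by (intro sum.mono_neutral_left) (auto simp: coeff[symmetric] coeff_eq_0)
  also have "\<dots> = (\<Sum>i<n. eval1 c (coeff h i) s * t ^ i)"
    by (intro sum.mono_neutral_right) (auto simp: h 0)
  finally show ?thesis .
qed

text \<open>A polynomial that does not vanish identically at \<open>S = 0\<close> remains when all factors \<open>S\<close> are
  removed.\<close>

lemma cancel_first_variable:
  fixes h :: poly2
  assumes "h \<noteq> 0"
  shows "\<exists>n h'. h = smult ([:0, 1:] ^ n) h' \<and> map_poly (\<lambda>r. poly r 0) h' \<noteq> 0"
proof -
  define p :: poly2 where "p = [:[:0, 1:]:]"
  have "\<not> is_unit p"
    by (auto simp: p_def is_unit_poly_iff)
  then obtain h' where h': "h = p ^ multiplicity p h * h'" "\<not> p dvd h'"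
    using multiplicity_decompose'[OF assms] by blast
  have pow: "p ^ n = [:[:0, 1:] ^ n:]" for n
    by (induction n) (auto simp: p_def one_pCons)
  obtain i where "\<not> [:0, 1:] dvd coeff h' i"
    using h'(2) unfolding p_def const_poly_dvd_iff by blast
  then have "poly (coeff h' i) 0 \<noteq> 0"
    using poly_eq_0_iff_dvd[of "coeff h' i" 0] by simp
  then have "coeff (map_poly (\<lambda>r. poly r 0) h') i \<noteq> 0"
    by (simp add: coeff_map_poly)
  then have "map_poly (\<lambda>r. poly r 0) h' \<noteq> 0"
    by (metis coeff_0)
  then show ?thesis
    using h'(1) unfolding pow by (intro exI[of _ "multiplicity p h"] exI[of _ h']) simp
qed

lemma eval2_smult: "is_hom c \<Longrightarrow> eval2 c (smult r h) s t = eval1 c r s * eval2 c h s t"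
  using eval2_hom(3)[of c "[:r:]" h s t] by (simp add: eval2_simps)

text \<open>A curve through the origin on which the coordinate that plays the role of \<open>x\<close> is not identically
  zero; \<open>x, y, z\<close> stand for the variables in the order given by \<open>\<sigma>\<close>.\<close>

locale space_curve =
  fixes P :: "poly3 set" and \<sigma> :: "3 \<Rightarrow> 3"
  assumes prime: "primeideal P cring_class_ops"
    and dim: "variety_dim P = 1"
    and origin: "0 \<in> variety P"
    and bij: "bij \<sigma>"
    and nonvanishing: "\<exists>p\<in>variety P. p $ \<sigma> 1 \<noteq> 0"
begin

abbreviation "x \<equiv> var (\<sigma> 1)"
abbreviation "y \<equiv> var (\<sigma> 2)"
abbreviation "z \<equiv> var (\<sigma> 3)"

lemma ideal_P: "0 \<in> P" "a \<in> P \<Longrightarrow> b \<in> P \<Longrightarrow> a + b \<in> P" "a \<in> P \<Longrightarrow> b \<in> P \<Longrightarrow> a - b \<in> P"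
    "a \<in> P \<Longrightarrow> c * a \<in> P"
  and prime_P: "a * b \<in> P \<Longrightarrow> a \<notin> P \<Longrightarrow> b \<in> P"
  using prime ideal_class_diff[of P a b]
  by (auto simp: primeideal_class_iff ideal_class_iff)

lemma ideal_P_right: "a \<in> P \<Longrightarrow> a * c \<in> P"
  using ideal_P(4) by (simp add: mult.commute)

lemma sum_P: "(\<And>i. i \<in> A \<Longrightarrow> f i \<in> P) \<Longrightarrow> sum f A \<in> P"
  by (induction A rule: infinite_finite_induct) (auto intro: ideal_P)

lemma sigma_distinct: "\<sigma> 1 \<noteq> \<sigma> 2" "\<sigma> 1 \<noteq> \<sigma> 3" "\<sigma> 2 \<noteq> \<sigma> 3"
  using bij by (auto simp: bij_def dest: injD)

lemma sigma_cases: "i = \<sigma> 1 \<or> i = \<sigma> 2 \<or> i = \<sigma> 3"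
  using bij exhaust_3 by (metis bij_pointE)

lemma x_notin: "x \<notin> P"
  using nonvanishing by (auto simp: variety_def eval3_var is_hom_of_real)

text \<open>After division by a power of \<open>x\<close>, a polynomial in \<open>x\<close> does not vanish at the origin, which lies on
  the curve. So \<open>x\<close> is transcendental modulo \<open>P\<close>.\<close>

lemma univariate_notin:
  assumes "g \<noteq> 0"
  shows "eval1 const g x \<notin> P"
proof
  assume g: "eval1 const g x \<in> P"
  obtain g' where g': "g = [:0, 1:] ^ order 0 g * g'" "\<not> [:0, 1:] dvd g'"
    using order_decomp[OF assms, of 0] by auto
  note hom = eval1_hom[OF is_hom_const]
  have "eval1 const g x = x ^ order 0 g * eval1 const g' x"
    by (subst g'(1)) (simp add: hom eval1_simps is_hom_const)
  then have "eval1 const g' x \<in> P"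
    using g prime_P[of "x ^ order 0 g"] primeideal_class_power[OF prime] x_notin by metis
  then have "rval (eval1 const g' x) 0 = 0"
    using origin by (simp add: zero_in_variety)
  then have "poly g' 0 = 0"
    by (simp add: eval3_eval1 is_hom_id rval_var eval1_real)
  then show False
    using g'(2) by (simp add: poly_eq_0_iff_dvd)
qed

lemma cancel_x: "x ^ n * a \<in> P \<Longrightarrow> a \<in> P"
  using prime_P primeideal_class_power[OF prime] x_notin by blast

lemma relation_nonzero_at_0:
  assumes "i \<noteq> \<sigma> 1"
  shows "\<exists>h. map_poly (\<lambda>r. poly r 0) h \<noteq> 0 \<and> eval2 const h x (var i) \<in> P"
proof -
  obtain h where h: "h \<noteq> 0" "eval2 const h x (var i) \<in> P"
    using curve_relation[OF prime dim, of "\<sigma> 1" i] assms by auto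
  obtain n h' where h': "h = smult ([:0, 1:] ^ n) h'" "map_poly (\<lambda>r. poly r 0) h' \<noteq> 0"
    using cancel_first_variable[OF h(1)] by blast
  have "x ^ n * eval2 const h' x (var i) \<in> P"
    using h(2) unfolding h'(1)
    by (simp add: eval2_smult eval1_hom eval1_simps is_hom_const)
  then show ?thesis
    using h'(2) cancel_x by blast
qed

text \<open>Relations between \<open>x\<close> and each of the other coordinates that do not become trivial at \<open>x = 0\<close>
  leave finitely many values for these coordinates there.\<close>

lemma finite_fibre_over_0: "finite {p \<in> real_points (variety P). p $ \<sigma> 1 = 0}"
proof -
  have "\<exists>R. finite R \<and> (\<forall>p\<in>real_points (variety P). p $ \<sigma> 1 = 0 \<longrightarrow> p $ i \<in> R)" if i: "i \<noteq> \<sigma> 1" for i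
  proof -
    obtain h where h: "map_poly (\<lambda>r. poly r 0) h \<noteq> 0" "eval2 const h x (var i) \<in> P"
      using relation_nonzero_at_0[OF i] by blast
    have "poly (map_poly (\<lambda>r. poly r 0) h) (p $ i) = 0"
      if "p \<in> real_points (variety P)" "p $ \<sigma> 1 = 0" for p
    proof -
      have "rval (eval2 const h x (var i)) p = 0"
        using that(1) h(2) by (simp add: real_points_variety)
      then show ?thesis
        using that(2) by (simp add: eval3_eval2 is_hom_id rval_var eval2_at_0)
    qed
    then show ?thesis
      using poly_roots_finite[OF h(1)] by blast
  qed
  then obtain R where R: "\<And>i. i \<noteq> \<sigma> 1 \<Longrightarrow> finite (R i)"
    "\<And>i p. i \<noteq> \<sigma> 1 \<Longrightarrow> p \<in> real_points (variety P) \<Longrightarrow> p $ \<sigma> 1 = 0 \<Longrightarrow> p $ i \<in> R i"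
    by metis
  define point where "point = (\<lambda>(b, c). \<chi> i. if i = \<sigma> 1 then 0 else if i = \<sigma> 2 then b else (c :: real))"
  have "p \<in> point ` (R (\<sigma> 2) \<times> R (\<sigma> 3))" if "p \<in> real_points (variety P)" "p $ \<sigma> 1 = 0" for p
  proof
    show "p = point (p $ \<sigma> 2, p $ \<sigma> 3)"
      using that(2) sigma_cases by (auto simp: point_def vec_eq_iff)
  qed (use that R(2) sigma_distinct in auto)
  then have "{p \<in> real_points (variety P). p $ \<sigma> 1 = 0} \<subseteq> point ` (R (\<sigma> 2) \<times> R (\<sigma> 3))"
    by auto
  moreover have "finite (point ` (R (\<sigma> 2) \<times> R (\<sigma> 3)))"
    using R(1)[of "\<sigma> 2"] R(1)[of "\<sigma> 3"] sigma_distinct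
    by (intro finite_imageI finite_cartesian_product) auto
  ultimately show ?thesis
    by (rule finite_subset)
qed

text \<open>\<open>z\<^sup>D K(x, y / z)\<close> for \<open>K\<close> of degree at most \<open>D\<close> in the second variable.\<close>

definition homogenised :: "nat \<Rightarrow> poly2 \<Rightarrow> poly3" where
  "homogenised D K = (\<Sum>i\<le>D. eval1 const (coeff K i) x * (y ^ i * z ^ (D - i)))"

text \<open>Modulo \<open>P\<close>, the monomials \<open>y\<^sup>i z\<^sup>D\<^sup>-\<^sup>i\<close> are combinations over \<open>\<real>(x)\<close> of the \<open>y\<^sup>s z\<^sup>t\<close>
  with \<open>s < a\<close> and \<open>t < b\<close>. For \<open>D = a b\<close> they are one too many to be independent.\<close>

lemma homogeneous_relation:
  "\<exists>D K. map_poly (\<lambda>r. poly r 0) K \<noteq> 0 \<and> (\<forall>i>D. coeff K i = 0) \<and> homogenised D K \<in> P"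
proof -
  \<comment> \<open>pseudo-division by \<open>G\<close> expresses the powers of \<open>w\<close>, up to a factor in \<open>\<real>[x]\<close>, by those below \<open>degree G\<close>\<close>
  have reduce: "\<exists>\<alpha> r. \<alpha> \<noteq> 0 \<and> (\<forall>s\<ge>degree G. coeff r s = 0) \<and>
      eval1 const \<alpha> x * w ^ i - eval2 const r x w \<in> P"
    if G: "G \<noteq> 0" "eval2 const G x w \<in> P" for G w i
  proof -
    obtain \<alpha> q where \<alpha>: "\<alpha> \<noteq> 0" "smult \<alpha> (monom 1 i) = G * q + pseudo_mod (monom 1 i) G"
      using pseudo_mod(1)[OF G(1)] by blast
    define r where "r = pseudo_mod (monom 1 i) G"
    have "coeff r s = 0" if "degree G \<le> s" for s
      using pseudo_mod(2)[OF G(1), of "monom 1 i"] that by (auto simp: r_def intro: coeff_eq_0)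
    moreover have "eval2 const (monom 1 i) x w = w ^ i"
      by (subst eval2_as_sum[where n = "Suc i"])
        (auto simp: is_hom_const eval1_hom)
    then have "eval1 const \<alpha> x * w ^ i - eval2 const r x w = eval2 const G x w * eval2 const q x w"
      using arg_cong[OF \<alpha>(2), of "\<lambda>h. eval2 const h x w"]
      by (simp add: eval2_smult eval2_hom is_hom_const r_def)
    ultimately show ?thesis
      using \<alpha>(1) ideal_P_right[OF G(2)] by metis
  qed
  obtain G F where G: "G \<noteq> 0" "eval2 const G x y \<in> P" and F: "F \<noteq> 0" "eval2 const F x z \<in> P"
    using curve_relation[OF prime dim] sigma_distinct by metis
  define a b D where "a = degree G" and "b = degree F" and "D = a * b"
  obtain \<alpha> r where \<alpha>: "\<And>i. \<alpha> i \<noteq> 0" "\<And>i s. s \<ge> a \<Longrightarrow> coeff (r i) s = 0"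
    "\<And>i. eval1 const (\<alpha> i) x * y ^ i - eval2 const (r i) x y \<in> P"
    using reduce[OF G] unfolding a_def by metis
  obtain \<beta> s where \<beta>: "\<And>i. \<beta> i \<noteq> 0" "\<And>i t. t \<ge> b \<Longrightarrow> coeff (s i) t = 0"
    "\<And>i. eval1 const (\<beta> i) x * z ^ i - eval2 const (s i) x z \<in> P"
    using reduce[OF F] unfolding b_def by metis
  have "card ({..<a} \<times> {..<b}) < card {..D}"
    by (simp add: D_def)
  then obtain c where c: "\<exists>i\<le>D. c i \<noteq> 0"
    "\<And>m n. m < a \<Longrightarrow> n < b \<Longrightarrow> (\<Sum>i\<le>D. c i * (coeff (r i) m * coeff (s (D - i)) n)) = 0"
    using underdetermined_system[of "{..<a} \<times> {..<b}" "{..D}" "\<lambda>(m, n) i. coeff (r i) m * coeff (s (D - i)) n"]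
    by fastforce
  define K where "K = (\<Sum>i\<le>D. monom (c i * (\<alpha> i * \<beta> (D - i))) i)"
  have coeff_K: "coeff K i = (if i \<le> D then c i * (\<alpha> i * \<beta> (D - i)) else 0)" for i
    by (simp add: K_def coeff_sum)
  have "K \<noteq> 0"
    using c(1) coeff_K \<alpha>(1) \<beta>(1) by (metis coeff_0 mult_eq_0_iff)
  define e where "e r = eval1 const r x" for r
  have e: "is_hom e"
    unfolding e_def by (intro is_hom_eval1 is_hom_const)
  define u v where "u i = e (\<alpha> i) * y ^ i" and "v i = e (\<beta> i) * z ^ i" for i
  define R S where "R i = eval2 const (r i) x y" and "S i = eval2 const (s i) x z" for i
  have "(\<Sum>i\<le>D. e (c i) * (R i * S (D - i))) = 0"
  proof -
    have "(\<Sum>i\<le>D. e (c i) * (R i * S (D - i))) =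
      (\<Sum>i\<le>D. e (c i) * ((\<Sum>m<a. e (coeff (r i) m) * y ^ m) * (\<Sum>n<b. e (coeff (s (D - i)) n) * z ^ n)))"
      using eval2_as_sum[OF is_hom_const \<alpha>(2)] eval2_as_sum[OF is_hom_const \<beta>(2)] by (simp add: R_def S_def e_def)
    also have "\<dots> = (\<Sum>i\<le>D. \<Sum>m<a. \<Sum>n<b. e (c i * (coeff (r i) m * coeff (s (D - i)) n)) * (y ^ m * z ^ n))"
      by (unfold sum_product, unfold sum_distrib_left) (simp add: is_hom_mult[OF e] mult_ac)
    also have "\<dots> = (\<Sum>m<a. \<Sum>n<b. \<Sum>i\<le>D. e (c i * (coeff (r i) m * coeff (s (D - i)) n)) * (y ^ m * z ^ n))"
      by (rule trans[OF sum.swap]) (intro sum.cong refl sum.swap)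
    also have "\<dots> = (\<Sum>m<a. \<Sum>n<b. e (\<Sum>i\<le>D. c i * (coeff (r i) m * coeff (s (D - i)) n)) * (y ^ m * z ^ n))"
      by (simp add: sum_distrib_right is_hom_sum[OF e])
    also have "\<dots> = 0"
      by (simp add: c(2) is_hom_0[OF e])
    finally show ?thesis .
  qed
  then have "homogenised D K = (\<Sum>i\<le>D. e (c i) * (u i * v (D - i))) - (\<Sum>i\<le>D. e (c i) * (R i * S (D - i)))"
    by (simp add: homogenised_def coeff_K u_def v_def is_hom_mult[OF e] mult_ac flip: e_def)
  also have "\<dots> = (\<Sum>i\<le>D. e (c i) * (u i * (v (D - i) - S (D - i)) + (u i - R i) * S (D - i)))"
    by (simp add: algebra_simps flip: sum_subtractf)
  also have "\<dots> \<in> P"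
    using \<alpha>(3) \<beta>(3)
    by (intro sum_P ideal_P(2,4) ideal_P_right[of "u _ - R _"]) (auto simp: u_def v_def R_def S_def e_def)
  finally have K: "homogenised D K \<in> P" .
  obtain n K' where K': "K = smult ([:0, 1:] ^ n) K'" "map_poly (\<lambda>r. poly r 0) K' \<noteq> 0"
    using cancel_first_variable[OF \<open>K \<noteq> 0\<close>] by blast
  have "homogenised D K = x ^ n * homogenised D K'"
    unfolding K'(1) homogenised_def sum_distrib_left
    by (simp add: eval1_hom[OF is_hom_const] eval1_simps[OF is_hom_const] mult.assoc)
  then have "homogenised D K' \<in> P"
    using K cancel_x by metis
  moreover have "coeff K' i = 0" if "i > D" for i
    using coeff_K[of i] that unfolding K'(1) by simp
  ultimately show ?thesis
    using K'(2) by blast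
qed

lemma norm_le_sigma: "norm (p :: real ^ 3) \<le> \<bar>p $ \<sigma> 1\<bar> + \<bar>p $ \<sigma> 2\<bar> + \<bar>p $ \<sigma> 3\<bar>"
proof -
  have "norm p \<le> (\<Sum>i\<in>UNIV. \<bar>p $ i\<bar>)"
    by (rule norm_le_l1_cart)
  also have "\<dots> = (\<Sum>i\<in>UNIV. \<bar>p $ \<sigma> i\<bar>)"
    using sum.reindex_bij_betw[OF bij, of "\<lambda>i. \<bar>p $ i\<bar>"] by simp
  finally show ?thesis
    by (simp add: sum_3)
qed

lemma proj_real: "proj \<sigma> \<kappa> p = (p $ \<sigma> 1, p $ \<sigma> 2 + \<kappa> * p $ \<sigma> 3)" for p :: "real ^ 3"
  by (simp add: proj_def)

lemma proj_components:
  "\<bar>p $ \<sigma> 1\<bar> \<le> norm (proj \<sigma> \<kappa> p)" "\<bar>p $ \<sigma> 2 + \<kappa> * p $ \<sigma> 3\<bar> \<le> norm (proj \<sigma> \<kappa> p)" for p :: "real ^ 3"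
  using norm_fst_le[of "p $ \<sigma> 1" "p $ \<sigma> 2 + \<kappa> * p $ \<sigma> 3"] norm_snd_le[of "p $ \<sigma> 2 + \<kappa> * p $ \<sigma> 3" "p $ \<sigma> 1"]
  by (simp_all add: proj_real)

lemma continuous_proj: "continuous_on A (proj \<sigma> \<kappa> :: real ^ 3 \<Rightarrow> real \<times> real)"
  unfolding proj_real[abs_def] by (intro continuous_intros)

text \<open>Where \<open>x\<close> and \<open>y + \<kappa> z\<close> are small but the point is far away, \<open>z\<close> has to be large, hence \<open>y / z\<close> is
  close to \<open>- \<kappa>\<close>. Dividing the homogeneous relation by \<open>z\<^sup>D\<close> and passing to the limit gives
  \<open>K(0, - \<kappa>) = 0\<close>.\<close>

lemma asymptotic_slope:
  fixes p :: "nat \<Rightarrow> real ^ 3"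
  assumes p: "\<And>n. p n \<in> real_points (variety P)" "\<And>n. norm (proj \<sigma> \<kappa> (p n)) < inverse (real (Suc n))"
      "\<And>n. norm (p n) \<ge> real n"
    and K: "homogenised D K \<in> P" "\<And>i. i > D \<Longrightarrow> coeff K i = 0"
  shows "poly (map_poly (\<lambda>r. poly r 0) K) (- \<kappa>) = 0"
proof -
  define X Y Z where "X n = p n $ \<sigma> 1" and "Y n = p n $ \<sigma> 2" and "Z n = p n $ \<sigma> 3" for n
  have small: "\<bar>X n\<bar> < inverse (real (Suc n))" "\<bar>Y n + \<kappa> * Z n\<bar> < inverse (real (Suc n))" for n
    using proj_components[of "p n" \<kappa>] p(2)[of n] by (auto simp: X_def Y_def Z_def)
  have X: "X \<longlonglongrightarrow> 0"
    by (rule tendsto_rabs_zero_cancel, rule tendsto_sandwich[OF _ _ tendsto_const LIMSEQ_inverse_real_of_nat])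
      (use small(1) in \<open>auto intro!: always_eventually less_imp_le\<close>)
  have U: "(\<lambda>n. Y n + \<kappa> * Z n) \<longlonglongrightarrow> 0"
    by (rule tendsto_rabs_zero_cancel, rule tendsto_sandwich[OF _ _ tendsto_const LIMSEQ_inverse_real_of_nat])
      (use small(2) in \<open>auto intro!: always_eventually less_imp_le\<close>)
  have Z_large: "real n - 2 \<le> (1 + \<bar>\<kappa>\<bar>) * \<bar>Z n\<bar>" for n
  proof -
    have "inverse (real (Suc n)) \<le> 1"
      by (simp add: inverse_le_1_iff)
    then have "\<bar>X n\<bar> \<le> 1" "\<bar>Y n + \<kappa> * Z n\<bar> \<le> 1"
      using small[of n] by linarith+
    moreover have "\<bar>Y n\<bar> \<le> \<bar>Y n + \<kappa> * Z n\<bar> + \<bar>\<kappa>\<bar> * \<bar>Z n\<bar>"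
      unfolding abs_mult[symmetric] by linarith
    moreover have "real n \<le> \<bar>X n\<bar> + \<bar>Y n\<bar> + \<bar>Z n\<bar>"
      using p(3)[of n] norm_le_sigma[of "p n"] by (simp add: X_def Y_def Z_def)
    ultimately show ?thesis
      by (simp add: algebra_simps)
  qed
  have Z_nonzero: "Z n \<noteq> 0" if "n \<ge> 3" for n
    using Z_large[of n] that by auto
  have "filterlim (\<lambda>n. (real n - 2) / (1 + \<bar>\<kappa>\<bar>)) at_top sequentially"
    by (intro filterlim_at_top_mult_tendsto_pos[of "\<lambda>_. inverse (1 + \<bar>\<kappa>\<bar>)" "inverse (1 + \<bar>\<kappa>\<bar>)", unfolded mult.commute[of "inverse _"] divide_inverse[symmetric]]
        tendsto_const filterlim_tendsto_add_at_top[of "\<lambda>_. -2" "-2" _ real, simplified] filterlim_real_sequentially)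
      (auto intro: add_pos_nonneg)
  then have "filterlim (\<lambda>n. \<bar>Z n\<bar>) at_top sequentially"
  proof (rule filterlim_at_top_mono)
    have "1 + \<bar>\<kappa>\<bar> > 0" by (simp add: add_pos_nonneg)
    then show "\<forall>\<^sub>F n in sequentially. (real n - 2) / (1 + \<bar>\<kappa>\<bar>) \<le> \<bar>Z n\<bar>"
      using Z_large by (intro always_eventually allI) (simp add: divide_le_eq mult.commute)
  qed
  then have "filterlim Z at_infinity sequentially"
    by (simp add: filterlim_at_infinity_conv_norm_at_top)
  then have "(\<lambda>n. (Y n + \<kappa> * Z n) / Z n) \<longlonglongrightarrow> 0"
    by (rule tendsto_divide_0[OF U])
  then have "(\<lambda>n. (Y n + \<kappa> * Z n) / Z n - \<kappa>) \<longlonglongrightarrow> 0 - \<kappa>"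
    by (intro tendsto_diff tendsto_const)
  moreover have "\<forall>\<^sub>F n in sequentially. (Y n + \<kappa> * Z n) / Z n - \<kappa> = Y n / Z n"
    using eventually_ge_at_top[of 3]
  proof eventually_elim
    case (elim n)
    then show ?case
      using Z_nonzero[of n] by (simp add: add_divide_distrib)
  qed
  ultimately have slope: "(\<lambda>n. Y n / Z n) \<longlonglongrightarrow> - \<kappa>"
    by (simp add: tendsto_cong)
  have lim: "(\<lambda>n. \<Sum>i\<le>D. poly (coeff K i) (X n) * (Y n / Z n) ^ i) \<longlonglongrightarrow>
      (\<Sum>i\<le>D. poly (coeff K i) 0 * (- \<kappa>) ^ i)"
    by (intro tendsto_sum tendsto_mult tendsto_power slope tendsto_poly X)
  have "\<forall>\<^sub>F n in sequentially. (\<Sum>i\<le>D. poly (coeff K i) (X n) * (Y n / Z n) ^ i) = 0"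
    using eventually_ge_at_top[of 3]
  proof eventually_elim
    case (elim n)
    have "rval (homogenised D K) (p n) = 0"
      using p(1) K(1) by (simp add: real_points_variety)
    then have "(\<Sum>i\<le>D. poly (coeff K i) (X n) * (Y n ^ i * Z n ^ (D - i))) = 0"
      by (simp add: homogenised_def is_hom_sum[OF is_hom_eval3[OF is_hom_id]] rval_hom eval3_eval1 is_hom_id
          rval_var eval1_real X_def Y_def Z_def)
    also have "(\<Sum>i\<le>D. poly (coeff K i) (X n) * (Y n ^ i * Z n ^ (D - i))) =
        Z n ^ D * (\<Sum>i\<le>D. poly (coeff K i) (X n) * (Y n / Z n) ^ i)"
      unfolding sum_distrib_left
    proof (rule sum.cong)
      fix i assume "i \<in> {..D}"
      then have "Z n ^ D = Z n ^ i * Z n ^ (D - i)"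
        by (simp flip: power_add)
      then show "poly (coeff K i) (X n) * (Y n ^ i * Z n ^ (D - i)) =
          Z n ^ D * (poly (coeff K i) (X n) * (Y n / Z n) ^ i)"
        using Z_nonzero[OF elim] by (simp add: power_divide)
    qed simp
    finally show ?case
      using Z_nonzero[OF elim] by simp
  qed
  then have "(\<lambda>n. \<Sum>i\<le>D. poly (coeff K i) (X n) * (Y n / Z n) ^ i) \<longlonglongrightarrow> 0"
    by (rule tendsto_eventually)
  from LIMSEQ_unique[OF lim this] have "(\<Sum>i\<le>D. poly (coeff K i) 0 * (- \<kappa>) ^ i) = 0" .
  moreover have "poly (map_poly (\<lambda>r. poly r 0) K) (- \<kappa>) = (\<Sum>i<Suc D. poly (coeff K i) 0 * (- \<kappa>) ^ i)"
    using eval2_as_sum[OF is_hom_id, of "Suc D" K 0 "- \<kappa>"] K(2) by (simp add: eval2_at_0 eval1_real)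
  ultimately show ?thesis
    by (simp add: lessThan_Suc_atMost)
qed

text \<open>\<open>B1\<close> consists of the \<open>\<kappa>\<close> for which a point over \<open>x = 0\<close> other than the origin is projected to \<open>(0, 0)\<close>,
  and \<open>B2\<close> contains the negatives of the slopes \<open>y / z\<close> at infinity. Outside \<open>B2\<close> the points with small projection are bounded, and
  outside \<open>B1\<close> the norm of the projection is bounded from below on the compact set of those
  among them that have norm at least \<open>\<epsilon>\<close>.\<close>

lemma finite_not_separating: "finite {\<kappa>. \<not> separates_origin P \<sigma> \<kappa>}"
proof -
  obtain D K where K: "map_poly (\<lambda>r. poly r 0) K \<noteq> 0" "\<forall>i>D. coeff K i = 0" "homogenised D K \<in> P"
    using homogeneous_relation by blast
  define K0 where "K0 = map_poly (\<lambda>r. poly r 0) K"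
  define V where "V = real_points (variety P)"
  define B1 where "B1 = (\<Union>p\<in>{p \<in> V. p $ \<sigma> 1 = 0} - {0}. {\<kappa>. p $ \<sigma> 2 + \<kappa> * p $ \<sigma> 3 = 0})"
  define B2 where "B2 = {\<kappa>. poly K0 (- \<kappa>) = 0}"
  have "finite {\<kappa>. p $ \<sigma> 2 + \<kappa> * p $ \<sigma> 3 = 0}" if p: "p \<in> {p \<in> V. p $ \<sigma> 1 = 0} - {0}" for p
  proof (cases "p $ \<sigma> 3 = 0")
    case True
    have "p $ \<sigma> 2 \<noteq> 0"
    proof
      assume "p $ \<sigma> 2 = 0"
      then have "p $ i = 0" for i
        using sigma_cases[of i] p True by auto
      then show False
        using p by (simp add: vec_eq_iff)
    qed
    then show ?thesis
      using True by simp
  next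
    case False
    then have "{\<kappa>. p $ \<sigma> 2 + \<kappa> * p $ \<sigma> 3 = 0} \<subseteq> {- p $ \<sigma> 2 / p $ \<sigma> 3}"
      by (auto simp: field_simps)
    then show ?thesis
      by (rule finite_subset) simp
  qed
  then have "finite B1"
    unfolding B1_def using finite_fibre_over_0 by (intro finite_UN_I) (auto simp: V_def)
  moreover have "finite B2"
  proof -
    have "B2 \<subseteq> uminus ` {t. poly K0 t = 0}"
      by (auto simp: B2_def image_iff) (metis minus_minus)
    then show ?thesis
      using poly_roots_finite[OF K(1)] by (auto simp: K0_def intro: finite_subset)
  qed
  moreover have "separates_origin P \<sigma> \<kappa>" if \<kappa>: "\<kappa> \<notin> B1" "\<kappa> \<notin> B2" for \<kappa>
  proof -
    have "\<exists>n. \<forall>p\<in>V. norm (proj \<sigma> \<kappa> p) < inverse (real (Suc n)) \<longrightarrow> norm p < real n"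
    proof (rule ccontr)
      assume "\<not> ?thesis"
      then have "\<forall>n. \<exists>p. p \<in> V \<and> norm (proj \<sigma> \<kappa> p) < inverse (real (Suc n)) \<and> norm p \<ge> real n"
        by (meson not_le)
      then obtain p where "\<And>n. p n \<in> V" "\<And>n. norm (proj \<sigma> \<kappa> (p n)) < inverse (real (Suc n))"
        "\<And>n. norm (p n) \<ge> real n"
        by metis
      then have "poly K0 (- \<kappa>) = 0"
        unfolding K0_def V_def using K(2,3) by (intro asymptotic_slope) auto
      then show False
        using \<kappa>(2) by (simp add: B2_def)
    qed
    then obtain N where N: "\<And>p. p \<in> V \<Longrightarrow> norm (proj \<sigma> \<kappa> p) < inverse (real (Suc N)) \<Longrightarrow> norm p < real N"
      by blast
    show ?thesis
      unfolding separates_origin_def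
    proof (intro allI impI)
      fix \<epsilon> :: real assume "\<epsilon> > 0"
      define C where "C = V \<inter> {p. \<epsilon> \<le> norm p} \<inter> cball 0 (real N)"
      have "closed {p :: real ^ 3. \<epsilon> \<le> norm p}"
        by (intro closed_Collect_le continuous_intros)
      then have "compact C"
        unfolding C_def V_def using closed_real_points by (intro closed_Int_compact closed_Int) auto
      have pos: "norm (proj \<sigma> \<kappa> p) > 0" if "p \<in> C" for p
      proof (rule ccontr)
        assume "\<not> ?thesis"
        then have "p $ \<sigma> 1 = 0" "p $ \<sigma> 2 + \<kappa> * p $ \<sigma> 3 = 0"
          by (auto simp: proj_real zero_prod_def)
        moreover have "p \<in> V" "p \<noteq> 0"
          using that \<open>\<epsilon> > 0\<close> by (auto simp: C_def)
        ultimately have "\<kappa> \<in> B1"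
          by (auto simp: B1_def)
        then show False
          using \<kappa>(1) by simp
      qed
      have "\<exists>m>0. \<forall>p\<in>C. m \<le> norm (proj \<sigma> \<kappa> p)"
      proof (cases "C = {}")
        case True
        then show ?thesis by (auto intro: exI[of _ 1])
      next
        case False
        have "continuous_on C (\<lambda>p. norm (proj \<sigma> \<kappa> p))"
          by (intro continuous_on_norm continuous_proj)
        then obtain p where "p \<in> C" "\<forall>p'\<in>C. norm (proj \<sigma> \<kappa> p) \<le> norm (proj \<sigma> \<kappa> p')"
          using continuous_attains_inf[OF \<open>compact C\<close> False] by blast
        then show ?thesis
          using pos by blast
      qed
      then obtain m where m: "m > 0" "\<And>p. p \<in> C \<Longrightarrow> m \<le> norm (proj \<sigma> \<kappa> p)"
        by blast
      have "norm p < \<epsilon>" if "p \<in> V" "norm (proj \<sigma> \<kappa> p) < min m (inverse (real (Suc N)))" for p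
      proof (rule ccontr)
        assume "\<not> ?thesis"
        moreover have "norm p < real N"
          using N that by simp
        ultimately have "p \<in> C"
          using that by (simp add: C_def)
        then show False
          using m(2)[of p] that by simp
      qed
      then show "\<exists>\<delta>>0. \<forall>p\<in>real_points (variety P). norm (proj \<sigma> \<kappa> p) < \<delta> \<longrightarrow> norm p < \<epsilon>"
        using m(1) by (intro exI[of _ "min m (inverse (real (Suc N)))"]) (auto simp: V_def)
    qed
  qed
  then have "{\<kappa>. \<not> separates_origin P \<sigma> \<kappa>} \<subseteq> B1 \<union> B2"
    by blast
  ultimately show ?thesis
    by (meson finite_UnI finite_subset)
qed

end


section \<open>Equations in the function field\<close>

text \<open>The aim is to turn equations between elements of the function field into congruences modulo
  \<open>P\<close>. Every member of a class of fractions is a pair of cosets \<open>(coset c, coset d)\<close>, so that the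
  classes can be handled through representatives in the ring.\<close>

locale prime_quotient =
  fixes P :: "'a::comm_ring_1 set"
  assumes prime: "primeideal P cring_class_ops"
begin

abbreviation "coset \<equiv> (\<lambda>h. P +>\<^bsub>cring_class_ops\<^esub> h)"
abbreviation "quot \<equiv> cring_class_ops Quot P"
abbreviation "fr \<equiv> (\<lambda>a b. fraction quot (coset a) (coset b))"

lemma ideal: "ideal P cring_class_ops"
  using prime by (simp add: primeideal_class_iff)

lemma P_simps: "0 \<in> P" "a \<in> P \<Longrightarrow> b \<in> P \<Longrightarrow> a + b \<in> P" "a \<in> P \<Longrightarrow> b \<in> P \<Longrightarrow> a - b \<in> P"
    "a \<in> P \<Longrightarrow> c * a \<in> P" "a * b \<in> P \<Longrightarrow> a \<notin> P \<Longrightarrow> b \<in> P" "1 \<notin> P"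
  using prime ideal_class_diff[of P a b] by (auto simp: primeideal_class_iff ideal_class_iff)

lemma coset_eq: "coset a = coset b \<longleftrightarrow> a - b \<in> P"
  by (rule coset_eq_iff[OF ideal])

lemma zero_quot: "\<zero>\<^bsub>quot\<^esub> = coset 0"
  by (simp add: coset_zero) (simp add: FactRing_def)

lemma one_quot: "\<one>\<^bsub>quot\<^esub> = coset 1"
  by (simp add: FactRing_def class_simps)

lemma carrier_nonzero: "carrier quot - {\<zero>\<^bsub>quot\<^esub>} = coset ` (- P)"
proof -
  have "coset h = coset 0 \<longleftrightarrow> h \<in> P" for h
    using coset_eq[of h 0] by simp
  then show ?thesis
    unfolding carrier_quot zero_quot by blast
qed

lemma mem_frac: "(coset c, coset d) \<in> fr a b \<longleftrightarrow> d \<notin> P \<and> a * d - c * b \<in> P"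
  by (auto simp: fraction_def carrier_quot zero_quot mult_quot[OF ideal] coset_eq)

lemma frac_elems: "u \<in> fr a b \<Longrightarrow> \<exists>c d. u = (coset c, coset d)"
  by (auto simp: fraction_def carrier_quot)

lemma frac_eq:
  assumes "b \<notin> P" "d \<notin> P"
  shows "fr a b = fr c d \<longleftrightarrow> a * d - c * b \<in> P"
proof
  assume "fr a b = fr c d"
  moreover have "(coset c, coset d) \<in> fr c d"
    using assms P_simps(1) by (simp add: mem_frac)
  ultimately have "(coset c, coset d) \<in> fr a b" by simp
  then show "a * d - c * b \<in> P"
    by (simp add: mem_frac)
next
  assume eq: "a * d - c * b \<in> P"
  have "c * f - e * d \<in> P" if "b \<notin> P" "a * d - c * b \<in> P" "a * f - e * b \<in> P" for a b c d e f
  proof -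
    have "b * (c * f - e * d) = d * (a * f - e * b) - f * (a * d - c * b)"
      by (simp add: algebra_simps)
    then have "b * (c * f - e * d) \<in> P"
      using that P_simps(3,4) by simp
    then show ?thesis
      using that(1) P_simps(5) by blast
  qed
  moreover have "c * b - a * d \<in> P"
    using P_simps(3)[OF P_simps(1) eq] by simp
  ultimately have iff: "a * f - e * b \<in> P \<longleftrightarrow> c * f - e * d \<in> P" for e f
    using eq assms by blast
  show "fr a b = fr c d"
  proof (rule Set.set_eqI)
    fix u show "u \<in> fr a b \<longleftrightarrow> u \<in> fr c d"
    proof (cases "\<exists>e f. u = (coset e, coset f)")
      case True
      then show ?thesis
        using iff by (auto simp: mem_frac)
    next
      case False
      then show ?thesis
        using frac_elems by blast
    qed
  qed
qed

lemma carrier_fraction_field: "carrier (fraction_field quot) = {fr a b | a b. b \<notin> P}"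
  unfolding fraction_field_def carrier_nonzero by (auto simp: carrier_quot)

lemma mult_frac:
  assumes "b \<notin> P" "d \<notin> P"
  shows "fr a b \<otimes>\<^bsub>fraction_field quot\<^esub> fr c d = fr (a * c) (b * d)"
proof -
  define F where "F = (\<lambda>((a, b), (c, d)). fraction quot (a \<otimes>\<^bsub>quot\<^esub> c) (b \<otimes>\<^bsub>quot\<^esub> d))"
  have *: "fr a b \<otimes>\<^bsub>fraction_field quot\<^esub> fr c d = \<Union> (F ` (fr a b \<times> fr c d))"
    by (simp add: fraction_field_def F_def)
  \<comment> \<open>the union that defines the product consists of equal sets\<close>
  have F: "F u = fr (a * c) (b * d)" if mem_u: "u \<in> fr a b \<times> fr c d" for u
  proof -
    obtain a' b' c' d' where u: "u = ((coset a', coset b'), (coset c', coset d'))"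
      using mem_u by (auto dest!: frac_elems)
    then have mem: "b' \<notin> P" "a * b' - a' * b \<in> P" "d' \<notin> P" "c * d' - c' * d \<in> P"
      using mem_u by (auto simp: mem_frac)
    have "(a' * c') * (b * d) - (a * c) * (b' * d') =
        - (c' * d) * (a * b' - a' * b) - (a * b') * (c * d' - c' * d)"
      by (simp add: algebra_simps)
    then have "(a' * c') * (b * d) - (a * c) * (b' * d') \<in> P"
      using P_simps(3)[OF P_simps(4)[OF mem(2), of "- (c' * d)"] P_simps(4)[OF mem(4), of "a * b'"]] by simp
    moreover have "b' * d' \<notin> P" "b * d \<notin> P"
      using mem assms P_simps(5) by blast+
    ultimately show ?thesis
      by (simp add: u F_def mult_quot[OF ideal] frac_eq)
  qed
  have "(coset a, coset b) \<in> fr a b" "(coset c, coset d) \<in> fr c d"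
    using assms P_simps(1) by (auto simp: mem_frac)
  then have "fr a b \<times> fr c d \<noteq> {}" by blast
  then show ?thesis
    unfolding * using F by auto
qed

lemma inv_frac:
  assumes "b \<notin> P"
  shows "inv\<^bsub>fraction_field quot\<^esub> (fr b 1) = fr 1 b"
proof -
  have one: "\<one>\<^bsub>fraction_field quot\<^esub> = fr 1 1"
    by (simp add: fraction_field_def one_quot)
  have eq_one: "fr c d = fr 1 1 \<longleftrightarrow> c - d \<in> P" if "d \<notin> P" for c d
    using frac_eq[OF that P_simps(6)] by simp
  have unique: "v = fr 1 b"
    if v: "v \<in> carrier (fraction_field quot)" "fr b 1 \<otimes>\<^bsub>fraction_field quot\<^esub> v = fr 1 1" for v
  proof -
    obtain c d where cd: "v = fr c d" "d \<notin> P"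
      using v(1) unfolding carrier_fraction_field by blast
    then have "b * c - d \<in> P"
      using v(2) by (simp add: mult_frac P_simps(6) eq_one)
    then show ?thesis
      using frac_eq[OF cd(2) assms, of c 1] by (simp add: cd(1) mult.commute)
  qed
  have "fr 1 b \<in> carrier (fraction_field quot)"
    using assms unfolding carrier_fraction_field by blast
  moreover have "fr b 1 \<otimes>\<^bsub>fraction_field quot\<^esub> fr 1 b = fr 1 1" "fr 1 b \<otimes>\<^bsub>fraction_field quot\<^esub> fr b 1 = fr 1 1"
    using assms P_simps(1) by (simp_all add: mult_frac P_simps(6) eq_one)
  ultimately show ?thesis
    unfolding m_inv_def one using unique by (intro the_equality) blast+
qed

lemma fraction_zero_iff: "fr k 1 = \<zero>\<^bsub>fraction_field quot\<^esub> \<longleftrightarrow> k \<in> P"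
proof -
  have "\<zero>\<^bsub>fraction_field quot\<^esub> = fr 0 1"
    by (simp only: fraction_field_def one_quot zero_quot ring.simps)
  then show ?thesis
    using frac_eq[OF P_simps(6,6)] by simp
qed

lemma fraction_eq_quotient_iff:
  assumes "b \<notin> P"
  shows "fr k 1 = fr a 1 \<otimes>\<^bsub>fraction_field quot\<^esub> inv\<^bsub>fraction_field quot\<^esub> (fr b 1) \<longleftrightarrow> k * b - a \<in> P"
  using assms by (simp add: inv_frac mult_frac P_simps(6) frac_eq)

end


section \<open>The plane model\<close>

lemma plane_ideal_iff:
  assumes "primeideal P cring_class_ops"
  shows "h \<in> plane_ideal P \<sigma> \<kappa> \<longleftrightarrow> eval2 const h (var (\<sigma> 1)) (lin_form \<sigma> \<kappa>) \<in> P"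
  by (simp add: plane_ideal_def a_kernel_def' carrier_class to_function_field_def function_field_def
      prime_quotient.fraction_zero_iff[OF prime_quotient.intro[OF assms]])

lemma eval2_of_real: "eval2 of_real h (of_real d) (of_real e) = (of_real (eval2 (\<lambda>a. a) h d e) :: complex)"
  using eval2_hom_comp[OF is_hom_of_real[where 'a = complex] is_hom_id, of h d e] by simp

lemma eval1_of_real: "eval1 of_real h (of_real d) = (of_real (poly h d) :: complex)"
  using eval1_hom_comp[OF is_hom_of_real[where 'a = complex] is_hom_id, of h d] by (simp add: eval1_real)

lemma real_points_plane_curve0:
  assumes "primeideal P cring_class_ops"
  shows "(d, e) \<in> real_points2 (plane_curve0 P \<sigma> \<kappa> g1 g2) \<longleftrightarrow>
    (\<forall>h. eval2 const h (var (\<sigma> 1)) (lin_form \<sigma> \<kappa>) \<in> P \<longrightarrow> eval2 (\<lambda>a. a) h d e = 0) \<and>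
    poly g1 d \<noteq> 0 \<and> poly g2 d \<noteq> 0"
  by (auto simp: real_points2_def plane_curve0_def plane_curve_def plane_ideal_iff[OF assms]
      eval2_of_real eval1_of_real)

lemma real_points_space_curve0:
  "real_points (space_curve0 P \<sigma> \<kappa> g1 g2) =
    {p \<in> real_points (variety P). proj \<sigma> \<kappa> p \<in> real_points2 (plane_curve0 P \<sigma> \<kappa> g1 g2)}"
  by (auto simp: real_points_def space_curve0_def proj_def real_points2_def)

locale plane_curve_model = space_curve +
  fixes \<kappa> :: real and f1 :: poly2 and g1 :: "real poly" and f2 :: poly2 and g2 :: "real poly"
  assumes model: "plane_model P \<sigma> \<kappa> f1 g1 f2 g2"
begin

abbreviation "u \<equiv> lin_form \<sigma> \<kappa>"
abbreviation "\<mu> \<equiv> (proj \<sigma> \<kappa> :: real ^ 3 \<Rightarrow> real \<times> real)"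
abbreviation "\<mu>' \<equiv> proj_inv \<sigma> f1 g1 f2 g2"
abbreviation "X \<equiv> real_points (variety P)"
abbreviation "X0 \<equiv> real_points (space_curve0 P \<sigma> \<kappa> g1 g2)"
abbreviation "Y0 \<equiv> real_points2 (plane_curve0 P \<sigma> \<kappa> g1 g2)"

lemma denominators_nonzero: "g1 \<noteq> 0" "g2 \<noteq> 0"
  using model by (auto simp: plane_model_def)

text \<open>The equations \<open>y = f\<^sub>1(x, u) / g\<^sub>1(x)\<close> and \<open>z = f\<^sub>2(x, u) / g\<^sub>2(x)\<close> without denominators.\<close>

lemma coordinate_equations:
  "y * eval1 const g1 x - eval2 const f1 x u \<in> P" "z * eval1 const g2 x - eval2 const f2 x u \<in> P"
  using model univariate_notin denominators_nonzero
  by (simp_all add: plane_model_def represents_def to_function_field_def function_field_def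
      prime_quotient.fraction_eq_quotient_iff[OF prime_quotient.intro[OF prime]])

lemma rval_u: "rval u p = p $ \<sigma> 2 + \<kappa> * p $ \<sigma> 3"
  by (simp add: lin_form_def rval_hom rval_var rval_const)

lemma rval_relation: "rval (eval2 const h x u) p = eval2 (\<lambda>a. a) h (fst (\<mu> p)) (snd (\<mu> p))"
  by (simp add: eval3_eval2 is_hom_id rval_var rval_u proj_real)

lemma \<mu>_in_Y0:
  assumes "p \<in> X" "poly g1 (p $ \<sigma> 1) \<noteq> 0" "poly g2 (p $ \<sigma> 1) \<noteq> 0"
  shows "\<mu> p \<in> Y0" and "\<mu>' (\<mu> p) = p"
proof -
  have vanish: "rval h p = 0" if "h \<in> P" for h
    using assms(1) that by (simp add: real_points_variety)
  have "eval2 (\<lambda>a. a) h (fst (\<mu> p)) (snd (\<mu> p)) = 0" if "eval2 const h x u \<in> P" for h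
    using vanish[OF that] unfolding rval_relation .
  then have "(fst (\<mu> p), snd (\<mu> p)) \<in> Y0"
    unfolding real_points_plane_curve0[OF prime] using assms by (auto simp: proj_real)
  then show "\<mu> p \<in> Y0" by simp
  have "p $ \<sigma> 2 * poly g1 (p $ \<sigma> 1) = eval2 (\<lambda>a. a) f1 (fst (\<mu> p)) (snd (\<mu> p))"
    "p $ \<sigma> 3 * poly g2 (p $ \<sigma> 1) = eval2 (\<lambda>a. a) f2 (fst (\<mu> p)) (snd (\<mu> p))"
    using vanish[OF coordinate_equations(1)] vanish[OF coordinate_equations(2)]
    by (simp_all add: rval_hom rval_relation rval_var eval3_eval1 is_hom_id eval1_real)
  then have coord: "eval2 (\<lambda>a. a) f1 (fst (\<mu> p)) (snd (\<mu> p)) / poly g1 (p $ \<sigma> 1) = p $ \<sigma> 2"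
    "eval2 (\<lambda>a. a) f2 (fst (\<mu> p)) (snd (\<mu> p)) / poly g2 (p $ \<sigma> 1) = p $ \<sigma> 3"
    using assms(2,3) by (simp_all add: divide_eq_eq)
  have "\<mu>' (\<mu> p) $ i = p $ i" for i
    using sigma_cases[of i] sigma_distinct coord by (auto simp: proj_inv_def proj_real)
  then show "\<mu>' (\<mu> p) = p"
    by (simp add: vec_eq_iff)
qed

lemma proj_inv_components:
  "\<mu>' (d, e) $ \<sigma> 1 = d" "\<mu>' (d, e) $ \<sigma> 2 = eval2 (\<lambda>a. a) f1 d e / poly g1 d"
  "\<mu>' (d, e) $ \<sigma> 3 = eval2 (\<lambda>a. a) f2 d e / poly g2 d"
  using sigma_distinct by (auto simp: proj_inv_def)

text \<open>Up to a power of the denominators, every polynomial in \<open>x, y, z\<close> is one in \<open>x, u\<close>, both modulo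
  \<open>P\<close> and at the points given by the formulas for the inverse: substitute these formulas.\<close>

lemma clear_denominators:
  "\<exists>N H. eval1 const (g1 * g2) x ^ N * h - eval2 const H x u \<in> P \<and>
    (\<forall>d e. poly g1 d \<noteq> 0 \<longrightarrow> poly g2 d \<noteq> 0 \<longrightarrow>
      eval2 (\<lambda>a. a) H d e = poly (g1 * g2) d ^ N * rval h (\<mu>' (d, e)))"
proof (induction h rule: poly3_generated)
  case (1 a)
  show ?case
    by (rule exI[of _ 0], rule exI[of _ "[:[:a:]:]"])
      (simp add: eval2_simps eval1_simps is_hom_const is_hom_id rval_const ideal_P)
next
  case (2 i)
  note simps = eval2_simps eval1_simps is_hom_const is_hom_id rval_var ideal_P(1) proj_inv_components
    eval2_smult eval1_hom eval1_real
  consider "i = \<sigma> 1" | "i = \<sigma> 2" | "i = \<sigma> 3"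
    using sigma_cases by blast
  then show ?case
  proof cases
    case 1
    then show ?thesis
      by (intro exI[of _ 0] exI[of _ "[:[:0, 1:]:]"]) (simp add: simps)
  next
    case 2
    have "eval1 const g2 x * (y * eval1 const g1 x - eval2 const f1 x u) \<in> P"
      using coordinate_equations(1) by (rule ideal_P)
    then show ?thesis
      using 2 by (intro exI[of _ 1] exI[of _ "smult g2 f1"]) (simp add: simps algebra_simps)
  next
    case 3
    have "eval1 const g1 x * (z * eval1 const g2 x - eval2 const f2 x u) \<in> P"
      using coordinate_equations(2) by (rule ideal_P)
    then show ?thesis
      using 3 by (intro exI[of _ 1] exI[of _ "smult g1 f2"]) (simp add: simps algebra_simps)
  qed
next
  case (3 p q)
  define G where "G = eval1 const (g1 * g2) x"
  obtain N H where H: "G ^ N * p - eval2 const H x u \<in> P"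
    "\<And>d e. poly g1 d \<noteq> 0 \<Longrightarrow> poly g2 d \<noteq> 0 \<Longrightarrow> eval2 (\<lambda>a. a) H d e = poly (g1 * g2) d ^ N * rval p (\<mu>' (d, e))"
    using 3(1) unfolding G_def by blast
  obtain M K where K: "G ^ M * q - eval2 const K x u \<in> P"
    "\<And>d e. poly g1 d \<noteq> 0 \<Longrightarrow> poly g2 d \<noteq> 0 \<Longrightarrow> eval2 (\<lambda>a. a) K d e = poly (g1 * g2) d ^ M * rval q (\<mu>' (d, e))"
    using 3(2) unfolding G_def by blast
  define R where "R = smult ((g1 * g2) ^ M) H + smult ((g1 * g2) ^ N) K"
  have "eval2 const R x u = G ^ M * eval2 const H x u + G ^ N * eval2 const K x u"
    unfolding R_def G_def by (simp add: eval2_hom eval2_smult eval1_hom is_hom_const)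
  then have "G ^ (N + M) * (p + q) - eval2 const R x u =
      G ^ M * (G ^ N * p - eval2 const H x u) + G ^ N * (G ^ M * q - eval2 const K x u)"
    by (simp add: power_add algebra_simps)
  also have "\<dots> \<in> P"
    using H(1) K(1) by (intro ideal_P(2,4))
  finally have "G ^ (N + M) * (p + q) - eval2 const R x u \<in> P" .
  moreover have "eval2 (\<lambda>a. a) R d e = poly (g1 * g2) d ^ (N + M) * rval (p + q) (\<mu>' (d, e))"
    if "poly g1 d \<noteq> 0" "poly g2 d \<noteq> 0" for d e
    unfolding R_def using H(2)[OF that] K(2)[OF that]
    by (simp add: eval2_hom eval2_smult eval1_real is_hom_id rval_hom power_add power_mult_distrib algebra_simps)
  ultimately show ?case
    unfolding G_def by blast
next
  case (4 p q)
  define G where "G = eval1 const (g1 * g2) x"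
  obtain N H where H: "G ^ N * p - eval2 const H x u \<in> P"
    "\<And>d e. poly g1 d \<noteq> 0 \<Longrightarrow> poly g2 d \<noteq> 0 \<Longrightarrow> eval2 (\<lambda>a. a) H d e = poly (g1 * g2) d ^ N * rval p (\<mu>' (d, e))"
    using 4(1) unfolding G_def by blast
  obtain M K where K: "G ^ M * q - eval2 const K x u \<in> P"
    "\<And>d e. poly g1 d \<noteq> 0 \<Longrightarrow> poly g2 d \<noteq> 0 \<Longrightarrow> eval2 (\<lambda>a. a) K d e = poly (g1 * g2) d ^ M * rval q (\<mu>' (d, e))"
    using 4(2) unfolding G_def by blast
  have "G ^ (N + M) * (p * q) - eval2 const (H * K) x u =
      (G ^ M * q) * (G ^ N * p - eval2 const H x u) + eval2 const H x u * (G ^ M * q - eval2 const K x u)"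
    by (simp add: power_add algebra_simps eval2_hom is_hom_const)
  also have "\<dots> \<in> P"
    using H(1) K(1) by (intro ideal_P(2,4))
  finally have "G ^ (N + M) * (p * q) - eval2 const (H * K) x u \<in> P" .
  moreover have "eval2 (\<lambda>a. a) (H * K) d e = poly (g1 * g2) d ^ (N + M) * rval (p * q) (\<mu>' (d, e))"
    if "poly g1 d \<noteq> 0" "poly g2 d \<noteq> 0" for d e
    using H(2)[OF that] K(2)[OF that]
    by (simp add: eval2_hom is_hom_id rval_hom power_add mult_ac)
  ultimately show ?case
    unfolding G_def by blast
qed

text \<open>For \<open>h \<in> P\<close> the polynomial \<open>H\<close> of \<open>clear_denominators\<close> belongs to the ideal of the plane curve, so \<open>h\<close>
  vanishes at the image. Applied to \<open>u\<close> itself, the same argument shows that the image is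
  projected back.\<close>

lemma proj_inv_in_X:
  assumes "w \<in> Y0"
  shows "\<mu>' w \<in> X" and "\<mu> (\<mu>' w) = w"
proof -
  obtain d e where w: "w = (d, e)" by fastforce
  have Y: "\<And>h. eval2 const h x u \<in> P \<Longrightarrow> eval2 (\<lambda>a. a) h d e = 0" and nz: "poly g1 d \<noteq> 0" "poly g2 d \<noteq> 0"
    using assms unfolding w real_points_plane_curve0[OF prime] by auto
  have "rval h (\<mu>' w) = 0" if "h \<in> P" for h
  proof -
    obtain N H where H: "eval1 const (g1 * g2) x ^ N * h - eval2 const H x u \<in> P"
      "eval2 (\<lambda>a. a) H d e = poly (g1 * g2) d ^ N * rval h (\<mu>' (d, e))"
      using clear_denominators[of h] nz by blast
    have "eval2 const H x u = eval1 const (g1 * g2) x ^ N * h - (eval1 const (g1 * g2) x ^ N * h - eval2 const H x u)"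
      by simp
    also have "\<dots> \<in> P"
      using ideal_P(3)[OF ideal_P(4)[OF that] H(1)] .
    finally show ?thesis
      using Y H(2) nz by (simp add: w)
  qed
  then show "\<mu>' w \<in> X"
    by (simp add: real_points_variety)
  obtain N H where H: "eval1 const (g1 * g2) x ^ N * u - eval2 const H x u \<in> P"
      "eval2 (\<lambda>a. a) H d e = poly (g1 * g2) d ^ N * rval u (\<mu>' (d, e))"
    using clear_denominators[of u] nz by blast
  have "eval2 const (smult ((g1 * g2) ^ N) [:0, 1:] - H) x u \<in> P"
    using H(1) by (simp only: eval2_hom eval2_smult eval2_simps eval1_hom is_hom_const)
  from Y[OF this] have "poly (g1 * g2) d ^ N * e = eval2 (\<lambda>a. a) H d e"
    by (simp only: eval2_hom eval2_smult eval2_simps eval1_real is_hom_id poly_power right_minus_eq)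
  then have "rval u (\<mu>' (d, e)) = e"
    using H(2) nz by simp
  then show "\<mu> (\<mu>' w) = w"
    by (simp add: w proj_real rval_u proj_inv_components)
qed

lemma X0_subset: "X0 \<subseteq> X"
  by (auto simp: real_points_space_curve0)

text \<open>Near the origin a root of a polynomial in \<open>x\<close> can only be \<open>x = 0\<close>, and the curve has finitely many
  points there.\<close>

lemma near_origin_in_Y0: "\<forall>\<^sub>F p in at 0 within X. \<mu> p \<in> Y0 \<and> \<mu>' (\<mu> p) = p \<and> \<mu> p \<noteq> 0"
proof -
  define B where "B = {p \<in> X. p $ \<sigma> 1 = 0} - {0}"
  have "finite B"
    using finite_fibre_over_0 by (simp add: B_def)
  then have "open (- B)"
    by (intro open_Compl finite_imp_closed)
  moreover have "0 \<in> - B"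
    by (simp add: B_def)
  ultimately have "\<forall>\<^sub>F p in nhds 0. p \<in> - B"
    by (rule eventually_nhds_in_open)
  then have "\<forall>\<^sub>F p in at 0 within X. p \<notin> B"
    unfolding eventually_at_filter by (rule eventually_mono) auto
  moreover have "\<forall>\<^sub>F p in at 0 within X. poly g (p $ \<sigma> 1) \<noteq> 0 \<or> p $ \<sigma> 1 = 0" if "g \<noteq> 0" for g :: "real poly"
  proof -
    define R where "R = {t. poly g t = 0} - {0}"
    have "finite R"
      unfolding R_def using poly_roots_finite[OF that] by simp
    then have "open (- R)"
      by (intro open_Compl finite_imp_closed)
    then have "\<forall>\<^sub>F t in nhds 0. t \<in> - R"
      by (rule eventually_nhds_in_open) (simp add: R_def)
    moreover have "((\<lambda>p :: real ^ 3. p $ \<sigma> 1) \<longlongrightarrow> 0) (at 0 within X)"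
      using tendsto_vec_nth[OF tendsto_ident_at[of "0 :: real ^ 3" X], of "\<sigma> 1"] by simp
    ultimately have "\<forall>\<^sub>F p in at 0 within X. p $ \<sigma> 1 \<in> - R"
      unfolding filterlim_iff by blast
    then show ?thesis
      by eventually_elim (auto simp: R_def)
  qed
  note this[OF denominators_nonzero(1)] this[OF denominators_nonzero(2)]
  moreover have "\<forall>\<^sub>F p in at 0 within X. p \<in> X \<and> p \<noteq> 0"
    by (simp add: eventually_at_filter)
  ultimately show ?thesis
  proof eventually_elim
    case (elim p)
    then have "p $ \<sigma> 1 \<noteq> 0"
      by (auto simp: B_def)
    then show ?case
      using \<mu>_in_Y0[of p] elim by (auto simp: proj_real zero_prod_def)
  qed
qed

lemma tendsto_\<mu>: "filterlim \<mu> (at (0, 0) within Y0) (at 0 within X)"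
proof -
  have "isCont \<mu> 0"
    using continuous_proj[of UNIV \<kappa>] by (simp add: continuous_on_eq_continuous_at)
  then have "(\<mu> \<longlongrightarrow> (0, 0)) (at 0 within X)"
    using tendsto_within_subset[of \<mu> "nhds (0, 0)" 0 UNIV X] by (simp add: isCont_def proj_real)
  then show ?thesis
    using near_origin_in_Y0 by (auto simp: filterlim_at zero_prod_def elim: eventually_mono)
qed

lemma space_limit_if_plane_limit:
  assumes "plane_limit q P \<sigma> \<kappa> f1 g1 f2 g2 M"
  shows "limit_along q (variety P) M"
proof -
  have "((\<lambda>p. (q \<circ> \<mu>') (\<mu> p)) \<longlongrightarrow> M) (at 0 within X)"
    using assms tendsto_\<mu> unfolding plane_limit_def by (rule filterlim_compose)
  moreover have "\<forall>\<^sub>F p in at 0 within X. (q \<circ> \<mu>') (\<mu> p) = q p"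
    using near_origin_in_Y0 by eventually_elim simp
  ultimately show ?thesis
    unfolding limit_along_def by (simp cong: tendsto_cong)
qed

text \<open>Separation of the origin says that the inverse of the projection tends to the origin at
  \<open>(0, 0)\<close>.\<close>

lemma plane_limit_if_space_limit:
  assumes sep: "separates_origin P \<sigma> \<kappa>"
    and lim: "limit_along q (space_curve0 P \<sigma> \<kappa> g1 g2) M"
  shows "plane_limit q P \<sigma> \<kappa> f1 g1 f2 g2 M"
proof -
  have "(\<mu>' \<longlongrightarrow> 0) (at (0, 0) within Y0)"
  proof (rule tendstoI)
    fix \<epsilon> :: real assume "\<epsilon> > 0"
    then obtain \<delta> where \<delta>: "\<delta> > 0" "\<And>p. p \<in> X \<Longrightarrow> norm (\<mu> p) < \<delta> \<Longrightarrow> norm p < \<epsilon>"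
      using sep unfolding separates_origin_def by blast
    have "norm (\<mu>' w) < \<epsilon>" if "w \<in> Y0" "norm w < \<delta>" for w
      using \<delta>(2) proj_inv_in_X[OF that(1)] that(2) by simp
    then show "\<forall>\<^sub>F w in at (0, 0) within Y0. dist (\<mu>' w) 0 < \<epsilon>"
      using \<delta>(1) unfolding eventually_at by (auto simp: dist_norm zero_prod_def[symmetric])
  qed
  moreover have "\<forall>\<^sub>F w in at (0, 0) within Y0. \<mu>' w \<in> X0 \<and> \<mu>' w \<noteq> 0"
  proof -
    have "\<forall>\<^sub>F w in at (0, 0) within Y0. w \<in> Y0 \<and> w \<noteq> (0, 0)"
      by (simp add: eventually_at_filter)
    then show ?thesis
    proof eventually_elim
      case (elim w)
      have "\<mu>' w \<noteq> 0"
        using proj_inv_in_X(2)[of w] elim by (auto simp: proj_real)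
      then show ?case
        using proj_inv_in_X[of w] elim by (simp add: real_points_space_curve0)
    qed
  qed
  ultimately have "filterlim \<mu>' (at 0 within X0) (at (0, 0) within Y0)"
    by (simp add: filterlim_at)
  then show ?thesis
    using lim unfolding plane_limit_def limit_along_def comp_def by (metis filterlim_compose)
qed

lemma limit_along_X0: "limit_along q (variety P) M \<Longrightarrow> limit_along q (space_curve0 P \<sigma> \<kappa> g1 g2) M"
  unfolding limit_along_def using tendsto_within_subset[OF _ X0_subset] by blast

end

theorem theorem19:
  fixes f g :: poly3 and L :: real
  assumes "rational_coeffs f" "rational_coeffs g"
    and "isolated_zero g"
    and "variety (disc_ideal f g) \<noteq> UNIV"
  shows "((quotient_fun f g \<longlongrightarrow> L) (at 0) \<longleftrightarrow>
      (\<forall>P\<in>relevant_components f g 1 \<union> relevant_components f g 2.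
        limit_along (quotient_fun f g) (variety P) L)) \<and>
    (\<forall>P\<in>relevant_components f g 1. \<forall>\<sigma>.
      bij \<sigma> \<and> (\<exists>p\<in>variety P. p $ \<sigma> 1 \<noteq> 0) \<longrightarrow>
      finite {\<kappa>. \<not> separates_origin P \<sigma> \<kappa>} \<and>
      (\<forall>\<kappa> f1 g1 f2 g2. plane_model P \<sigma> \<kappa> f1 g1 f2 g2 \<longrightarrow>
        (\<forall>M. plane_limit (quotient_fun f g) P \<sigma> \<kappa> f1 g1 f2 g2 M \<longrightarrow>
             limit_along (quotient_fun f g) (variety P) M) \<and>
        (separates_origin P \<sigma> \<kappa> \<longrightarrow>
          ((\<exists>M. limit_along (quotient_fun f g) (variety P) M) \<longleftrightarrow>
           (\<exists>M. plane_limit (quotient_fun f g) P \<sigma> \<kappa> f1 g1 f2 g2 M)) \<and>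
          (\<forall>M. limit_along (quotient_fun f g) (space_curve0 P \<sigma> \<kappa> g1 g2) M \<longleftrightarrow>
               plane_limit (quotient_fun f g) P \<sigma> \<kappa> f1 g1 f2 g2 M)))) \<and>
    (\<forall>P\<in>relevant_components f g 2. \<forall>h A B C.
      irreducible h \<and> variety P = variety {h} \<and> A > 0 \<and> B > 0 \<and> C > 0 \<and>
      (\<forall>Q\<in>component_primes (crit_ideal h A B C). variety_dim Q < 2) \<longrightarrow>
      (limit_along (quotient_fun f g) (variety P) L \<longleftrightarrow>
       (\<forall>Q\<in>component_primes (sing_ideal h) \<union> component_primes (crit_ideal h A B C) \<union>
           component_primes (tangency_ideal h A B C). limit_along (quotient_fun f g) (variety Q) L)))"
proof (intro conjI ballI allI impI)
  show "(quotient_fun f g \<longlongrightarrow> L) (at 0) \<longleftrightarrow>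
      (\<forall>P\<in>relevant_components f g 1 \<union> relevant_components f g 2.
        limit_along (quotient_fun f g) (variety P) L)"
    by (rule limit_iff_limits_along_components[OF assms(3,4)])
next
  fix P and \<sigma> :: "3 \<Rightarrow> 3"
  assume P: "P \<in> relevant_components f g 1" and \<sigma>: "bij \<sigma> \<and> (\<exists>p\<in>variety P. p $ \<sigma> 1 \<noteq> 0)"
  interpret space_curve P \<sigma>
  proof (rule space_curve.intro)
    show "primeideal P cring_class_ops" "variety_dim P = 1" "0 \<in> variety P"
      using P by (simp_all add: relevant_components_def minimal_primes_def)
  qed (use \<sigma> in blast)+
  show "finite {\<kappa>. \<not> separates_origin P \<sigma> \<kappa>}"
    by (rule finite_not_separating)
  fix \<kappa> f1 g1 f2 g2 assume model: "plane_model P \<sigma> \<kappa> f1 g1 f2 g2"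
  interpret plane_curve_model P \<sigma> \<kappa> f1 g1 f2 g2
    by (rule plane_curve_model.intro[OF space_curve_axioms plane_curve_model_axioms.intro[OF model]])
  show "limit_along (quotient_fun f g) (variety P) M"
    if "plane_limit (quotient_fun f g) P \<sigma> \<kappa> f1 g1 f2 g2 M" for M
    using that by (rule space_limit_if_plane_limit)
  assume sep: "separates_origin P \<sigma> \<kappa>"
  have eq: "limit_along (quotient_fun f g) (space_curve0 P \<sigma> \<kappa> g1 g2) M \<longleftrightarrow>
      plane_limit (quotient_fun f g) P \<sigma> \<kappa> f1 g1 f2 g2 M" for M
    using plane_limit_if_space_limit[OF sep, of "quotient_fun f g" M]
      space_limit_if_plane_limit[of "quotient_fun f g" M, THEN limit_along_X0] by blast
  then show "limit_along (quotient_fun f g) (space_curve0 P \<sigma> \<kappa> g1 g2) M \<longleftrightarrow>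
      plane_limit (quotient_fun f g) P \<sigma> \<kappa> f1 g1 f2 g2 M" for M .
  have "limit_along (quotient_fun f g) (variety P) M \<longleftrightarrow>
      plane_limit (quotient_fun f g) P \<sigma> \<kappa> f1 g1 f2 g2 M" for M
    using eq[of M] limit_along_X0[of "quotient_fun f g" M]
      space_limit_if_plane_limit[of "quotient_fun f g" M] by blast
  then show "(\<exists>M. limit_along (quotient_fun f g) (variety P) M) \<longleftrightarrow>
      (\<exists>M. plane_limit (quotient_fun f g) P \<sigma> \<kappa> f1 g1 f2 g2 M)"
    by simp
next
  fix P h A B C
  assume "P \<in> relevant_components f g 2"
  then have "P \<in> component_primes (disc_ideal f g)"
    by (simp add: relevant_components_def)
  moreover assume "irreducible h \<and> variety P = variety {h} \<and> A > 0 \<and> B > 0 \<and> C > 0 \<and>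
      (\<forall>Q\<in>component_primes (crit_ideal h A B C). variety_dim Q < 2)"
  then have "variety P = variety {h}"
    by (elim conjE)
  ultimately show "limit_along (quotient_fun f g) (variety P) L \<longleftrightarrow>
       (\<forall>Q\<in>component_primes (sing_ideal h) \<union> component_primes (crit_ideal h A B C) \<union>
           component_primes (tangency_ideal h A B C). limit_along (quotient_fun f g) (variety Q) L)"
    by (rule surface_limit[OF assms(3)])
qed

end
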